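(* Let $D$ be a Borel directed graph of bounded degree on a standard Borel space $X$. Assume that no connected component of $D$ is a Gallai tree. Then $D$ is Borel degree-list-dicolorable.
   Context: A directed graph (digraph) is a pair $D = (X, A)$ with $A \subseteq X^2$ irreflexive; elements of $A$ are called arcs. If $X$ is a standard Borel space, $D$ is a Borel digraph on $X$ if $A$ is Borel in $X^2$. The underlying graph $\tilde{D}$ of $D$ is the undirected graph on $X$ in which $x, y$ are adjacent iff $(x,y) \in A$ or $(y,x) \in A$. $D$ is of bounded degree if the degrees of the vertices of $\tilde{D}$ are bounded by a fixed natural number; connectedness and connected components of $D$ are those of $\tilde{D}$. For $x \in X$, $d^+(x) = |\{y : (x,y) \in A\}|$, $d^-(x) = |\{y : (y,x) \in A\}|$, and $d^{\max}(x) = \max\{d^+(x), d^-(x)\}$. For $S \subseteq X$, $D[S]$ and $\tilde{D}[S]$ denote induced sub(di)graphs. A dicycle in $D$ is a sequence $(x_0, x_1, \dots, x_k = x_0)$, $k \geq 2$, with $(x_i, x_{i+1}) \in A$ for each $i < k$ and $x_0, \dots, x_{k-1}$ pairwise distinct. A dicoloring of $D$ is a function on $X$ that is not constant on any dicycle. For a Polish space $Y$, let $[Y]^{<\infty}$ be the standard Borel space of finite subsets of $Y$. A Borel ($Y$-)list assignment is a Borel function $L : X \to [Y]^{<\infty}$. A Borel $L$-dicoloring of $D$ is a Borel function $c : X \to Y$ that is a dicoloring of $D$ with $c(x) \in L(x)$ for all $x \in X$. $D$ is Borel degree-list-dicolorable if for every Polish $Y$ and every Borel list assignment $L : X \to [Y]^{<\infty}$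 with $|L(x)| \geq d^{\max}(x)$ for all $x \in X$, $D$ has a Borel $L$-dicoloring. A set $S \subseteq X$ with $|S| \geq 2$ is biconnected if $\tilde{D}[S]$ is connected and $\tilde{D}[S \setminus \{s\}]$ is connected for every $s \in S$. A block is a maximal biconnected set. The symmetrization of an undirected graph is the digraph obtained by replacing each edge $\{x,y\}$ with both arcs $(x,y)$ and $(y,x)$. A connected component $C$ of $D$ is a Gallai tree if each block of $D[C]$ induces a (finite) dicycle, the symmetrization of a finite undirected odd cycle, or the symmetrization of a finite undirected complete graph. *)

theory Defs
  imports "HOL-Analysis.Analysis"
begin

section \<open>Polish and standard Borel spaces\<close>

definition Polish_space :: "'a topology \<Rightarrow> bool" where
  "Polish_space T \<longleftrightarrow> separable_space T \<and> completely_metrizable_space T"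

definition borel_of :: "'a topology \<Rightarrow> 'a measure" where
  "borel_of T = sigma (topspace T) {U. openin T U}"

text \<open>As usual, \<^typ>\<open>'a measure\<close> serves as the type of measurable spaces; only
  \<^const>\<open>space\<close> and \<^const>\<open>sets\<close> matter here.\<close>

definition standard_Borel :: "'a measure \<Rightarrow> bool" where
  "standard_Borel X \<longleftrightarrow>
     (\<exists>T. Polish_space T \<and> topspace T = space X \<and> sets X = sets (borel_of T))"

text \<open>The space of finite (possibly empty) subsets of \<open>Y\<close>, with the trace of the Effros Borel
  structure, generated by the hitting sets of the open sets.\<close>

definition finite_subsets :: "'b topology \<Rightarrow> 'b set measure" where
  "finite_subsets Y =
     sigma {F. finite F \<and> F \<subseteq> topspace Y}
       {{F. finite F \<and> F \<subseteq> topspace Y \<and> F \<inter> U \<noteq> {}} | U. openin Y U}"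


section \<open>Digraphs\<close>

text \<open>A digraph is given by its vertex set \<open>V\<close> and its arc relation \<open>A\<close>; induced subdigraphs
  have the arc relation \<^term>\<open>Restr A S\<close>. The vertex set is omitted where it plays no role.\<close>

definition dgraph :: "'a set \<Rightarrow> ('a \<times> 'a) set \<Rightarrow> bool" where
  "dgraph V A \<longleftrightarrow> A \<subseteq> V \<times> V \<and> irrefl A"

definition Borel_digraph :: "'a measure \<Rightarrow> ('a \<times> 'a) set \<Rightarrow> bool" where
  "Borel_digraph X A \<longleftrightarrow>
     standard_Borel X \<and> dgraph (space X) A \<and> A \<in> sets (X \<Otimes>\<^sub>M X)"

definition underlying :: "('a \<times> 'a) set \<Rightarrow> ('a \<times> 'a) set" where
  "underlying A = {(x, y). (x, y) \<in> A \<or> (y, x) \<in> A}"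

definition bounded_degree :: "'a set \<Rightarrow> ('a \<times> 'a) set \<Rightarrow> bool" where
  "bounded_degree V A \<longleftrightarrow>
     (\<exists>N::nat. \<forall>x\<in>V. finite {y. (x, y) \<in> underlying A} \<and> card {y. (x, y) \<in> underlying A} \<le> N)"

text \<open>The degrees are meaningful at vertices of finite degree only, since \<^const>\<open>card\<close> is \<open>0\<close> on
  infinite sets.\<close>

definition outdeg :: "('a \<times> 'a) set \<Rightarrow> 'a \<Rightarrow> nat" where
  "outdeg A x = card {y. (x, y) \<in> A}"

definition indeg :: "('a \<times> 'a) set \<Rightarrow> 'a \<Rightarrow> nat" where
  "indeg A x = card {y. (y, x) \<in> A}"

definition maxdeg :: "('a \<times> 'a) set \<Rightarrow> 'a \<Rightarrow> nat" where
  "maxdeg A x = max (outdeg A x) (indeg A x)"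


section \<open>Dicycles and dicolorings\<close>

text \<open>The list \<open>[x\<^sub>0, \<dots>, x\<^sub>k\<^sub>-\<^sub>1]\<close> encodes the closed sequence \<open>(x\<^sub>0, \<dots>, x\<^sub>k\<^sub>-\<^sub>1, x\<^sub>0)\<close>.\<close>

definition cycle_arcs :: "'a list \<Rightarrow> ('a \<times> 'a) set" where
  "cycle_arcs xs = {(xs ! i, xs ! (Suc i mod length xs)) | i. i < length xs}"

definition dicycle :: "('a \<times> 'a) set \<Rightarrow> 'a list \<Rightarrow> bool" where
  "dicycle A xs \<longleftrightarrow> 2 \<le> length xs \<and> distinct xs \<and> cycle_arcs xs \<subseteq> A"

definition dicoloring :: "('a \<times> 'a) set \<Rightarrow> ('a \<Rightarrow> 'b) \<Rightarrow> bool" where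
  "dicoloring A c \<longleftrightarrow> (\<forall>xs. dicycle A xs \<longrightarrow> \<not> (\<exists>b. \<forall>x\<in>set xs. c x = b))"

definition Borel_list_dicoloring ::
    "'a measure \<Rightarrow> ('a \<times> 'a) set \<Rightarrow> 'b topology \<Rightarrow> ('a \<Rightarrow> 'b set) \<Rightarrow> ('a \<Rightarrow> 'b) \<Rightarrow> bool" where
  "Borel_list_dicoloring X A Y L c \<longleftrightarrow>
     c \<in> measurable X (borel_of Y) \<and> dicoloring A c \<and> (\<forall>x\<in>space X. c x \<in> L x)"

text \<open>The type argument makes explicit where the points of the Polish spaces \<open>Y\<close> live; HOL cannot
  quantify over types inside a formula.\<close>

definition Borel_degree_list_dicolorable ::
    "'b itself \<Rightarrow> 'a measure \<Rightarrow> ('a \<times> 'a) set \<Rightarrow> bool" where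
  "Borel_degree_list_dicolorable _ X A \<longleftrightarrow>
     (\<forall>(Y :: 'b topology) L.
        Polish_space Y \<and> L \<in> measurable X (finite_subsets Y)
        \<and> (\<forall>x\<in>space X. maxdeg A x \<le> card (L x))
        \<longrightarrow> (\<exists>c. Borel_list_dicoloring X A Y L c))"


section \<open>Blocks and Gallai trees\<close>

definition connected_in :: "('a \<times> 'a) set \<Rightarrow> 'a set \<Rightarrow> bool" where
  "connected_in A S \<longleftrightarrow> (\<forall>x\<in>S. \<forall>y\<in>S. (x, y) \<in> (Restr (underlying A) S)\<^sup>*)"

definition conn_components :: "'a set \<Rightarrow> ('a \<times> 'a) set \<Rightarrow> 'a set set" where
  "conn_components V A = {{y\<in>V. (x, y) \<in> (underlying A)\<^sup>*} | x. x \<in> V}"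

text \<open>Biconnected sets may be infinite, so that \<open>2 \<le> card S\<close> would be too narrow.\<close>

definition biconnected :: "('a \<times> 'a) set \<Rightarrow> 'a set \<Rightarrow> bool" where
  "biconnected A S \<longleftrightarrow>
     (\<exists>x\<in>S. \<exists>y\<in>S. x \<noteq> y) \<and> connected_in A S \<and> (\<forall>s\<in>S. connected_in A (S - {s}))"

definition block :: "'a set \<Rightarrow> ('a \<times> 'a) set \<Rightarrow> 'a set \<Rightarrow> bool" where
  "block V A S \<longleftrightarrow>
     S \<subseteq> V \<and> biconnected A S \<and> (\<forall>T. S \<subseteq> T \<and> T \<subseteq> V \<and> biconnected A T \<longrightarrow> T = S)"

text \<open>Undirected graphs are given by their sets of edges, each a two-element set of vertices.\<close>

definition symmetrization :: "'a set set \<Rightarrow> ('a \<times> 'a) set" where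
  "symmetrization E = {(x, y). {x, y} \<in> E}"

definition cycle_edges :: "'a list \<Rightarrow> 'a set set" where
  "cycle_edges xs = {{xs ! i, xs ! (Suc i mod length xs)} | i. i < length xs}"

definition complete_edges :: "'a set \<Rightarrow> 'a set set" where
  "complete_edges S = {e. e \<subseteq> S \<and> card e = 2}"

definition induces_dicycle :: "('a \<times> 'a) set \<Rightarrow> 'a set \<Rightarrow> bool" where
  "induces_dicycle A S \<longleftrightarrow>
     (\<exists>xs. 2 \<le> length xs \<and> distinct xs \<and> set xs = S \<and> Restr A S = cycle_arcs xs)"

definition induces_odd_cycle :: "('a \<times> 'a) set \<Rightarrow> 'a set \<Rightarrow> bool" where
  "induces_odd_cycle A S \<longleftrightarrow>
     (\<exists>xs. 3 \<le> length xs \<and> odd (length xs) \<and> distinct xs \<and> set xs = S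
        \<and> Restr A S = symmetrization (cycle_edges xs))"

definition induces_complete :: "('a \<times> 'a) set \<Rightarrow> 'a set \<Rightarrow> bool" where
  "induces_complete A S \<longleftrightarrow> finite S \<and> Restr A S = symmetrization (complete_edges S)"

definition Gallai_tree :: "('a \<times> 'a) set \<Rightarrow> 'a set \<Rightarrow> bool" where
  "Gallai_tree A C \<longleftrightarrow>
     (\<forall>S. block C (Restr A C) S \<longrightarrow>
        induces_dicycle A S \<or> induces_odd_cycle A S \<or> induces_complete A S)"

end

theory Submission
  imports Defs
begin

text \<open>
  A set \<open>S\<close> of vertices is good if every list coloring outside of \<open>S\<close> extends to \<open>S\<close> without a
  monochromatic dicycle through \<open>S\<close>. If every component contains a good finite set of a shape that is
  recognized by the arcs in it, then a Borel choice of pairwise non-adjacent good sets meeting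
  every component can be made, the remaining vertices can be colored greedily in a Borel well-founded
  order in which each vertex has a neighbor that comes later, and the good sets are colored last.

  The good sets are of two kinds. A single vertex is good if its list is longer than its in- or
  outdegree, counting only arcs on dicycles. If there is no such vertex, consider a cycle of the
  underlying graph with a vertex \<open>v\<close> that lies on no chord. If all but \<open>v\<close> is colored and \<open>v\<close>
  cannot be, then every color of the list of \<open>v\<close> occurs exactly once among its in-neighbors and once
  among its out-neighbors, and the hole may be moved to any neighbor. Moving it around the
  cycle rotates the colors, so the cycle is good unless it induces a dicycle, or it is odd and the two
  neighbors of \<open>v\<close> on it are joined to \<open>v\<close> in the same way. A biconnected graph in which no cycle
  is good is a dicycle, an odd symmetric cycle or complete, so a component without good sets is a Gallai
  tree.

  Measurability rests on the Lusin--Souslin theorem, which provides Borel functions that enumerate the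
  neighbors of a vertex.
\<close>


section \<open>The Lusin--Souslin theorem\<close>

text \<open>A dicycle may leave a good set and come back far away through other good sets, so
  whether a coloring is admissible is not a local question. It is replaced by a stronger local one:
  a monochromatic path in the set is already forbidden when it can be entered from and left to outer
  vertices of its color (\<open>bad_path\<close>). This involves the set and its neighbors only, so
  it is Borel and non-adjacent good sets do not interact. The greedy arguments survive, because a
  vertex is safe once its color is missing among its in-neighbors or among its out-neighbors.

  Dicycles of the whole component enter in \<open>A0\<close>. A block of two vertices joined by a
  single arc is not a Gallai block, yet it has no cycle to recolor. If its arc lies on a dicycle,
  the pair is not a maximal biconnected set; if it lies on none, the arc is left out of the count,
  and both of its ends have a spare color.

  Good cycles may be arbitrarily long, so no radius serves all components. But a good set has one of
  countably many codes, and the least code is an invariant of the component on which the radius may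
  depend.\<close>

lemma continuous_on_snd_apply [continuous_intros]:
  "continuous_on UNIV (\<lambda>z :: 'a::topological_space \<times> (nat \<Rightarrow> real). snd z i)"
  using continuous_on_compose2[OF continuous_on_product_coordinates[of i] continuous_on_snd[OF continuous_on_id]]
  by auto

section \<open>Borel sets as injective projections of closed sets\<close>

text \<open>The second factor carries a witness of membership that is determined by the point.
  Thanks to this uniqueness, a map that is injective on the Borel set stays injective when it is
  pulled back to the closed set.\<close>

definition inj_closed_proj :: "'a::{complete_space, second_countable_topology} set \<Rightarrow> bool" where
  "inj_closed_proj B \<longleftrightarrow>
     (\<exists>F :: ('a \<times> (nat \<Rightarrow> real)) set. closed F \<and> inj_on fst F \<and> fst ` F = B)"

lemma inj_closed_proj_closed:
  assumes "closed B" shows "inj_closed_proj B"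
  unfolding inj_closed_proj_def
proof (intro exI conjI)
  show "closed (B \<times> {\<lambda>_::nat. 0::real})"
    using assms by (intro closed_Times) auto
qed (auto simp: inj_on_def image_iff)

text \<open>Coordinate 0 of the witness is the reciprocal of the distance to the complement, which
  turns the open condition of positive distance into a closed one. The other coordinates are frozen
  at 0 for uniqueness. The whole space is treated apart because the distance to the empty set is 0
  by convention.\<close>

lemma inj_closed_proj_open:
  fixes U :: "'a::{complete_space, second_countable_topology} set"
  assumes "open U" shows "inj_closed_proj U"
proof (cases "U = UNIV")
  case True
  then show ?thesis by (simp add: inj_closed_proj_closed)
next
  case False
  let ?F = "{z :: 'a \<times> (nat \<Rightarrow> real). snd z 0 * infdist (fst z) (-U) = 1} \<inter> {z. \<forall>n. snd z (Suc n) = 0}"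
  have "closed ?F"
    by (intro closed_Int closed_Collect_eq closed_Collect_all continuous_intros
        continuous_on_snd_apply)
  moreover have "inj_on fst ?F"
  proof (rule inj_onI)
    fix z w assume *: "z \<in> ?F" "w \<in> ?F" "fst z = fst w"
    have "infdist (fst w) (-U) \<noteq> 0" using * by auto
    then have "snd z 0 = snd w 0" using * by (metis (mono_tags, lifting) IntD1 mem_Collect_eq mult_right_cancel)
    then have "snd z n = snd w n" for n using * by (cases n) auto
    with * show "z = w" by (simp add: prod_eq_iff fun_eq_iff)
  qed
  moreover have "fst ` ?F = U"
  proof (intro set_eqI iffI)
    fix x assume "x \<in> fst ` ?F"
    then obtain y where "y (0::nat) * infdist x (-U) = (1::real)" by auto
    then have "infdist x (-U) \<noteq> 0" by auto
    then show "x \<in> U" using infdist_zero[of x "-U"] by blast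
  next
    fix x assume x: "x \<in> U"
    have "closed (-U)" "-U \<noteq> {}" using assms False by auto
    then have "infdist x (-U) \<noteq> 0" using x by (metis ComplD in_closed_iff_infdist_zero)
    then have "(x, \<lambda>n. if n = 0 then 1 / infdist x (-U) else 0) \<in> ?F" by auto
    then show "x \<in> fst ` ?F" by (metis (no_types, lifting) fst_conv image_eqI)
  qed
  ultimately show ?thesis unfolding inj_closed_proj_def by blast
qed

text \<open>A witness for the intersection bundles one witness for each \<open>B n\<close>, whose
  entry \<open>m\<close> is stored at position \<open>prod_encode (n, m)\<close>.\<close>

lemma inj_closed_proj_INT:
  fixes B :: "nat \<Rightarrow> 'a::{complete_space, second_countable_topology} set"
  assumes "\<And>n. inj_closed_proj (B n)" shows "inj_closed_proj (\<Inter>n. B n)"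
proof -
  have "\<forall>n. \<exists>F :: ('a \<times> (nat \<Rightarrow> real)) set. closed F \<and> inj_on fst F \<and> fst ` F = B n"
    using assms by (simp add: inj_closed_proj_def)
  then obtain F :: "nat \<Rightarrow> ('a \<times> (nat \<Rightarrow> real)) set"
    where F: "\<And>n. closed (F n)" "\<And>n. inj_on fst (F n)" "\<And>n. fst ` F n = B n" by metis
  let ?p = "\<lambda>n (z :: 'a \<times> (nat \<Rightarrow> real)). (fst z, \<lambda>m. snd z (prod_encode (n, m)))"
  let ?F = "\<Inter>n. ?p n -` F n"
  have "continuous_on UNIV (?p n)" for n
    by (intro continuous_intros continuous_on_coordinatewise_then_product
        continuous_on_snd_apply)
  then have "closed ?F"
    using F(1) by (intro closed_INT ballI closed_vimage) auto
  moreover have "inj_on fst ?F"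
  proof (rule inj_onI)
    fix z w assume *: "z \<in> ?F" "w \<in> ?F" "fst z = fst w"
    have "snd z k = snd w k" for k
    proof -
      obtain n m where k: "k = prod_encode (n, m)" by (metis prod_decode_inverse surj_pair)
      have "?p n z \<in> F n" "?p n w \<in> F n" using * by auto
      then have "?p n z = ?p n w" using inj_onD[OF F(2)[of n], of "?p n z" "?p n w"] * by simp
      then show ?thesis unfolding k by (auto dest: fun_cong)
    qed
    with * show "z = w" by (simp add: prod_eq_iff fun_eq_iff)
  qed
  moreover have "fst ` ?F = (\<Inter>n. B n)"
  proof (intro set_eqI iffI)
    fix x assume "x \<in> (\<Inter>n. B n)"
    then have "\<forall>n. \<exists>y. (x, y) \<in> F n" using F(3) by fastforce
    then obtain y where y: "\<And>n. (x, y n) \<in> F n" by metis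
    have "(x, \<lambda>k. y (fst (prod_decode k)) (snd (prod_decode k))) \<in> ?F" using y by auto
    then show "x \<in> fst ` ?F" by (metis (no_types, lifting) fst_conv image_eqI)
  next
    fix x assume "x \<in> fst ` ?F"
    then obtain y where y: "\<And>n. ?p n (x, y) \<in> F n" by auto
    have "x \<in> B n" for n using imageI[OF y[of n], of fst] F(3)[of n] by simp
    then show "x \<in> (\<Inter>n. B n)" by simp
  qed
  ultimately show ?thesis unfolding inj_closed_proj_def by blast
qed

text \<open>Coordinate 0 of the witness names the index of the set that contains the point, and the
  remaining coordinates hold the witness for this set. Disjointness makes the index unique.\<close>

lemma inj_closed_proj_disjoint_UN:
  fixes B :: "nat \<Rightarrow> 'a::{complete_space, second_countable_topology} set"
  assumes "\<And>n. inj_closed_proj (B n)" and disj: "\<And>m n. m \<noteq> n \<Longrightarrow> B m \<inter> B n = {}"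
  shows "inj_closed_proj (\<Union>n. B n)"
proof -
  have "\<forall>n. \<exists>F :: ('a \<times> (nat \<Rightarrow> real)) set. closed F \<and> inj_on fst F \<and> fst ` F = B n"
    using assms by (simp add: inj_closed_proj_def)
  then obtain F :: "nat \<Rightarrow> ('a \<times> (nat \<Rightarrow> real)) set"
    where F: "\<And>n. closed (F n)" "\<And>n. inj_on fst (F n)" "\<And>n. fst ` F n = B n" by metis
  let ?p = "\<lambda>(z :: 'a \<times> (nat \<Rightarrow> real)). (fst z, \<lambda>m. snd z (Suc m))"
  let ?h = "\<lambda>(z :: 'a \<times> (nat \<Rightarrow> real)). snd z 0"
  \<comment> \<open>A natural number differs from \<open>n\<close> iff it is at most
    \<open>n - 1\<close> or at least \<open>n + 1\<close>. In this form, "if the index is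
    \<open>n\<close>, then the rest lies in \<open>F n\<close>" is a union of closed sets.\<close>
  let ?F = "?h -` \<nat> \<inter> (\<Inter>n. {z. ?h z \<le> real n - 1} \<union> {z. real n + 1 \<le> ?h z} \<union> ?p -` F n)"
  have F_eq: "?F = {z. \<exists>n. ?h z = real n \<and> ?p z \<in> F n}"
  proof (intro set_eqI iffI)
    fix z assume z: "z \<in> ?F"
    then obtain n where n: "?h z = real n" by (auto elim: Nats_cases)
    have "\<not> ?h z \<le> real n - 1" "\<not> real n + 1 \<le> ?h z" using n by auto
    moreover have "z \<in> {z. ?h z \<le> real n - 1} \<union> {z. real n + 1 \<le> ?h z} \<union> ?p -` F n" using z by blast
    ultimately have "?p z \<in> F n" by auto
    with n show "z \<in> {z. \<exists>n. ?h z = real n \<and> ?p z \<in> F n}" by auto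
  next
    fix z assume "z \<in> {z. \<exists>n. ?h z = real n \<and> ?p z \<in> F n}"
    then obtain n where n: "?h z = real n" "?p z \<in> F n" by auto
    have "z \<in> {z. ?h z \<le> real m - 1} \<union> {z. real m + 1 \<le> ?h z} \<union> ?p -` F m" for m
    proof (cases "m = n")
      case False
      then consider "m \<ge> n + 1" | "n \<ge> m + 1" by linarith
      then show ?thesis
      proof cases
        case 1
        then have "real m \<ge> real n + 1" by (metis of_nat_1 of_nat_add of_nat_le_iff)
        then show ?thesis using n by auto
      next
        case 2
        then have "real n \<ge> real m + 1" by (metis of_nat_1 of_nat_add of_nat_le_iff)
        then show ?thesis using n by auto
      qed
    qed (use n in auto)
    then show "z \<in> ?F" using n by auto
  qed
  have "continuous_on UNIV ?p" "continuous_on UNIV ?h"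
    by (intro continuous_intros continuous_on_coordinatewise_then_product
        continuous_on_snd_apply)+
  then have "closed ?F"
    using F(1) by (intro closed_Int closed_INT closed_Un ballI closed_vimage closed_Collect_le
        continuous_intros closed_Nats) auto
  moreover have "inj_on fst ?F"
    unfolding F_eq
  proof (rule inj_onI)
    fix z w assume *: "z \<in> {z. \<exists>n. ?h z = real n \<and> ?p z \<in> F n}"
      "w \<in> {z. \<exists>n. ?h z = real n \<and> ?p z \<in> F n}" "fst z = fst w"
    then obtain m n where mn: "?h z = real m" "?p z \<in> F m" "?h w = real n" "?p w \<in> F n" by blast
    have "fst z \<in> B m" "fst w \<in> B n" using mn(2,4) F(3) by (metis fst_conv imageI)+
    then have "m = n" using disj[of m n] * by auto
    have "?p z = ?p w" using inj_onD[OF F(2)[of n], of "?p z" "?p w"] mn * \<open>m = n\<close> by simp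
    then have "snd z (Suc k) = snd w (Suc k)" for k by (auto dest: fun_cong)
    then have "snd z k = snd w k" for k using mn \<open>m = n\<close> by (cases k) auto
    with * show "z = w" by (simp add: prod_eq_iff fun_eq_iff)
  qed
  moreover have "fst ` ?F = (\<Union>n. B n)"
    unfolding F_eq
  proof (intro set_eqI iffI)
    fix x assume "x \<in> (\<Union>n. B n)"
    then obtain n y where y: "(x, y) \<in> F n" using F(3) by fastforce
    have "(x, \<lambda>k. case k of 0 \<Rightarrow> real n | Suc k \<Rightarrow> y k) \<in> {z. \<exists>n. ?h z = real n \<and> ?p z \<in> F n}"
      using y by auto
    then show "x \<in> fst ` {z. \<exists>n. ?h z = real n \<and> ?p z \<in> F n}" by (metis (no_types, lifting) fst_conv image_eqI)
  next
    fix x assume "x \<in> fst ` {z. \<exists>n. ?h z = real n \<and> ?p z \<in> F n}"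
    then obtain y n where y: "?p (x, y) \<in> F n" by auto
    then have "x \<in> B n" using imageI[OF y, of fst] F(3)[of n] by simp
    then show "x \<in> (\<Union>n. B n)" by blast
  qed
  ultimately show ?thesis unfolding inj_closed_proj_def by blast
qed

lemma inj_closed_proj_Int:
  assumes "inj_closed_proj A" "inj_closed_proj B" shows "inj_closed_proj (A \<inter> B)"
proof -
  have "inj_closed_proj (\<Inter>n::nat. if n = 0 then A else B)"
    by (rule inj_closed_proj_INT) (use assms in auto)
  moreover have "(\<Inter>n::nat. if n = 0 then A else B) = A \<inter> B" by (auto split: if_splits)
  ultimately show ?thesis by simp
qed

text \<open>The induction carries the complement along. A union is made disjoint by intersecting
  each set with the complements of the earlier ones, and the complement of a union is an
  intersection.\<close>

lemma borel_inj_closed_proj: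
  fixes B :: "'a::{complete_space, second_countable_topology} set"
  assumes "B \<in> sets borel" shows "inj_closed_proj B"
proof -
  have "B \<in> sigma_sets UNIV {S. open S}"
    using assms by (simp add: borel_def)
  then have "inj_closed_proj B \<and> inj_closed_proj (-B)"
  proof induction
    case (Basic a)
    then show ?case by (auto intro: inj_closed_proj_open inj_closed_proj_closed)
  next
    case Empty
    then show ?case by (auto intro: inj_closed_proj_closed)
  next
    case (Compl a)
    then show ?case by (simp add: Compl_eq_Diff_UNIV[symmetric])
  next
    case (Union a)
    let ?b = "\<lambda>n. a n \<inter> (\<Inter>m. if m < n then - a m else UNIV)"
    have "inj_closed_proj (\<Union>n. ?b n)"
    proof (rule inj_closed_proj_disjoint_UN)
      show "inj_closed_proj (?b n)" for n
        using Union by (intro inj_closed_proj_Int inj_closed_proj_INT) (auto intro: inj_closed_proj_closed)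
      show "?b m \<inter> ?b n = {}" if "m \<noteq> n" for m n
        using that by (cases "m < n") (auto split: if_splits simp: not_less dest!: le_neq_implies_less)
    qed
    moreover have "(\<Union>n. ?b n) = (\<Union>n. a n)"
    proof (intro set_eqI iffI)
      fix x assume "x \<in> (\<Union>n. a n)"
      then have ex: "\<exists>n. x \<in> a n" by auto
      define k where "k = (LEAST n. x \<in> a n)"
      have "x \<in> a k" using ex unfolding k_def by (rule LeastI_ex)
      moreover have "x \<notin> a m" if "m < k" for m using that not_less_Least unfolding k_def by blast
      ultimately show "x \<in> (\<Union>n. ?b n)" by auto
    qed auto
    moreover have "inj_closed_proj (\<Inter>n. - a n)" using Union by (intro inj_closed_proj_INT) auto
    ultimately show ?case by simp
  qed
  then show ?thesis by simp
qed

section \<open>Separation of disjoint images by Borel sets\<close>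

definition borel_separated :: "'b::topological_space set \<Rightarrow> 'b set \<Rightarrow> bool" where
  "borel_separated P Q \<longleftrightarrow> (\<exists>C\<in>sets borel. P \<subseteq> C \<and> Q \<inter> C = {})"

lemma borel_separated_empty: "borel_separated {} Q" "borel_separated P {}"
  unfolding borel_separated_def by (intro bexI[of _ "{}"] bexI[of _ UNIV]; simp)+

text \<open>Used in contraposition: if two unions are inseparable, then so are some two of their
  pieces.\<close>

lemma borel_separated_UN:
  fixes P Q :: "nat \<Rightarrow> 'b::topological_space set"
  assumes "\<And>i j. borel_separated (P i) (Q j)"
  shows "borel_separated (\<Union>i. P i) (\<Union>j. Q j)"
proof -
  obtain C where C: "\<And>i j. C i j \<in> sets borel" "\<And>i j. P i \<subseteq> C i j" "\<And>i j. Q j \<inter> C i j = {}"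
    using assms unfolding borel_separated_def by metis
  have "(\<Union>i. \<Inter>j. C i j) \<in> sets borel" using C(1) by auto
  moreover have "(\<Union>i. P i) \<subseteq> (\<Union>i. \<Inter>j. C i j)" using C(2) by blast
  moreover have "(\<Union>j. Q j) \<inter> (\<Union>i. \<Inter>j. C i j) = {}" using C(3) by blast
  ultimately show ?thesis unfolding borel_separated_def by blast
qed

lemma countable_cball_cover:
  obtains d :: "nat \<Rightarrow> 'a::{metric_space, second_countable_topology}"
  where "\<And>e x. 0 < e \<Longrightarrow> \<exists>k. dist x (d k) \<le> e"
proof -
  obtain D :: "'a set" where D: "countable D" "\<And>X. open X \<Longrightarrow> X \<noteq> {} \<Longrightarrow> \<exists>d\<in>D. d \<in> X"
    using countable_dense_setE by blast
  have "D \<noteq> {}" using D(2)[of UNIV] by auto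
  have "\<exists>k. dist x (from_nat_into D k) \<le> e" if "0 < e" for e x
  proof -
    have "x \<in> ball x e" using that by simp
    then have "\<exists>y\<in>D. y \<in> ball x e" by (intro D(2)) auto
    then obtain y where "y \<in> D" "dist x y < e" by (auto simp: mem_ball)
    then show ?thesis using from_nat_into_surj[OF D(1)] by (metis less_imp_le)
  qed
  then show ?thesis using that by blast
qed

text \<open>An inseparable pair can be refined to an inseparable pair of subsets of balls of radius
  \<open>(1/2)^n\<close>, for one \<open>n\<close> after another. The nested pairs shrink to points
  \<open>P\<close> of \<open>F1\<close> and \<open>Q\<close> of \<open>F2\<close> with distinct
  images, and by continuity disjoint neighborhoods of these images separate a late pair.\<close>

theorem Lusin_separation:
  fixes g :: "'a::{complete_space, second_countable_topology} \<Rightarrow> 'b::t2_space"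
  assumes F: "closed F1" "closed F2" and g: "continuous_on UNIV g"
    and disj: "g ` F1 \<inter> g ` F2 = {}"
  shows "borel_separated (g ` F1) (g ` F2)"
proof (rule ccontr)
  assume nsep: "\<not> borel_separated (g ` F1) (g ` F2)"
  obtain d :: "nat \<Rightarrow> 'a" where d: "\<And>e x. 0 < e \<Longrightarrow> \<exists>k. dist x (d k) \<le> e"
    using countable_cball_cover[where ?'a = 'a] by blast
  let ?Q = "\<lambda>n (PQ::'a set \<times> 'a set). \<not> borel_separated (g ` fst PQ) (g ` snd PQ) \<and> fst PQ \<subseteq> F1 \<and> snd PQ \<subseteq> F2"
  let ?R = "\<lambda>n (PQ::'a set \<times> 'a set) PQ'. fst PQ' \<subseteq> fst PQ \<and> snd PQ' \<subseteq> snd PQ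
      \<and> (\<exists>a b. fst PQ' \<subseteq> cball a ((1/2)^n) \<and> snd PQ' \<subseteq> cball b ((1/2)^n))"
  have "\<exists>f. \<forall>n. ?Q n (f n) \<and> ?R n (f n) (f (Suc n))"
  proof (rule dependent_nat_choice[of ?Q ?R])
    show "\<exists>x. ?Q 0 x" using nsep by (intro exI[of _ "(F1, F2)"]) auto
  next
    fix PQ n assume PQ: "?Q n PQ"
    let ?c = "\<lambda>k. cball (d k) ((1/2)^n)"
    have cov: "(\<Union>k. ?c k) = UNIV"
      using d[of "(1/2)^n"] by (auto simp: mem_cball dist_commute)
    have "\<exists>i j. \<not> borel_separated (g ` (fst PQ \<inter> ?c i)) (g ` (snd PQ \<inter> ?c j))"
    proof (rule ccontr)
      assume "\<not> ?thesis"
      then have "borel_separated (\<Union>i. g ` (fst PQ \<inter> ?c i)) (\<Union>j. g ` (snd PQ \<inter> ?c j))"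
        by (intro borel_separated_UN) auto
      moreover have "(\<Union>i. g ` (P \<inter> ?c i)) = g ` P" for P
        using cov by (metis Int_UNIV_right Int_UN_distrib image_UN)
      ultimately show False using PQ by simp
    qed
    then obtain i j where "\<not> borel_separated (g ` (fst PQ \<inter> ?c i)) (g ` (snd PQ \<inter> ?c j))" by blast
    then show "\<exists>y. ?Q (Suc n) y \<and> ?R n PQ y"
      using PQ by (intro exI[of _ "(fst PQ \<inter> ?c i, snd PQ \<inter> ?c j)"]) auto
  qed
  then obtain f where f: "\<And>n. ?Q n (f n)" "\<And>n. ?R n (f n) (f (Suc n))" by blast
  have "fst (f n) \<noteq> {}" "snd (f n) \<noteq> {}" for n
    using f(1)[of n] borel_separated_empty by (metis image_empty)+
  then have "\<exists>x. x \<in> fst (f n) \<times> snd (f n)" for n by (simp add: ex_in_conv)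
  then obtain z where z: "\<And>n. z n \<in> fst (f n) \<times> snd (f n)" by metis
  define p q where "p n = fst (z n)" and "q n = snd (z n)" for n
  have pq: "\<And>n. p n \<in> fst (f n)" "\<And>n. q n \<in> snd (f n)" using z by (auto simp: p_def q_def mem_Times_iff)
  have mono: "fst (f n) \<subseteq> fst (f m)" "snd (f n) \<subseteq> snd (f m)" if "m \<le> n" for m n
    using lift_Suc_antimono_le[of "\<lambda>n. fst (f n)", OF _ that] lift_Suc_antimono_le[of "\<lambda>n. snd (f n)", OF _ that]
      f(2) by simp_all
  have close: "dist x y \<le> 2 * (1/2)^n"
    if "(x \<in> fst (f (Suc n)) \<and> y \<in> fst (f (Suc n))) \<or> (x \<in> snd (f (Suc n)) \<and> y \<in> snd (f (Suc n)))" for x y n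
  proof -
    obtain a b where ab: "fst (f (Suc n)) \<subseteq> cball a ((1/2)^n)" "snd (f (Suc n)) \<subseteq> cball b ((1/2)^n)"
      using f(2)[of n] by meson
    have "\<exists>c. x \<in> cball c ((1/2)^n) \<and> y \<in> cball c ((1/2)^n)"
      using that subsetD[OF ab(1)] subsetD[OF ab(2)] by meson
    then obtain a where "x \<in> cball a ((1/2)^n)" "y \<in> cball a ((1/2)^n)" by meson
    then show ?thesis using dist_triangle[of x y a] by (auto simp: mem_cball dist_commute)
  qed
  have ex: "\<exists>n. 2 * (1/2::real)^n < e" if "0 < e" for e
    using real_arch_pow_inv[of "e/2" "1/2"] that by (auto simp: mult.commute)
  have "Cauchy p" "Cauchy q"
  proof -
    have "\<exists>M. \<forall>m\<ge>M. \<forall>n\<ge>M. dist (p m) (p n) < e" "\<exists>M. \<forall>m\<ge>M. \<forall>n\<ge>M. dist (q m) (q n) < e" if "0 < e" for e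
    proof -
      obtain n where n: "2 * (1/2::real)^n < e" using ex[OF \<open>0<e\<close>] by blast
      have "dist (p i) (p j) < e" "dist (q i) (q j) < e" if "Suc n \<le> i" "Suc n \<le> j" for i j
      proof -
        have "p i \<in> fst (f (Suc n))" "p j \<in> fst (f (Suc n))" "q i \<in> snd (f (Suc n))" "q j \<in> snd (f (Suc n))"
          using mono[OF that(1)] mono[OF that(2)] pq[of i] pq[of j] by blast+
        then show "dist (p i) (p j) < e" "dist (q i) (q j) < e"
          using close[of "p i" n "p j"] close[of "q i" n "q j"] n by linarith+
      qed
      then show "\<exists>M. \<forall>m\<ge>M. \<forall>n\<ge>M. dist (p m) (p n) < e" "\<exists>M. \<forall>m\<ge>M. \<forall>n\<ge>M. dist (q m) (q n) < e"
        by blast+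
    qed
    then show "Cauchy p" "Cauchy q" unfolding Cauchy_def by blast+
  qed
  then obtain P Q where lim: "p \<longlonglongrightarrow> P" "q \<longlonglongrightarrow> Q" using convergent_eq_Cauchy by (metis convergent_def)
  have "P \<in> F1" using closed_sequentially[OF F(1) _ lim(1)] pq(1) f(1) by blast
  have "Q \<in> F2" using closed_sequentially[OF F(2) _ lim(2)] pq(2) f(1) by blast
  have "g P \<noteq> g Q" using disj \<open>P \<in> F1\<close> \<open>Q \<in> F2\<close> by auto
  then obtain U V where UV: "open U" "open V" "g P \<in> U" "g Q \<in> V" "U \<inter> V = {}"
    using hausdorff by meson
  have "open (g -` U)" "open (g -` V)" using g UV(1,2) by (auto simp: continuous_on_open_vimage)
  then obtain e1 e2 where e: "0 < e1" "0 < e2" "ball P e1 \<subseteq> g -` U" "ball Q e2 \<subseteq> g -` V"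
    using UV(3,4) by (metis open_contains_ball vimageI2)
  obtain n where n: "2 * (1/2::real)^n < min e1 e2" using ex[of "min e1 e2"] e by auto
  have "dist x P \<le> 2 * (1/2)^n" if "x \<in> fst (f (Suc n))" for x
  proof (rule tendsto_upperbound)
    show "(\<lambda>k. dist x (p k)) \<longlonglongrightarrow> dist x P" using lim(1) by (intro tendsto_intros)
    show "\<forall>\<^sub>F k in sequentially. dist x (p k) \<le> 2 * (1/2)^n"
      using close[of x n] that pq(1) mono(1)[of "Suc n", THEN subsetD] by (auto simp: eventually_sequentially intro!: exI[of _ "Suc n"])
  qed simp
  then have "dist P x < e1" if "x \<in> fst (f (Suc n))" for x
    using that n by (metis dist_commute le_less_trans min_less_iff_conj)
  then have "fst (f (Suc n)) \<subseteq> ball P e1" by auto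
  then have PU: "g ` fst (f (Suc n)) \<subseteq> U" using e(3) by blast
  have "dist x Q \<le> 2 * (1/2)^n" if "x \<in> snd (f (Suc n))" for x
  proof (rule tendsto_upperbound)
    show "(\<lambda>k. dist x (q k)) \<longlonglongrightarrow> dist x Q" using lim(2) by (intro tendsto_intros)
    show "\<forall>\<^sub>F k in sequentially. dist x (q k) \<le> 2 * (1/2)^n"
      using close[of x n] that pq(2) mono(2)[of "Suc n", THEN subsetD] by (auto simp: eventually_sequentially intro!: exI[of _ "Suc n"])
  qed simp
  then have "dist Q x < e2" if "x \<in> snd (f (Suc n))" for x
    using that n by (metis dist_commute le_less_trans min_less_iff_conj)
  then have "snd (f (Suc n)) \<subseteq> ball Q e2" by auto
  then have QV: "g ` snd (f (Suc n)) \<subseteq> V" using e(4) by blast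
  have "borel_separated (g ` fst (f (Suc n))) (g ` snd (f (Suc n)))"
    unfolding borel_separated_def using PU QV UV by (intro bexI[of _ U]) auto
  with f(1) show False by blast
qed

lemma Lusin_separation_countable:
  fixes g :: "'a::{complete_space, second_countable_topology} \<Rightarrow> 'b::t2_space"
  assumes B: "\<And>i::'i::countable. B i \<in> sets borel" and g: "continuous_on UNIV g"
    and disj: "\<And>i j. i \<noteq> j \<Longrightarrow> g ` B i \<inter> g ` B j = {}"
  obtains C where "\<And>i. C i \<in> sets borel" "\<And>i. g ` B i \<subseteq> C i" "\<And>i j. i \<noteq> j \<Longrightarrow> C i \<inter> C j = {}"
proof -
  have "\<forall>i. \<exists>F :: ('a \<times> (nat \<Rightarrow> real)) set. closed F \<and> fst ` F = B i"
    using borel_inj_closed_proj[OF B] unfolding inj_closed_proj_def by blast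
  then obtain F :: "'i \<Rightarrow> ('a \<times> (nat \<Rightarrow> real)) set"
    where F: "\<And>i. closed (F i)" "\<And>i. fst ` F i = B i" by metis
  have gF: "(g \<circ> fst) ` F i = g ` B i" for i using F(2)[of i] by (metis image_comp)
  have "continuous_on UNIV (g \<circ> (fst :: 'a \<times> (nat \<Rightarrow> real) \<Rightarrow> 'a))"
    by (intro continuous_on_compose continuous_intros continuous_on_subset[OF g]) auto
  note sep = Lusin_separation[OF F(1) F(1) this, unfolded gF]
  have "borel_separated (g ` B i) (g ` B j)" if "i \<noteq> j" for i j
    using sep[OF disj[OF that]] .
  then have "\<exists>C. C \<in> sets borel \<and> (i \<noteq> j \<longrightarrow> g ` B i \<subseteq> C \<and> g ` B j \<inter> C = {})" for i j
    unfolding borel_separated_def by (cases "i = j") (auto simp: Bex_def dest!: meta_spec[of _ i] meta_spec[of _ j])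
  then obtain S where S: "\<And>i j. S i j \<in> sets borel"
    "\<And>i j. i \<noteq> j \<Longrightarrow> g ` B i \<subseteq> S i j" "\<And>i j. i \<noteq> j \<Longrightarrow> g ` B j \<inter> S i j = {}" by metis
  \<comment> \<open>Both separators of each pair are used: \<open>?C i\<close> lies in
    \<open>S i j\<close>, whereas \<open>?C j\<close> avoids it.\<close>
  let ?C = "\<lambda>i. \<Inter>j. if j = i then UNIV else S i j - S j i"
  show thesis
  proof
    show "?C i \<in> sets borel" for i using S(1) by (intro sets.countable_INT'') auto
    show "g ` B i \<subseteq> ?C i" for i
    proof (rule INT_greatest)
      show "g ` B i \<subseteq> (if j = i then UNIV else S i j - S j i)" for j
        using S(2)[of i j] S(3)[of j i] by (cases "j = i") auto
    qed
    show "?C i \<inter> ?C j = {}" if "i \<noteq> j" for i j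
    proof -
      have "?C i \<subseteq> S i j" "?C j \<subseteq> - S i j" using that by (auto split: if_splits)
      then show ?thesis by blast
    qed
  qed
qed

section \<open>Borel images under injective maps\<close>

text \<open>\<open>F\<close> is cut into ever finer pieces \<open>P s\<close>, indexed by finite
  sequences of ball centers. By injectivity the images of the pieces of one level are disjoint, so
  they lie in disjoint Borel sets \<open>C n s\<close>. In the resulting scheme \<open>D\<close> a
  point determines its branch, and the union over uncountably many branches becomes a countable
  intersection of countable unions.\<close>

lemma continuous_inj_image_closed_borel:
  fixes g :: "'a::{complete_space, second_countable_topology} \<Rightarrow> 'b::metric_space"
  assumes F: "closed F" and g: "continuous_on UNIV g" and inj: "inj_on g F"
  shows "g ` F \<in> sets borel"
proof -
  obtain d :: "nat \<Rightarrow> 'a" where d: "\<And>e x. 0 < e \<Longrightarrow> \<exists>k. dist x (d k) \<le> e"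
    using countable_cball_cover[where ?'a = 'a] by blast
  \<comment> \<open>Taking the first close center, not just any, makes the pieces of a level
    disjoint and Borel.\<close>
  define ix where "ix n z = (LEAST k. dist z (d k) \<le> (1/2)^n)" for n z
  have ix: "dist z (d (ix n z)) \<le> (1/2)^n" for n z
    unfolding ix_def by (rule LeastI_ex) (use d in auto)
  have [measurable]: "ix n \<in> measurable borel (count_space UNIV)" for n
    unfolding ix_def by (intro measurable_Least) simp
  define br where "br n z = map (\<lambda>i. ix i z) [0..<n]" for n z
  define P where "P s = {z \<in> F. br (length s) z = s}" for s
  have [measurable]: "br n \<in> measurable borel (count_space UNIV)" for n
  proof (induction n)
    case (Suc n)
    have "br (Suc n) = (\<lambda>z. br n z @ [ix n z])" by (auto simp: br_def fun_eq_iff)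
    moreover have "(\<lambda>z. br n z @ [ix n z]) \<in> measurable borel (count_space UNIV)"
      using Suc by measurable
    ultimately show ?case by simp
  qed (auto simp: br_def)
  have [measurable]: "F \<in> sets borel" using F by auto
  have PB: "P s \<in> sets borel" for s
  proof -
    have "P s = F \<inter> (br (length s) -` {s} \<inter> space borel)" by (auto simp: P_def)
    also have "\<dots> \<in> sets borel" by (intro sets.Int measurable_sets[of _ _ "count_space UNIV"]) auto
    finally show ?thesis .
  qed
  have disj: "g ` P s \<inter> g ` P t = {}" if "s \<noteq> t" "length s = length t" for s t
    using that inj by (auto simp: P_def inj_on_def)
  have "\<exists>C. (\<forall>s. C s \<in> sets borel) \<and> (\<forall>s. length s = n \<longrightarrow> g ` P s \<subseteq> C s)
      \<and> (\<forall>s t. s \<noteq> t \<longrightarrow> length s = n \<longrightarrow> length t = n \<longrightarrow> C s \<inter> C t = {})" for n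
  proof -
    let ?B = "\<lambda>s. if length s = n then P s else {}"
    obtain C where "\<And>i. C i \<in> sets borel" "\<And>i. g ` ?B i \<subseteq> C i" "\<And>i j. i \<noteq> j \<Longrightarrow> C i \<inter> C j = {}"
      by (rule Lusin_separation_countable[of ?B g]) (use PB disj g in auto)
    then show ?thesis by (intro exI[of _ C]) (metis (full_types))
  qed
  then obtain C where C: "\<And>n s. C n s \<in> sets borel" "\<And>n s. length s = n \<Longrightarrow> g ` P s \<subseteq> C n s"
    "\<And>n s t. s \<noteq> t \<Longrightarrow> length s = n \<Longrightarrow> length t = n \<Longrightarrow> C n s \<inter> C n t = {}" by metis
  define D where "D n s = (\<Inter>k\<le>n. C k (take k s) \<inter> closure (g ` P (take k s)))" for n s
  have br_take: "take k (br n z) = br k z" if "k \<le> n" for k n z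
    using that by (simp add: br_def take_map)
  have "g ` F = (\<Inter>n. \<Union>s\<in>{s. length s = n}. D n s)"
  proof (intro set_eqI iffI)
    fix x assume "x \<in> g ` F"
    then obtain z where z: "z \<in> F" "x = g z" by auto
    have zP: "z \<in> P (br k z)" for k using z by (simp add: P_def br_def)
    have "x \<in> D n (br n z)" for n
    proof -
      have "x \<in> C k (take k (br n z))" if "k \<le> n" for k
        using C(2)[of "br k z" k] zP[of k] br_take[OF that] z by (auto simp: br_def)
      moreover have "x \<in> closure (g ` P (take k (br n z)))" if "k \<le> n" for k
        using zP[of k] br_take[OF that] z closure_subset by fastforce
      ultimately show ?thesis by (auto simp: D_def)
    qed
    then show "x \<in> (\<Inter>n. \<Union>s\<in>{s. length s = n}. D n s)" by (auto simp: br_def intro!: exI[of _ "br _ z"])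
  next
    fix x assume "x \<in> (\<Inter>n. \<Union>s\<in>{s. length s = n}. D n s)"
    then have "\<forall>n. \<exists>s. length s = n \<and> x \<in> D n s" by auto
    then obtain s where s: "\<And>n. length (s n) = n" "\<And>n. x \<in> D n (s n)" by metis
    \<comment> \<open>Here the disjointness of the separators is used: the sequences found at
      different levels are initial segments of one branch.\<close>
    have coh: "take k (s n) = s k" if "k \<le> n" for k n
    proof (rule ccontr)
      assume "take k (s n) \<noteq> s k"
      then have "C k (take k (s n)) \<inter> C k (s k) = {}" using that s(1) by (intro C(3)) auto
      moreover have "x \<in> C k (take k (s n))" using s(2)[of n] that by (auto simp: D_def)
      moreover have "x \<in> C k (s k)" using s(2)[of k] s(1)[of k] unfolding D_def by force
      ultimately show False by blast
    qed
    have cl: "x \<in> closure (g ` P (s n))" for n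
      using s(2)[of n] s(1)[of n] unfolding D_def by force
    then have "P (s n) \<noteq> {}" for n by (metis closure_empty empty_iff image_empty)
    then have "\<exists>z. z \<in> P (s n)" for n by (simp add: ex_in_conv)
    then obtain z where z: "\<And>n. z n \<in> P (s n)" by metis
    have Pmono: "P (s n) \<subseteq> P (s m)" if "m \<le> n" for m n
    proof
      fix y assume y: "y \<in> P (s n)"
      then have "br n y = s n" using s(1)[of n] by (simp add: P_def)
      then have "br m y = s m" using br_take[OF that] coh[OF that] by metis
      then show "y \<in> P (s m)" using y s(1) by (simp add: P_def)
    qed
    have close: "dist y y' \<le> 2 * (1/2)^n" if "y \<in> P (s (Suc n))" "y' \<in> P (s (Suc n))" for y y' n
    proof -
      have "br (Suc n) y = br (Suc n) y'" using that s(1)[of "Suc n"] by (simp add: P_def)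
      then have "ix n y = ix n y'" by (simp add: br_def)
      then show ?thesis using ix[of y n] ix[of y' n] dist_triangle[of y y' "d (ix n y)"] by (simp add: dist_commute)
    qed
    have ex: "\<exists>n. 2 * (1/2::real)^n < e" if "0 < e" for e
      using real_arch_pow_inv[of "e/2" "1/2"] that by (auto simp: mult.commute)
    have "Cauchy z"
      unfolding Cauchy_def
    proof (intro allI impI)
      fix e :: real assume "0 < e"
      then obtain n where n: "2 * (1/2::real)^n < e" using ex by blast
      have "dist (z i) (z j) < e" if "Suc n \<le> i" "Suc n \<le> j" for i j
      proof -
        have "z i \<in> P (s (Suc n))" "z j \<in> P (s (Suc n))"
          using Pmono[OF that(1)] Pmono[OF that(2)] z[of i] z[of j] by blast+
        then show ?thesis using close[of "z i" n "z j"] n by linarith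
      qed
      then show "\<exists>M. \<forall>m\<ge>M. \<forall>n\<ge>M. dist (z m) (z n) < e" by blast
    qed
    then obtain w where lim: "z \<longlonglongrightarrow> w" using convergent_eq_Cauchy by (metis convergent_def)
    have "w \<in> F" using closed_sequentially[OF F _ lim] z by (auto simp: P_def)
    \<comment> \<open>The point lies in the closure of the image of every piece on the branch, and
      these images shrink to \<open>g w\<close>.\<close>
    have "g w = x"
    proof (rule ccontr)
      assume "g w \<noteq> x"
      define e where "e = dist (g w) x / 2"
      have "0 < e" using \<open>g w \<noteq> x\<close> by (simp add: e_def)
      then obtain r where r: "0 < r" "\<And>y. dist y w < r \<Longrightarrow> dist (g y) (g w) < e"
        using g unfolding continuous_on_iff by (metis UNIV_I)
      obtain n where n: "2 * (1/2::real)^n < r" using ex r(1) by blast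
      have "dist y w \<le> 2 * (1/2)^n" if "y \<in> P (s (Suc n))" for y
      proof (rule tendsto_upperbound)
        show "(\<lambda>k. dist y (z k)) \<longlonglongrightarrow> dist y w" using lim by (intro tendsto_intros)
        show "\<forall>\<^sub>F k in sequentially. dist y (z k) \<le> 2 * (1/2)^n"
          using close[OF that] z Pmono[of "Suc n", THEN subsetD] by (auto simp: eventually_sequentially intro!: exI[of _ "Suc n"])
      qed simp
      then have "dist y w < r" if "y \<in> P (s (Suc n))" for y using that n le_less_trans by blast
      then have "g ` P (s (Suc n)) \<subseteq> cball (g w) e" using r(2) by (auto simp: dist_commute less_imp_le)
      then have "x \<in> cball (g w) e" using cl[of "Suc n"] closure_minimal by blast
      then show False using \<open>0 < e\<close> by (simp add: e_def mem_cball)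
    qed
    with \<open>w \<in> F\<close> show "x \<in> g ` F" by auto
  qed
  moreover have "D n s \<in> sets borel" for n s
    unfolding D_def by (intro sets.finite_INT sets.Int C(1) borel_closed) auto
  then have "(\<Inter>n. \<Union>s\<in>{s. length s = n}. D n s) \<in> sets borel"
    by (intro sets.countable_INT'' sets.countable_UN') auto
  ultimately show ?thesis by simp
qed

theorem Lusin_Souslin:
  fixes g :: "'a::{complete_space, second_countable_topology} \<Rightarrow> 'b::metric_space"
  assumes B: "B \<in> sets borel" and g: "continuous_on UNIV g" and inj: "inj_on g B"
  shows "g ` B \<in> sets borel"
proof -
  obtain F :: "('a \<times> (nat \<Rightarrow> real)) set" where F: "closed F" "inj_on fst F" "fst ` F = B"
    using borel_inj_closed_proj[OF B] by (auto simp: inj_closed_proj_def)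
  have "continuous_on UNIV (g \<circ> (fst :: 'a \<times> (nat \<Rightarrow> real) \<Rightarrow> 'a))"
    by (intro continuous_on_compose continuous_intros continuous_on_subset[OF g]) auto
  moreover have "inj_on (g \<circ> fst) F" using F inj by (simp add: comp_inj_on)
  ultimately have "(g \<circ> fst) ` F \<in> sets borel" by (rule continuous_inj_image_closed_borel[OF F(1)])
  then show ?thesis using F(3) by (metis image_comp)
qed

text \<open>The graph of \<open>g\<close> over \<open>B\<close> is Borel, and its second projection
  is continuous and injective.\<close>

corollary borel_inj_image:
  fixes g :: "'a::{complete_space, second_countable_topology} \<Rightarrow> 'b::{complete_space, second_countable_topology}"
  assumes B: "B \<in> sets borel" and g: "g \<in> borel_measurable borel" and inj: "inj_on g B"
  shows "g ` B \<in> sets borel"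
proof -
  let ?G = "{z. g (fst z) = snd z \<and> fst z \<in> B}"
  have "?G \<in> sets borel"
  proof -
    have "?G = {z \<in> space borel. g (fst z) = snd z} \<inter> fst -` B \<inter> space borel" by auto
    moreover have "(\<lambda>z. g (fst z)) \<in> borel_measurable (borel :: ('a \<times> 'b) measure)"
      "(snd :: 'a \<times> 'b \<Rightarrow> 'b) \<in> borel_measurable borel"
      "(fst :: 'a \<times> 'b \<Rightarrow> 'a) \<in> borel_measurable borel"
      using g by (auto simp: borel_prod[symmetric])
    ultimately show ?thesis using B by (auto intro!: sets.Int borel_measurable_eq simp: Int_assoc measurable_sets)
  qed
  moreover have "inj_on snd ?G" using inj by (auto simp: inj_on_def)
  ultimately have "snd ` ?G \<in> sets borel" by (intro Lusin_Souslin continuous_on_snd continuous_on_id)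
  moreover have "snd ` ?G = g ` B" by (auto simp: image_iff)
  ultimately show ?thesis by simp
qed


section \<open>Standard Borel spaces as Borel sets of reals\<close>

text \<open>Base 3 with digits 0 and 1: all digits after a position together weigh at most half of a
  1 at this position, so the expansion is unique, unlike in base 2.\<close>

definition ternary :: "(nat \<Rightarrow> bool) \<Rightarrow> real" where
  "ternary b = (\<Sum>n. of_bool (b n) * (1/3)^n)"

lemma summable_ternary: "summable (\<lambda>n. of_bool (b n) * (1/3::real)^n)"
  by (rule summable_comparison_test'[where g = "\<lambda>n. (1/3::real)^n" and N = 0])
     (auto intro: summable_geometric)

lemma ternary_less:
  assumes "\<And>m. m < n \<Longrightarrow> a m = b m" "\<not> a n" "b n" shows "ternary a < ternary b"
proof -
  let ?f = "\<lambda>b n. of_bool (b n) * (1/3::real)^n"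
  have split: "ternary c = (\<Sum>m. ?f c (m + Suc n)) + sum (?f c) {..<Suc n}" for c
    unfolding ternary_def by (rule suminf_split_initial_segment[OF summable_ternary])
  have "(\<Sum>m. ?f a (m + Suc n)) \<le> (\<Sum>m. (1/3)^Suc n * (1/3::real)^m)"
    by (intro suminf_le summable_mult summable_geometric)
      (use summable_ignore_initial_segment[OF summable_ternary[of a], of "Suc n"] in \<open>auto simp: power_add\<close>)
  also have "\<dots> = (1/3)^Suc n * (\<Sum>m. (1/3::real)^m)" by (intro suminf_mult summable_geometric) auto
  also have "\<dots> = (1/3)^n * (1/2)" by (subst suminf_geometric) auto
  also have "\<dots> < (1/3)^n" by simp
  finally have "(\<Sum>m. ?f a (m + Suc n)) < (1/3)^n" .
  moreover have "0 \<le> (\<Sum>m. ?f b (m + Suc n))"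
    by (intro suminf_nonneg summable_ignore_initial_segment[OF summable_ternary]) auto
  moreover have "sum (?f a) {..<n} = sum (?f b) {..<n}" using assms by (intro sum.cong) auto
  ultimately show ?thesis unfolding split[of a] split[of b] using assms by simp
qed

lemma ternary_inject: "ternary a = ternary b \<longleftrightarrow> a = b"
proof
  assume eq: "ternary a = ternary b"
  show "a = b"
  proof (rule ccontr)
    assume "a \<noteq> b"
    then have ex: "\<exists>n. a n \<noteq> b n" by auto
    define n where "n = (LEAST n. a n \<noteq> b n)"
    have "a n \<noteq> b n" using ex unfolding n_def by (rule LeastI_ex)
    moreover have "a m = b m" if "m < n" for m using that not_less_Least unfolding n_def by blast
    ultimately show False using ternary_less[of n a b] ternary_less[of n b a] eq by fastforce
  qed
qed simp

text \<open>Each entry is coded by its cut, the set of rationals above it, and all cuts are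
  interleaved into one digit sequence.\<close>

definition cut_code :: "(nat \<Rightarrow> real) \<Rightarrow> real" where
  "cut_code y = ternary (\<lambda>n. y (fst (prod_decode n)) < real_of_rat (from_nat (snd (prod_decode n))))"

lemma inj_cut_code: "inj cut_code"
proof (rule injI)
  fix y z assume "cut_code y = cut_code z"
  then have eq: "(y (fst (prod_decode n)) < real_of_rat (from_nat (snd (prod_decode n)))) \<longleftrightarrow>
      (z (fst (prod_decode n)) < real_of_rat (from_nat (snd (prod_decode n))))" for n
    unfolding cut_code_def ternary_inject by meson
  have "y i < real_of_rat q \<longleftrightarrow> z i < real_of_rat q" for i q
    using eq[of "prod_encode (i, to_nat q)"] by simp
  then have "y i = z i" for i
    by (metis linorder_less_linear of_rat_dense order_less_asym)
  then show "y = z" by auto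
qed

lemma measurable_cut_code: "cut_code \<in> borel_measurable borel"
proof -
  have [measurable]: "(\<lambda>y::nat \<Rightarrow> real. y i) \<in> borel_measurable borel" for i
    by (intro borel_measurable_continuous_onI continuous_on_product_coordinates)
  show ?thesis unfolding cut_code_def[abs_def] ternary_def by measurable
qed

text \<open>A point is mapped to its distances from a dense sequence. The image \<open>E\<close> is
  described by countably many inequalities: the triangle inequalities and the existence of
  arbitrarily small entries. By completeness every sequence that satisfies them is attained.\<close>

lemma Polish_embedding:
  assumes "Polish_space T"
  obtains e :: "'a \<Rightarrow> nat \<Rightarrow> real" where "e \<in> borel_measurable (borel_of T)" "inj_on e (topspace T)"
    "\<And>B. B \<in> sets (borel_of T) \<Longrightarrow> e ` B \<in> sets borel"
proof -
  obtain M d where "Metric_space M d" and complete: "Metric_space.mcomplete M d"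
    and T: "T = Metric_space.mtopology M d"
    using assms unfolding Polish_space_def completely_metrizable_space_def by blast
  then interpret Metric_space M d by simp
  have top: "topspace T = M" using T by simp
  have space: "space (borel_of T) = M"
    unfolding borel_of_def using top openin_subset[of T] by (subst space_measure_of) auto
  have sets: "sets (borel_of T) = sigma_sets M {U. openin T U}"
    unfolding borel_of_def using top openin_subset[of T] by (subst sets_measure_of) auto
  show thesis
  proof (cases "M = {}")
    case True
    show thesis
    proof (rule that[of "\<lambda>_ _. 0"])
      show "(\<lambda>_ _. 0) ` B \<in> sets borel" if "B \<in> sets (borel_of T)" for B :: "'a set"
        using sets.sets_into_space[OF that] space True by simp
    qed (use top True in auto)
  next
    case False
    obtain D where D: "countable D" "D \<subseteq> M" "T closure_of D = M"
      using assms top unfolding Polish_space_def separable_space_def by blast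
    then have "D \<noteq> {}" using False by auto
    define \<delta> where "\<delta> = from_nat_into D"
    have \<delta>: "\<delta> n \<in> M" for n using from_nat_into[OF \<open>D \<noteq> {}\<close>] D(2) by (auto simp: \<delta>_def)
    have dense: "\<exists>n. d x (\<delta> n) < r" if "x \<in> M" "0 < r" for x r
    proof -
      have "x \<in> T closure_of D" using that D by simp
      then have "\<exists>y\<in>D. y \<in> mball x r"
        unfolding T metric_closure_of using \<open>0 < r\<close> by blast
      then obtain y where "y \<in> D" "y \<in> mball x r" by blast
      then show ?thesis using from_nat_into_surj[OF D(1)] by (auto simp: \<delta>_def)
    qed
    define e where "e x = (\<lambda>n. d x (\<delta> n))" for x
    define E where "E = {y. (\<forall>n m. \<bar>y n - y m\<bar> \<le> d (\<delta> n) (\<delta> m) \<and> d (\<delta> n) (\<delta> m) \<le> y n + y m)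
       \<and> (\<forall>k. \<exists>n. y n < 1 / Suc k)}"
    have small: "\<exists>k. 1 / Suc k < r" if "0 < r" for r :: real
      using that nat_approx_posE by blast
    have eE: "e x \<in> E" if "x \<in> M" for x
    proof -
      have "\<bar>d x (\<delta> n) - d x (\<delta> m)\<bar> \<le> d (\<delta> n) (\<delta> m)" "d (\<delta> n) (\<delta> m) \<le> d x (\<delta> n) + d x (\<delta> m)" for n m
        using triangle[OF that \<delta>[of n] \<delta>[of m]] triangle[OF that \<delta>[of m] \<delta>[of n]]
          triangle[OF \<delta>[of n] that \<delta>[of m]] commute by (auto simp: abs_le_iff)
      moreover have "\<exists>n. d x (\<delta> n) < 1 / Suc k" for k using dense[OF that, of "1 / Suc k"] by simp
      ultimately show ?thesis by (auto simp: E_def e_def)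
    qed
    \<comment> \<open>The dense points at which \<open>y\<close> is small form a Cauchy sequence, as
      \<open>y n + y m\<close> bounds their distances, and \<open>y\<close> lists the distances from
      its limit.\<close>
    have Ee: "\<exists>x\<in>M. e x = y" if y: "y \<in> E" for y
    proof -
      have pos: "0 \<le> y n" for n using y zero[OF \<delta>[of n] \<delta>[of n]] by (auto simp: E_def dest!: spec[of _ n])
      have "\<forall>k. \<exists>n. y n < 1 / Suc k" using y by (simp add: E_def)
      then obtain n where n: "\<And>k. y (n k) < 1 / Suc k" by metis
      have "MCauchy (\<lambda>k. \<delta> (n k))"
        unfolding MCauchy_def
      proof (intro conjI allI impI)
        show "range (\<lambda>k. \<delta> (n k)) \<subseteq> M" using \<delta> by auto
        fix r :: real assume "0 < r"
        then obtain K where K: "1 / Suc K < r / 2" using small[of "r/2"] by auto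
        have "d (\<delta> (n i)) (\<delta> (n j)) < r" if "K \<le> i" "K \<le> j" for i j
        proof -
          have "1 / real (Suc i) \<le> 1 / Suc K" "1 / real (Suc j) \<le> 1 / Suc K"
            using that by (auto intro!: divide_left_mono)
          moreover have "d (\<delta> (n i)) (\<delta> (n j)) \<le> y (n i) + y (n j)" using y by (simp add: E_def)
          ultimately show ?thesis using n[of i] n[of j] K by linarith
        qed
        then show "\<exists>N. \<forall>i j. N \<le> i \<longrightarrow> N \<le> j \<longrightarrow> d (\<delta> (n i)) (\<delta> (n j)) < r" by blast
      qed
      then obtain x where x: "limitin mtopology (\<lambda>k. \<delta> (n k)) x sequentially"
        using complete by (auto simp: mcomplete_def)
      then have xM: "x \<in> M" by (simp add: limitin_mspace)
      have "e x m = y m" for m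
      proof (rule ccontr)
        assume "e x m \<noteq> y m"
        then have "0 < \<bar>e x m - y m\<bar> / 3" by simp
        then obtain K1 where K1: "1 / Suc K1 < \<bar>e x m - y m\<bar> / 3" using small by blast
        obtain K2 where K2: "\<And>k. K2 \<le> k \<Longrightarrow> d (\<delta> (n k)) x < \<bar>e x m - y m\<bar> / 3"
          using x \<open>0 < \<bar>e x m - y m\<bar> / 3\<close> unfolding limit_metric_sequentially by meson
        define k where "k = max K1 K2"
        have "1 / real (Suc k) \<le> 1 / Suc K1" by (auto intro!: divide_left_mono simp: k_def)
        then have "y (n k) < \<bar>e x m - y m\<bar> / 3" using n[of k] K1 by linarith
        moreover have "d (\<delta> (n k)) x < \<bar>e x m - y m\<bar> / 3" using K2 by (simp add: k_def)
        moreover have "\<bar>e x m - d (\<delta> (n k)) (\<delta> m)\<bar> \<le> d (\<delta> (n k)) x"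
          using triangle[OF xM \<delta>[of "n k"] \<delta>[of m]] triangle[OF \<delta>[of "n k"] xM \<delta>[of m]]
            commute[of x "\<delta> (n k)"] by (auto simp: e_def abs_le_iff)
        moreover have "\<bar>y m - d (\<delta> (n k)) (\<delta> m)\<bar> \<le> y (n k)"
        proof -
          have "\<bar>y (n k) - y m\<bar> \<le> d (\<delta> (n k)) (\<delta> m)" "d (\<delta> (n k)) (\<delta> m) \<le> y (n k) + y m"
            using y by (auto simp: E_def)
          then show ?thesis by (auto simp: abs_le_iff)
        qed
        ultimately show False
          using abs_triangle_ineq4[of "e x m - d (\<delta> (n k)) (\<delta> m)" "y m - d (\<delta> (n k)) (\<delta> m)"] by auto
      qed
      with xM show ?thesis by auto
    qed
    have [measurable]: "(\<lambda>y::nat \<Rightarrow> real. y i) \<in> borel_measurable borel" for i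
      by (intro borel_measurable_continuous_onI continuous_on_product_coordinates)
    have EB: "E \<in> sets borel"
    proof -
      have "Measurable.pred borel (\<lambda>y::nat \<Rightarrow> real. (\<forall>n m. \<bar>y n - y m\<bar> \<le> d (\<delta> n) (\<delta> m) \<and> d (\<delta> n) (\<delta> m) \<le> y n + y m)
       \<and> (\<forall>k. \<exists>n. y n < 1 / Suc k))" by measurable
      then show ?thesis unfolding E_def by (simp add: pred_def)
    qed
    have inj: "inj_on e M"
    proof (rule inj_onI, rule ccontr)
      fix x y assume *: "x \<in> M" "y \<in> M" "e x = e y" "x \<noteq> y"
      then have "0 < d x y / 2" by simp
      then obtain n where n: "d x (\<delta> n) < d x y / 2" using dense[OF *(1)] by blast
      moreover have "d y (\<delta> n) = d x (\<delta> n)" using fun_cong[OF *(3), of n] by (simp add: e_def)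
      ultimately show False using triangle[OF *(1) \<delta>[of n] *(2)] commute[of y "\<delta> n"] by auto
    qed
    have img: "e ` U \<in> sets borel" if "U \<in> sigma_sets M {U. openin T U}" for U
      using that
    proof induction
      case (Basic U)
      then have U: "openin T U" by simp
      \<comment> \<open>An open set is the union of the balls around dense points that it contains,
        and membership in such a ball is a condition on one coordinate of the image.\<close>
      have "e ` U = E \<inter> {y. \<exists>n k. mball (\<delta> n) (1 / Suc k) \<subseteq> U \<and> y n < 1 / Suc k}"
      proof (intro set_eqI iffI)
        fix y assume "y \<in> e ` U"
        then obtain x where x: "x \<in> U" "y = e x" by auto
        obtain r where r: "0 < r" "mball x r \<subseteq> U" using U x(1) unfolding T openin_mtopology by blast
        have xM: "x \<in> M" using U x(1) openin_subset top by blast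
        obtain k where k: "1 / Suc k < r / 2" using small[of "r/2"] r by auto
        obtain n where n: "d x (\<delta> n) < 1 / Suc k" using dense[OF xM, of "1 / Suc k"] by auto
        have "mball (\<delta> n) (1 / Suc k) \<subseteq> mball x r"
        proof
          fix z assume "z \<in> mball (\<delta> n) (1 / Suc k)"
          then show "z \<in> mball x r" using triangle[OF xM \<delta>[of n], of z] n k xM by auto
        qed
        then show "y \<in> E \<inter> {y. \<exists>n k. mball (\<delta> n) (1 / Suc k) \<subseteq> U \<and> y n < 1 / Suc k}"
          using eE[OF xM] x n r by (auto simp: e_def)
      next
        fix y assume y: "y \<in> E \<inter> {y. \<exists>n k. mball (\<delta> n) (1 / Suc k) \<subseteq> U \<and> y n < 1 / Suc k}"
        then obtain x where x: "x \<in> M" "e x = y" using Ee by blast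
        obtain n k where nk: "mball (\<delta> n) (1 / Suc k) \<subseteq> U" "y n < 1 / Suc k" using y by blast
        then have "x \<in> mball (\<delta> n) (1 / Suc k)" using x \<delta>[of n] commute[of x] by (auto simp: e_def)
        then show "y \<in> e ` U" using nk x by blast
      qed
      moreover have "Measurable.pred borel (\<lambda>y::nat \<Rightarrow> real. \<exists>n k. mball (\<delta> n) (1 / Suc k) \<subseteq> U \<and> y n < 1 / Suc k)"
        by measurable
      ultimately show ?case using EB by (auto simp: pred_def)
    next
      case Empty
      then show ?case by simp
    next
      case (Compl a)
      have "a \<subseteq> M" using Compl(1) by (rule sigma_sets_into_sp[rotated]) (use openin_subset[of T] top in auto)
      moreover have "e ` M = E" using eE Ee by auto
      ultimately have "e ` (M - a) = E - e ` a" using inj_on_image_set_diff[OF inj, of M a] by auto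
      with Compl EB show ?case by auto
    next
      case (Union a)
      then show ?case by (auto simp: image_UN)
    qed
    have meas: "e \<in> borel_measurable (borel_of T)"
    proof (rule measurable_coordinatewise_then_product, rule borel_measurableI_less)
      fix i r
      have "openin T (mball (\<delta> i) r)" by (simp add: T)
      moreover have "{x \<in> space (borel_of T). e x i < r} = mball (\<delta> i) r"
        unfolding space e_def mball_def using \<delta>[of i] commute by auto
      ultimately show "{x \<in> space (borel_of T). e x i < r} \<in> sets (borel_of T)" by (simp add: sets sigma_sets.Basic)
    qed
    show thesis using that[of e] meas inj img top sets by metis
  qed
qed

theorem standard_Borel_embedding:
  assumes "standard_Borel X"
  obtains \<kappa> :: "'a \<Rightarrow> real" where "\<kappa> \<in> borel_measurable X" "inj_on \<kappa> (space X)"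
    "\<And>B. B \<in> sets X \<Longrightarrow> \<kappa> ` B \<in> sets borel"
proof -
  obtain T where T: "Polish_space T" "topspace T = space X" "sets X = sets (borel_of T)"
    using assms by (auto simp: standard_Borel_def)
  obtain e :: "'a \<Rightarrow> nat \<Rightarrow> real" where e: "e \<in> borel_measurable (borel_of T)" "inj_on e (topspace T)"
    "\<And>B. B \<in> sets (borel_of T) \<Longrightarrow> e ` B \<in> sets borel" using Polish_embedding[OF T(1)] by blast
  have em: "e \<in> borel_measurable X" using e(1) measurable_cong_sets[OF T(3) refl] by blast
  show thesis
  proof (rule that[of "cut_code \<circ> e"])
    show "cut_code \<circ> e \<in> borel_measurable X" using em measurable_cut_code by (rule measurable_comp)
    show "inj_on (cut_code \<circ> e) (space X)"
      using e(2) inj_cut_code T(2) by (metis comp_inj_on inj_on_subset subset_UNIV)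
    show "(cut_code \<circ> e) ` B \<in> sets borel" if "B \<in> sets X" for B
      unfolding image_comp[symmetric]
      using e(3) that T(3) by (intro borel_inj_image measurable_cut_code inj_on_subset[OF inj_cut_code]) auto
  qed
qed

section \<open>Borel sets with bounded sections\<close>

lemma single_valued_fst_image_borel:
  fixes G :: "(real \<times> real) set"
  assumes "G \<in> sets borel" "single_valued G" shows "fst ` G \<in> sets borel"
  by (rule Lusin_Souslin[OF assms(1)])
    (use assms(2) in \<open>auto simp: single_valued_def inj_on_def intro!: continuous_intros\<close>)

text \<open>Peeling off the smallest element of each section of maximal size lowers the bound. The set of
  those points is the injective image of the Borel set of increasing enumerations of such sections.\<close>

lemma bounded_sections_single_valued:
  fixes A :: "(real \<times> real) set"
  assumes "A \<in> sets borel" "\<And>x. finite {y. (x, y) \<in> A} \<and> card {y. (x, y) \<in> A} \<le> N"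
  shows "\<exists>G :: nat \<Rightarrow> (real \<times> real) set. (\<forall>i. G i \<in> sets borel \<and> single_valued (G i)) \<and> A = (\<Union>i. G i)"
  using assms
proof (induction N arbitrary: A)
  case 0
  then have "{y. (x, y) \<in> A} = {}" for x using "0.prems"(2)[of x] by (metis card_0_eq le_zero_eq)
  then have "A = {}" by auto
  then show ?case by (intro exI[of _ "\<lambda>_. {}"]) auto
next
  case (Suc N)
  let ?n = "Suc N"
  let ?Y = "\<lambda>x. {y. (x, y) \<in> A}"
  \<comment> \<open>The zeros after the enumeration leave no freedom, so that the first component
    determines the whole tuple.\<close>
  let ?P = "\<lambda>z :: real \<times> (nat \<Rightarrow> real). (\<forall>i. i < ?n \<longrightarrow> (fst z, snd z i) \<in> A) \<and>
      (\<forall>i. Suc i < ?n \<longrightarrow> snd z i < snd z (Suc i)) \<and> (\<forall>i. ?n \<le> i \<longrightarrow> snd z i = 0)"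
  let ?g = "\<lambda>z :: real \<times> (nat \<Rightarrow> real). (fst z, snd z 0)"
  have [measurable]: "(\<lambda>z :: real \<times> (nat \<Rightarrow> real). snd z i) \<in> borel_measurable borel" for i
    by (intro borel_measurable_continuous_onI continuous_intros)
  have [measurable]: "(fst :: real \<times> (nat \<Rightarrow> real) \<Rightarrow> real) \<in> borel_measurable borel"
    by (intro borel_measurable_continuous_onI continuous_intros)
  have "(\<lambda>z :: real \<times> (nat \<Rightarrow> real). (fst z, snd z i)) \<in> borel_measurable borel" for i
    by (intro borel_measurable_continuous_onI continuous_intros)
  then have [measurable]: "Measurable.pred borel (\<lambda>z :: real \<times> (nat \<Rightarrow> real). (fst z, snd z i) \<in> A)" for i
    using Suc.prems(1) by (rule pred_sets2[rotated])
  have TT: "Collect ?P \<in> sets borel"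
  proof -
    have "Measurable.pred borel ?P" by measurable
    then show ?thesis by (simp add: pred_def)
  qed
  \<comment> \<open>A section has at most \<open>Suc N\<close> points, so \<open>Suc N\<close>
    distinct ones exhaust it.\<close>
  have enum: "map (snd z) [0..<?n] = sorted_list_of_set (?Y (fst z))" if "?P z" for z
  proof -
    have "sorted_wrt (<) (map (snd z) [0..<?n])"
      using that by (subst sorted_wrt_iff_nth_Suc_transp) (auto simp del: upt_Suc)
    then have s: "sorted (map (snd z) [0..<?n])" "distinct (map (snd z) [0..<?n])"
      using strict_sorted_iff by blast+
    have sub: "set (map (snd z) [0..<?n]) \<subseteq> ?Y (fst z)" using that by auto
    have "card (set (map (snd z) [0..<?n])) = ?n" using distinct_card[OF s(2)] by simp
    then have "set (map (snd z) [0..<?n]) = ?Y (fst z)"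
      using sub Suc.prems(2)[of "fst z"] by (intro card_seteq) auto
    then show ?thesis using s by (metis sorted_list_of_set.idem_if_sorted_distinct)
  qed
  define G where "G = ?g ` Collect ?P"
  have eq: "z = w" if "?P z" "?P w" "fst z = fst w" for z w
  proof -
    have "map (snd z) [0..<?n] = map (snd w) [0..<?n]" 
      unfolding enum[OF that(1)] enum[OF that(2)] that(3) ..
    then have "snd z i = snd w i" if "i < ?n" for i
      using that by (metis add.left_neutral diff_zero length_upt nth_map nth_upt)
    moreover have "snd z i = snd w i" if "?n \<le> i" for i using \<open>?P z\<close> \<open>?P w\<close> that by simp
    ultimately have "snd z i = snd w i" for i by (meson not_less)
    then show ?thesis using that(3) by (auto simp: prod_eq_iff)
  qed
  have GB: "G \<in> sets borel"
    unfolding G_def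
  proof (rule Lusin_Souslin[OF TT])
    show "inj_on ?g (Collect ?P)"
    proof (rule inj_onI)
      fix z w assume "z \<in> Collect ?P" "w \<in> Collect ?P" "?g z = ?g w"
      then show "z = w" by (intro eq) simp_all
    qed
  qed (intro continuous_intros)
  have Gsv: "single_valued G"
  proof (rule single_valuedI)
    fix x y y' assume "(x, y) \<in> G" "(x, y') \<in> G"
    then obtain z w where zw: "?P z" "?P w" "(x, y) = ?g z" "(x, y') = ?g w"
      unfolding G_def by (elim imageE CollectE)
    then have "z = w" by (intro eq) simp_all
    then show "y = y'" using zw by simp
  qed
  have GA: "G \<subseteq> A" unfolding G_def by auto
  have small: "finite {y. (x, y) \<in> A - G} \<and> card {y. (x, y) \<in> A - G} \<le> N" for x
  proof -
    have fin: "finite (?Y x)" and le: "card (?Y x) \<le> ?n" using Suc.prems(2)[of x] by auto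
    have sub: "{y. (x, y) \<in> A - G} \<subseteq> ?Y x" by auto
    show ?thesis
    proof (cases "card (?Y x) = ?n")
      case False
      then show ?thesis using card_mono[OF fin sub] le finite_subset[OF sub fin] by auto
    next
      case True
      let ?l = "sorted_list_of_set (?Y x)"
      let ?z = "(x, \<lambda>i. if i < ?n then ?l ! i else 0)"
      have len: "length ?l = ?n" using True by simp
      have "?z \<in> Collect ?P"
        unfolding mem_Collect_eq
      proof (intro conjI allI impI)
        show "(fst ?z, snd ?z i) \<in> A" if "i < ?n" for i
          using nth_mem[of i ?l] that len fin by auto
        show "snd ?z i < snd ?z (Suc i)" if "Suc i < ?n" for i
          using sorted_wrt_nth_less[OF strict_sorted_list_of_set, of i "Suc i" "?Y x"] that len by auto
      qed auto
      then have "?g ?z \<in> G" unfolding G_def by (rule imageI)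
      then obtain y0 where y0: "(x, y0) \<in> G" unfolding fst_conv by (rule that)
      then have "y0 \<in> ?Y x" using GA by blast
      then have "card (?Y x - {y0}) = N" using True fin by simp
      moreover have "{y. (x, y) \<in> A - G} \<subseteq> ?Y x - {y0}" using y0 by blast
      ultimately show ?thesis using card_mono[of "?Y x - {y0}"] fin finite_subset[OF sub fin] by fastforce
    qed
  qed
  obtain G' where G': "\<And>i. G' i \<in> sets borel \<and> single_valued (G' i)" "A - G = (\<Union>i::nat. G' i)"
    using Suc.IH[of "A - G"] small Suc.prems(1) GB by blast
  show ?case
  proof (intro exI[of _ "\<lambda>i. case i of 0 \<Rightarrow> G | Suc i \<Rightarrow> G' i"] conjI allI)
    show "A = (\<Union>i. case i of 0 \<Rightarrow> G | Suc i \<Rightarrow> G' i)"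
    proof (intro set_eqI iffI)
      fix z assume "z \<in> A"
      then have "z \<in> G \<or> (\<exists>i. z \<in> G' i)" using G'(2) by blast
      then show "z \<in> (\<Union>i. case i of 0 \<Rightarrow> G | Suc i \<Rightarrow> G' i)"
      proof
        assume "z \<in> G" then show ?thesis by (intro UN_I[of 0]) auto
      next
        assume "\<exists>i. z \<in> G' i"
        then obtain i where "z \<in> G' i" by blast
        then show ?thesis by (intro UN_I[of "Suc i"]) auto
      qed
    next
      fix z assume "z \<in> (\<Union>i. case i of 0 \<Rightarrow> G | Suc i \<Rightarrow> G' i)"
      then obtain i where "z \<in> (case i of 0 \<Rightarrow> G | Suc i \<Rightarrow> G' i)" by blast
      then show "z \<in> A" using GA G'(2) by (cases i) auto
    qed
  qed (use GB Gsv G'(1) in \<open>auto split: nat.splits\<close>)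
qed

text \<open>The relation is carried to the plane by \<open>\<kappa>\<close> and split into countably
  many Borel graphs of partial functions. Where such a function is undefined, the point itself is
  the value, a default that stays in \<open>X\<close> without any further choice.\<close>

theorem bounded_sections_selectors:
  assumes X: "standard_Borel X" and A: "A \<in> sets (X \<Otimes>\<^sub>M X)"
    and bound: "\<And>x. x \<in> space X \<Longrightarrow> finite {y. (x, y) \<in> A} \<and> card {y. (x, y) \<in> A} \<le> N"
  obtains n :: "nat \<Rightarrow> 'a \<Rightarrow> 'a" where "\<And>i. n i \<in> measurable X X"
    "\<And>x i. x \<in> space X \<Longrightarrow> n i x = x \<or> (x, n i x) \<in> A"
    "\<And>x y. (x, y) \<in> A \<Longrightarrow> \<exists>i. n i x = y"
proof -
  obtain \<kappa> :: "'a \<Rightarrow> real" where \<kappa>: "\<kappa> \<in> borel_measurable X" "inj_on \<kappa> (space X)"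
    "\<And>B. B \<in> sets X \<Longrightarrow> \<kappa> ` B \<in> sets borel" using standard_Borel_embedding[OF X] by blast
  have Asub: "A \<subseteq> space X \<times> space X" using sets.sets_into_space[OF A] by (simp add: space_pair_measure)
  let ?k = "map_prod \<kappa> \<kappa>"
  have kinj: "inj_on ?k (space X \<times> space X)" using \<kappa>(2) by (simp add: map_prod_inj_on)
  have times: "?k ` (a \<times> b) = \<kappa> ` a \<times> \<kappa> ` b" for a b by force
  have img: "?k ` B \<in> sets borel" if "B \<in> sets (X \<Otimes>\<^sub>M X)" for B
  proof -
    have "B \<in> sigma_sets (space X \<times> space X) {a \<times> b |a b. a \<in> sets X \<and> b \<in> sets X}"
      using that by (simp add: sets_pair_measure)
    then show ?thesis
    proof induction
      case (Basic a)
      then show ?case using \<kappa>(3) by (auto simp: times borel_prod[symmetric])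
    next
      case (Compl a)
      have "a \<subseteq> space X \<times> space X" using sigma_sets_into_sp[OF _ Compl(1)] sets.sets_into_space by blast
      then have "?k ` (space X \<times> space X - a) = \<kappa> ` space X \<times> \<kappa> ` space X - ?k ` a"
        using kinj by (subst inj_on_image_set_diff[OF kinj]) (auto simp: times)
      moreover have "\<kappa> ` space X \<times> \<kappa> ` space X \<in> sets borel"
        using \<kappa>(3)[of "space X"] by (auto simp: borel_prod[symmetric])
      ultimately show ?case using Compl by auto
    qed (auto simp: image_UN)
  qed
  have sect: "{y. (x, y) \<in> ?k ` A} = (if x \<in> \<kappa> ` space X then \<kappa> ` {y. (inv_into (space X) \<kappa> x, y) \<in> A} else {})" for x
    using Asub \<kappa>(2) by (auto simp: image_iff inv_into_f_f) (force simp: inv_into_f_f)+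
  have "finite {y. (x, y) \<in> ?k ` A} \<and> card {y. (x, y) \<in> ?k ` A} \<le> N" for x
    unfolding sect using bound[of "inv_into (space X) \<kappa> x"] by (auto simp: inv_into_into intro: card_image_le[THEN le_trans])
  then obtain G where G: "\<And>i. G i \<in> sets borel" "\<And>i. single_valued (G i)" "?k ` A = (\<Union>i::nat. G i)"
    using bounded_sections_single_valued[OF img[OF A]] by meson
  define P where "P i x y \<longleftrightarrow> y \<in> space X \<and> (\<kappa> x, \<kappa> y) \<in> G i" for i x y
  define n where "n i x = (if \<exists>y. P i x y then SOME y. P i x y else x)" for i x
  have uniq: "y = z" if "P i x y" "P i x z" for i x y z
    using that G(2)[of i] \<kappa>(2) unfolding P_def single_valued_def inj_on_def by blast
  have n_eq: "n i x = y" if "P i x y" for i x y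
    unfolding n_def using uniq that by (metis someI)
  have PA: "(x, y) \<in> A" if "P i x y" "x \<in> space X" for i x y
  proof -
    have "(\<kappa> x, \<kappa> y) \<in> ?k ` A" using that G(3) by (auto simp: P_def)
    then obtain x' y' where *: "(x', y') \<in> A" "\<kappa> x = \<kappa> x'" "\<kappa> y = \<kappa> y'" by auto
    then have "x' = x" "y' = y" using that Asub \<kappa>(2) by (auto simp: P_def inj_on_def)
    then show ?thesis using * by simp
  qed
  show thesis
  proof (rule that[of n])
    fix i
    \<comment> \<open>The part of the graph with values in \<open>B\<close> is still single-valued,
      hence its first projection is Borel.\<close>
    have dom: "{x \<in> space X. \<exists>y\<in>B. P i x y} \<in> sets X" if "B \<in> sets X" for B
    proof -
      have B: "B \<subseteq> space X" using that sets.sets_into_space by blast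
      have "G i \<inter> UNIV \<times> \<kappa> ` B \<in> sets borel"
        using G(1)[of i] \<kappa>(3)[OF that] by (intro sets.Int) (auto simp: borel_prod[symmetric])
      then have "fst ` (G i \<inter> UNIV \<times> \<kappa> ` B) \<in> sets borel"
        using G(2)[of i] by (intro single_valued_fst_image_borel) (auto simp: single_valued_def)
      then have "\<kappa> -` (fst ` (G i \<inter> UNIV \<times> \<kappa> ` B)) \<inter> space X \<in> sets X" using \<kappa>(1) by (rule measurable_sets[rotated])
      moreover have "\<kappa> -` (fst ` (G i \<inter> UNIV \<times> \<kappa> ` B)) \<inter> space X = {x \<in> space X. \<exists>y\<in>B. P i x y}"
        using B by (force simp: P_def)
      ultimately show ?thesis by simp
    qed
    show "n i \<in> measurable X X"
    proof (rule measurableI)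
      fix x assume "x \<in> space X"
      then show "n i x \<in> space X" using n_eq by (metis P_def n_def)
    next
      fix B assume B: "B \<in> sets X"
      have "n i -` B \<inter> space X = {x \<in> space X. \<exists>y\<in>B. P i x y} \<union> (B - {x \<in> space X. \<exists>y\<in>space X. P i x y})"
      proof (intro set_eqI iffI)
        fix x assume x: "x \<in> n i -` B \<inter> space X"
        show "x \<in> {x \<in> space X. \<exists>y\<in>B. P i x y} \<union> (B - {x \<in> space X. \<exists>y\<in>space X. P i x y})"
        proof (cases "\<exists>y. P i x y")
          case True
          then show ?thesis using n_eq x by auto
        next
          case False
          then have "n i x = x" by (simp add: n_def)
          then show ?thesis using False x by auto
        qed
      next
        fix x assume x: "x \<in> {x \<in> space X. \<exists>y\<in>B. P i x y} \<union> (B - {x \<in> space X. \<exists>y\<in>space X. P i x y})"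
        show "x \<in> n i -` B \<inter> space X"
        proof (cases "\<exists>y. P i x y")
          case True
          then obtain y where y: "P i x y" by blast
          then have "x \<in> {x \<in> space X. \<exists>y\<in>B. P i x y}" using x sets.sets_into_space[OF B] by (auto simp: P_def)
          then show ?thesis using n_eq by auto
        next
          case False
          then have "n i x = x" by (simp add: n_def)
          then show ?thesis using False x sets.sets_into_space[OF B] by auto
        qed
      qed
      then show "n i -` B \<inter> space X \<in> sets X" using dom[OF B] dom[OF sets.top] B by auto
    qed
  next
    fix x i assume "x \<in> space X"
    then show "n i x = x \<or> (x, n i x) \<in> A"
      using PA n_eq by (metis n_def)
  next
    fix x y assume xy: "(x, y) \<in> A"
    then have "(\<kappa> x, \<kappa> y) \<in> ?k ` A" by force
    then have "(\<kappa> x, \<kappa> y) \<in> (\<Union>i. G i)" unfolding G(3) .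
    then obtain i where "(\<kappa> x, \<kappa> y) \<in> G i" by blast
    then have "P i x y" using xy Asub by (auto simp: P_def)
    then show "\<exists>i. n i x = y" using n_eq by blast
  qed
qed


section \<open>Extending colorings over short cycles\<close>

abbreviation adj :: "('a \<times> 'a) set \<Rightarrow> 'a \<Rightarrow> 'a \<Rightarrow> bool" where
  "adj A x y \<equiv> (x, y) \<in> underlying A"

lemma adj_iff: "adj A x y \<longleftrightarrow> (x, y) \<in> A \<or> (y, x) \<in> A"
  by (simp add: underlying_def)

lemma adj_sym: "adj A x y \<longleftrightarrow> adj A y x"
  by (auto simp: underlying_def)

text \<open>A path in \<open>U\<close> of constant color is bad if it closes up to a dicycle or may be completed to a
  monochromatic dicycle outside of \<open>S\<close>, where any two vertices are treated as joined.\<close>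

definition bad_path :: "('a \<times> 'a) set \<Rightarrow> 'a set \<Rightarrow> 'a set \<Rightarrow> ('a \<Rightarrow> 'b) \<Rightarrow> 'a list \<Rightarrow> bool" where
  "bad_path A S U \<phi> p \<longleftrightarrow> p \<noteq> [] \<and> set p \<subseteq> U \<and> successively (\<lambda>x y. (x, y) \<in> A) p
     \<and> (\<exists>c. (\<forall>x\<in>set p. \<phi> x = c)
        \<and> ((last p, hd p) \<in> A \<or> (\<exists>y. y \<notin> S \<and> (y, hd p) \<in> A \<and> \<phi> y = c) \<and> (\<exists>y. y \<notin> S \<and> (last p, y) \<in> A \<and> \<phi> y = c)))"

lemma bad_path_converse_rev:
  "bad_path A S U \<phi> p \<Longrightarrow> bad_path (A\<inverse>) S U \<phi> (rev p)"
  unfolding bad_path_def by (auto simp: hd_rev last_rev)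

lemma bad_path_subset: "bad_path A S U \<phi> p \<Longrightarrow> U \<subseteq> V \<Longrightarrow> bad_path A S V \<phi> p"
  by (auto simp: bad_path_def)

lemma bad_path_mono:
  assumes "bad_path A S U \<phi> p" "A \<subseteq> B" shows "bad_path B S U \<phi> p"
proof -
  have "successively (\<lambda>x y. (x, y) \<in> B) p"
    using assms by (auto simp: bad_path_def intro: successively_mono)
  then show ?thesis using assms unfolding bad_path_def by blast
qed

text \<open>No path vertex of color \<open>c\<close> can follow \<open>v\<close>. So
  \<open>v\<close> would be the last vertex of a bad path through it, but the path could neither
  close up nor be left through an outer vertex of color \<open>c\<close>.\<close>

lemma no_bad_path_insert_out:
  assumes no: "\<And>p. \<not> bad_path A S U \<phi> p" and U: "U \<subseteq> S" "v \<in> S" "v \<notin> U" and irr: "irrefl A"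
    and free: "\<And>y. (v, y) \<in> A \<Longrightarrow> y \<in> U \<or> y \<notin> S \<Longrightarrow> \<phi> y \<noteq> c"
  shows "\<not> bad_path A S (insert v U) (\<phi>(v := c)) p"
proof
  let ?\<phi> = "\<phi>(v := c)"
  assume bad: "bad_path A S (insert v U) ?\<phi> p"
  have loop: "(v, v) \<notin> A" using irr by (simp add: irrefl_def)
  obtain k where k: "\<forall>x\<in>set p. ?\<phi> x = k" "(last p, hd p) \<in> A \<or>
      (\<exists>y. y \<notin> S \<and> (y, hd p) \<in> A \<and> ?\<phi> y = k) \<and> (\<exists>y. y \<notin> S \<and> (last p, y) \<in> A \<and> ?\<phi> y = k)"
    and p_props: "p \<noteq> []" "set p \<subseteq> insert v U" "successively (\<lambda>x y. (x, y) \<in> A) p"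
    using bad unfolding bad_path_def by blast
  have off: "?\<phi> x = \<phi> x" if "x \<notin> S" for x using that U by auto
  show False
  proof (cases "v \<in> set p")
    case False
    then have on: "?\<phi> x = \<phi> x" if "x \<in> set p" for x using that by auto
    have "\<forall>x\<in>set p. \<phi> x = k" using k(1) on by simp
    moreover have "(last p, hd p) \<in> A \<or>
      (\<exists>y. y \<notin> S \<and> (y, hd p) \<in> A \<and> \<phi> y = k) \<and> (\<exists>y. y \<notin> S \<and> (last p, y) \<in> A \<and> \<phi> y = k)"
      using k(2) off by metis
    ultimately have "bad_path A S U \<phi> p"
      using p_props False unfolding bad_path_def by blast
    then show False using no by blast
  next
    case True
    have "k = c" using k(1) True by force
    then have col: "?\<phi> x = c" if "x \<in> set p" for x using that k(1) by blast
    have nofollow: "(v, x) \<notin> A" if "x \<in> set p" for x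
    proof
      assume vx: "(v, x) \<in> A"
      then have "x \<noteq> v" using loop by auto
      then have "x \<in> U" "\<phi> x = c" using col[OF that] that p_props(2) by auto
      then show False using free[OF vx] by simp
    qed
    obtain a b where p: "p = a @ v # b" using True by (meson split_list)
    have "b = []"
    proof (rule ccontr)
      assume "b \<noteq> []"
      then have "(v, hd b) \<in> A" "hd b \<in> set p"
        using p_props(3) unfolding p by (auto simp: successively_append_iff successively_Cons)
      then show False using nofollow by blast
    qed
    then have lst: "last p = v" by (simp add: p)
    have "hd p \<in> set p" using p_props(1) by simp
    then have "\<exists>y. y \<notin> S \<and> (v, y) \<in> A \<and> ?\<phi> y = c"
      using k(2) lst nofollow \<open>k = c\<close> by metis
    then obtain y where y: "y \<notin> S" "(v, y) \<in> A" "?\<phi> y = c" by blast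
    then have "\<phi> y = c" using off by simp
    then show False using free[OF y(2)] y by simp
  qed
qed

text \<open>Reversing the arcs and the path exchanges in-neighbors and out-neighbors.\<close>

lemma no_bad_path_insert_in:
  assumes no: "\<And>p. \<not> bad_path A S U \<phi> p" and U: "U \<subseteq> S" "v \<in> S" "v \<notin> U" and irr: "irrefl A"
    and free: "\<And>y. (y, v) \<in> A \<Longrightarrow> y \<in> U \<or> y \<notin> S \<Longrightarrow> \<phi> y \<noteq> c"
  shows "\<not> bad_path A S (insert v U) (\<phi>(v := c)) p"
proof
  assume "bad_path A S (insert v U) (\<phi>(v := c)) p"
  then have "bad_path (A\<inverse>) S (insert v U) (\<phi>(v := c)) (rev p)" by (rule bad_path_converse_rev)
  moreover have "\<not> bad_path (A\<inverse>) S (insert v U) (\<phi>(v := c)) (rev p)"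
  proof (rule no_bad_path_insert_out[OF _ U])
    show "\<not> bad_path (A\<inverse>) S U \<phi> p" for p
      using no bad_path_converse_rev[of "A\<inverse>" S U \<phi> p] by auto
  qed (use irr free in \<open>auto simp: irrefl_def\<close>)
  ultimately show False by contradiction
qed

definition ucycle :: "('a \<times> 'a) set \<Rightarrow> 'a list \<Rightarrow> bool" where
  "ucycle A xs \<longleftrightarrow> 3 \<le> length xs \<and> distinct xs \<and> successively (adj A) xs \<and> adj A (last xs) (hd xs)"

text \<open>In- and outdegree at most 1 in the induced subdigraph, in a form without cardinalities
  that translates directly into Borel conditions.\<close>

definition thin :: "('a \<times> 'a) set \<Rightarrow> 'a set \<Rightarrow> bool" where
  "thin A S \<longleftrightarrow> (\<forall>u\<in>S. \<forall>a\<in>S. \<forall>b\<in>S.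
     ((u, a) \<in> A \<and> (u, b) \<in> A \<longrightarrow> a = b) \<and> ((a, u) \<in> A \<and> (b, u) \<in> A \<longrightarrow> a = b))"

definition alike :: "('a \<times> 'a) set \<Rightarrow> 'a \<Rightarrow> 'a \<Rightarrow> 'a \<Rightarrow> bool" where
  "alike A v a b \<longleftrightarrow> ((v, a) \<in> A \<longleftrightarrow> (v, b) \<in> A) \<and> ((a, v) \<in> A \<longleftrightarrow> (b, v) \<in> A)"

text \<open>The exceptions in the definition are what rotating the colors around the cycle cannot refute.\<close>

definition violator :: "('a \<times> 'a) set \<Rightarrow> 'a list \<Rightarrow> bool" where
  "violator A xs \<longleftrightarrow> ucycle A xs \<and>
     (\<forall>u\<in>set xs. adj A (hd xs) u \<longrightarrow> u = hd (tl xs) \<or> u = last xs) \<and>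
     \<not> thin A (set xs) \<and> \<not> (odd (length xs) \<and> alike A (hd xs) (hd (tl xs)) (last xs))"

section \<open>Moving the hole of a partial coloring\<close>

text \<open>A hypothetical failure, to be refuted: the coloring \<open>\<psi>\<close> outside of
  \<open>S\<close> has no admissible extension. Indegree, outdegree and list size agree on
  \<open>S\<close>, so a repeated color next to the hole would leave another color free for
  it.\<close>

locale stuck_set =
  fixes A :: "('a \<times> 'a) set" and S :: "'a set" and L :: "'a \<Rightarrow> 'b set" and \<psi> :: "'a \<Rightarrow> 'b"
  assumes irr: "irrefl A"
    and fin: "\<And>x. x \<in> S \<Longrightarrow> finite (A `` {x})" "\<And>x. x \<in> S \<Longrightarrow> finite (A\<inverse> `` {x})"
      "\<And>x. x \<in> S \<Longrightarrow> finite (L x)"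
    and card: "\<And>x. x \<in> S \<Longrightarrow> card (A `` {x}) = card (L x)" "\<And>x. x \<in> S \<Longrightarrow> card (A\<inverse> `` {x}) = card (L x)"
    and stuck: "\<And>\<phi>. (\<And>x. x \<notin> S \<Longrightarrow> \<phi> x = \<psi> x) \<Longrightarrow> (\<And>x. x \<in> S \<Longrightarrow> \<phi> x \<in> L x) \<Longrightarrow>
       \<exists>p. bad_path A S S \<phi> p"
begin

text \<open>The vertex \<open>v\<close> is the hole of the partial coloring; the value of \<open>\<phi>\<close> there is irrelevant.\<close>

definition state :: "'a \<Rightarrow> ('a \<Rightarrow> 'b) \<Rightarrow> bool" where
  "state v \<phi> \<longleftrightarrow> v \<in> S \<and> (\<forall>x. x \<notin> S \<longrightarrow> \<phi> x = \<psi> x) \<and> (\<forall>x\<in>S - {v}. \<phi> x \<in> L x)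
     \<and> (\<forall>p. \<not> bad_path A S (S - {v}) \<phi> p)"

lemma state_no_extension:
  assumes st: "state v \<phi>" and c: "c \<in> L v"
  shows "c \<in> \<phi> ` (A `` {v})" "c \<in> \<phi> ` (A\<inverse> `` {v})"
proof -
  have v: "v \<in> S" and ins: "insert v (S - {v}) = S" using st by (auto simp: state_def)
  have no: "\<not> bad_path A S (S - {v}) \<phi> p" for p using st by (simp add: state_def)
  have "\<exists>p. bad_path A S S (\<phi>(v := c)) p"
    by (rule stuck) (use st c in \<open>auto simp: state_def\<close>)
  then obtain p where p: "bad_path A S (insert v (S - {v})) (\<phi>(v := c)) p" unfolding ins by blast
  show "c \<in> \<phi> ` (A `` {v})"
  proof (rule ccontr)
    assume "c \<notin> \<phi> ` (A `` {v})"
    then have "\<not> bad_path A S (insert v (S - {v})) (\<phi>(v := c)) p"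
      by (intro no_bad_path_insert_out[OF no] irr v) auto
    then show False using p by contradiction
  qed
  show "c \<in> \<phi> ` (A\<inverse> `` {v})"
  proof (rule ccontr)
    assume "c \<notin> \<phi> ` (A\<inverse> `` {v})"
    then have "\<not> bad_path A S (insert v (S - {v})) (\<phi>(v := c)) p"
      by (intro no_bad_path_insert_in[OF no] irr v) auto
    then show False using p by contradiction
  qed
qed

text \<open>Every color of the list occurs among the neighbors on either side of the hole, and
  either side has exactly as many neighbors as there are colors.\<close>

lemma state_bij:
  assumes st: "state v \<phi>" and R: "R = A \<or> R = A\<inverse>"
  shows "\<phi> ` (R `` {v}) = L v" "inj_on \<phi> (R `` {v})"
proof -
  have v: "v \<in> S" using st by (simp add: state_def)
  have finR: "finite (R `` {v})" and cardR: "card (R `` {v}) = card (L v)"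
    using fin card v R by auto
  have sub: "L v \<subseteq> \<phi> ` (R `` {v})" using state_no_extension[OF st] R by blast
  show eq: "\<phi> ` (R `` {v}) = L v"
    using card_seteq[OF finite_imageI[OF finR] sub] card_image_le[OF finR, of \<phi>] cardR by simp
  show "inj_on \<phi> (R `` {v})"
    using eq cardR finR by (intro eq_card_imp_inj_on) auto
qed

text \<open>Among the neighbors of \<open>v\<close> on its side, \<open>u\<close> alone has the
  color \<open>\<phi> u\<close>. Once \<open>u\<close> is uncolored, this color is missing on that
  side and is safe for \<open>v\<close>.\<close>

lemma state_shift:
  assumes st: "state v \<phi>" and u: "u \<in> S" "adj A v u"
  shows "state u (\<phi>(v := \<phi> u))"
proof -
  have v: "v \<in> S" using st by (simp add: state_def)
  have "u \<noteq> v" using u irr by (auto simp: adj_iff irrefl_def)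
  let ?U = "S - {u, v}"
  have ins: "insert v ?U = S - {u}" using v \<open>u \<noteq> v\<close> by auto
  have no: "\<not> bad_path A S ?U \<phi> p" for p
    using st bad_path_subset[of A S ?U \<phi> p "S - {v}"] by (auto simp: state_def)
  obtain R where R: "R = A \<or> R = A\<inverse>" "u \<in> R `` {v}" using u(2) by (auto simp: adj_iff)
  have "\<phi> u \<in> L v" using state_bij(1)[OF st R(1)] R(2) by blast
  moreover have "\<not> bad_path A S (insert v ?U) (\<phi>(v := \<phi> u)) p" for p
  proof -
    have neq: "\<phi> y \<noteq> \<phi> u" if "y \<in> R `` {v}" "y \<in> ?U \<or> y \<notin> S" for y
      using inj_onD[OF state_bij(2)[OF st R(1)], of y u] that R(2) u(1) by blast
    show ?thesis
      using R(1)
    proof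
      assume "R = A"
      then show ?thesis using neq by (intro no_bad_path_insert_out[OF no] irr v) auto
    next
      assume "R = A\<inverse>"
      then show ?thesis using neq by (intro no_bad_path_insert_in[OF no] irr v) auto
    qed
  qed
  ultimately show ?thesis
    using st u(1) v \<open>u \<noteq> v\<close> unfolding state_def ins by auto
qed

lemma state_move:
  assumes "state v \<phi>" "successively (adj A) (v # ps)" "distinct (v # ps)" "set ps \<subseteq> S"
  shows "\<exists>\<phi>'. state (last (v # ps)) \<phi>' \<and> (\<forall>x. x \<notin> set (v # ps) \<longrightarrow> \<phi>' x = \<phi> x)
     \<and> map \<phi>' (butlast (v # ps)) = map \<phi> ps"
  using assms
proof (induction ps arbitrary: v \<phi>)
  case Nil
  then show ?case by auto
next
  case (Cons p ps)
  let ?\<phi> = "\<phi>(v := \<phi> p)"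
  have "state p ?\<phi>" using Cons.prems by (intro state_shift) auto
  then obtain \<phi>' where \<phi>': "state (last (p # ps)) \<phi>'" "\<forall>x. x \<notin> set (p # ps) \<longrightarrow> \<phi>' x = ?\<phi> x"
    "map \<phi>' (butlast (p # ps)) = map ?\<phi> ps"
    using Cons.IH[of p ?\<phi>] Cons.prems(2-4) unfolding successively.simps distinct.simps list.set by blast
  have "\<phi>' v = \<phi> p" using \<phi>'(2) Cons.prems(3) by auto
  moreover have "map ?\<phi> ps = map \<phi> ps" using Cons.prems(3) by auto
  ultimately show ?case using \<phi>' by (intro exI[of _ \<phi>']) auto
qed

text \<open>The hole runs through the cycle to its last vertex and returns to \<open>v\<close> over
  the closing edge. Every color moves back by one place, and the first one passes over
  \<open>v\<close> to the end.\<close>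

lemma state_rotate1:
  assumes st: "state v \<phi>" and ps: "successively (adj A) (v # ps)" "distinct (v # ps)" "set ps \<subseteq> S"
    "ps \<noteq> []" "adj A (last ps) v"
  shows "\<exists>\<phi>'. state v \<phi>' \<and> (\<forall>x. x \<notin> set (v # ps) \<longrightarrow> \<phi>' x = \<phi> x) \<and> map \<phi>' ps = rotate1 (map \<phi> ps)"
proof -
  obtain \<phi>' where \<phi>': "state (last (v # ps)) \<phi>'" "\<forall>x. x \<notin> set (v # ps) \<longrightarrow> \<phi>' x = \<phi> x"
    "map \<phi>' (butlast (v # ps)) = map \<phi> ps" using state_move[OF st ps(1-3)] by blast
  let ?l = "last ps" and ?\<phi> = "\<phi>'(last ps := \<phi>' v)"
  have v: "v \<in> S" using st by (simp add: state_def)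
  have "state v ?\<phi>" using \<phi>'(1) v ps by (intro state_shift) auto
  moreover have "\<forall>x. x \<notin> set (v # ps) \<longrightarrow> ?\<phi> x = \<phi> x" using \<phi>'(2) ps(4) by auto
  moreover have "map ?\<phi> ps = rotate1 (map \<phi> ps)"
  proof -
    obtain bs where bs: "ps = bs @ [?l]" using ps(4) by (metis append_butlast_last_id)
    have hd: "\<phi>' v # map \<phi>' bs = map \<phi> ps" using \<phi>'(3) by (subst (asm) bs) (simp add: butlast_append)
    have "?l \<notin> set bs" using ps(2) by (subst (asm) bs) auto
    then have "map ?\<phi> ps = map \<phi>' bs @ [\<phi>' v]" by (subst bs) auto
    then show ?thesis unfolding hd[symmetric] by simp
  qed
  ultimately show ?thesis by blast
qed

lemma state_rotate:
  assumes st: "state v \<phi>" and ps: "successively (adj A) (v # ps)" "distinct (v # ps)" "set ps \<subseteq> S"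
    "ps \<noteq> []" "adj A (last ps) v"
  shows "\<exists>\<phi>'. state v \<phi>' \<and> (\<forall>x. x \<notin> set (v # ps) \<longrightarrow> \<phi>' x = \<phi> x) \<and> map \<phi>' ps = rotate j (map \<phi> ps)"
proof (induction j)
  case 0
  then show ?case using st by auto
next
  case (Suc j)
  then obtain \<phi>' where \<phi>': "state v \<phi>'" "\<forall>x. x \<notin> set (v # ps) \<longrightarrow> \<phi>' x = \<phi> x"
    "map \<phi>' ps = rotate j (map \<phi> ps)" by blast
  then show ?case using state_rotate1[OF \<phi>'(1) ps] by auto
qed

text \<open>The neighbors inside \<open>S\<close> carry those colors of \<open>L v\<close> that the
  neighbors outside leave over, and the coloring outside is fixed.\<close>

lemma state_same_colors:
  assumes "state v \<phi>" "state v \<phi>'" "R = A \<or> R = A\<inverse>" "\<And>x. x \<notin> S \<Longrightarrow> \<phi>' x = \<phi> x"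
  shows "\<phi>' ` (R `` {v} \<inter> S) = \<phi> ` (R `` {v} \<inter> S)"
proof -
  have eq: "\<theta> ` (R `` {v} \<inter> S) = L v - \<theta> ` (R `` {v} - S)" if "state v \<theta>" for \<theta>
  proof -
    have "\<theta> ` (R `` {v} - (R `` {v} - S)) = \<theta> ` (R `` {v}) - \<theta> ` (R `` {v} - S)"
      by (rule inj_on_image_set_diff[OF state_bij(2)[OF that assms(3)]]) auto
    then show ?thesis using state_bij(1)[OF that assms(3)] by (simp add: Diff_Diff_Int)
  qed
  have "\<phi>' ` (R `` {v} - S) = \<phi> ` (R `` {v} - S)" using assms(4) by auto
  then show ?thesis using eq[OF assms(1)] eq[OF assms(2)] by simp
qed

text \<open>If all colors on the cycle are equal, they remain so wherever the hole is moved. As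
  colors do not repeat on a side of the hole, at most one neighbor on each side lies in
  \<open>S\<close>.\<close>

lemma mono_imp_thin:
  assumes st: "state v \<phi>" and xs: "successively (adj A) (v # ps)" "set (v # ps) = S"
    and mono: "\<And>x. x \<in> set ps \<Longrightarrow> \<phi> x = c"
  shows "thin A S"
proof -
  let ?xs = "v # ps"
  have "i < length ?xs \<Longrightarrow> \<exists>\<phi>. state (?xs ! i) \<phi> \<and> (\<forall>x\<in>S - {?xs ! i}. \<phi> x = c)" for i
  proof (induction i)
    case 0
    then show ?case using st mono xs(2) by auto
  next
    case (Suc i)
    then obtain \<theta> where \<theta>: "state (?xs ! i) \<theta>" "\<forall>x\<in>S - {?xs ! i}. \<theta> x = c" by auto
    have a: "adj A (?xs ! i) (?xs ! Suc i)" using successively_nth[OF xs(1)] Suc.prems by blast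
    have S: "?xs ! Suc i \<in> S" using Suc.prems xs(2) nth_mem by blast
    have "?xs ! Suc i \<noteq> ?xs ! i" using a irr by (metis adj_iff irreflD)
    then have "\<theta> (?xs ! Suc i) = c" using \<theta>(2) S by blast
    moreover have "state (?xs ! Suc i) (\<theta>(?xs ! i := \<theta> (?xs ! Suc i)))" by (rule state_shift[OF \<theta>(1) S a])
    moreover have "\<forall>x\<in>S - {?xs ! Suc i}. (\<theta>(?xs ! i := c)) x = c" using \<theta>(2) by simp
    ultimately show ?case by metis
  qed
  then have ex: "\<exists>\<phi>. state u \<phi> \<and> (\<forall>x\<in>S - {u}. \<phi> x = c)" if "u \<in> S" for u
    using that xs(2) by (metis in_set_conv_nth)
  have "a = b" if u: "u \<in> S" and R: "R = A \<or> R = A\<inverse>" and ab: "a \<in> S" "b \<in> S" "(u, a) \<in> R" "(u, b) \<in> R" for u R a b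
  proof -
    obtain \<theta> where \<theta>: "state u \<theta>" "\<forall>x\<in>S - {u}. \<theta> x = c" using ex[OF u] by blast
    have "a \<noteq> u" "b \<noteq> u" using ab R irr by (auto simp: irrefl_def)
    then have "\<theta> a = \<theta> b" using \<theta>(2) ab by auto
    then show ?thesis using inj_onD[OF state_bij(2)[OF \<theta>(1) R], of a b] ab by blast
  qed
  from this[of _ A] this[of _ "A\<inverse>"] show ?thesis unfolding thin_def by blast
qed

text \<open>Greedy coloring along the path. Each vertex has an uncolored neighbor in
  \<open>S\<close>, its successor or finally \<open>v\<close>, so on the side of this neighbor fewer
  colors are used than the list offers.\<close>

lemma stuck_initial_state:
  assumes xs: "successively (adj A) (v # ps)" "distinct (v # ps)" "set (v # ps) = S" "ps \<noteq> []" "adj A (last ps) v"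
  shows "\<exists>\<phi>. state v \<phi>"
proof -
  have "t \<le> length ps \<Longrightarrow> \<exists>\<phi>. (\<forall>x. x \<notin> S \<longrightarrow> \<phi> x = \<psi> x) \<and> (\<forall>x\<in>set (take t ps). \<phi> x \<in> L x) \<and>
      (\<forall>p. \<not> bad_path A S (set (take t ps)) \<phi> p)" for t
  proof (induction t)
    case 0
    then show ?case by (intro exI[of _ \<psi>]) (auto simp: bad_path_def)
  next
    case (Suc t)
    let ?U = "set (take t ps)" and ?x = "ps ! t"
    obtain \<phi> where \<phi>: "\<forall>x. x \<notin> S \<longrightarrow> \<phi> x = \<psi> x" "\<forall>x\<in>?U. \<phi> x \<in> L x" "\<And>p. \<not> bad_path A S ?U \<phi> p"
      using Suc by auto
    have t: "t < length ps" using Suc.prems by simp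
    have tk: "take (Suc t) ps = take t ps @ [?x]" using t by (simp add: take_Suc_conv_app_nth)
    have x: "?x \<in> S" "?x \<notin> ?U"
    proof -
      show "?x \<in> S" using t xs(3) by auto
      have "distinct (take (Suc t) ps)" using xs(2) by simp
      then show "?x \<notin> ?U" unfolding tk by auto
    qed
    obtain y where y: "y \<in> S" "y \<notin> ?U" "adj A ?x y" "y \<noteq> ?x"
    proof (cases "Suc t < length ps")
      case True
      have "adj A ?x (ps ! Suc t)" using xs(1) True successively_nth[of "adj A" ps t] by (auto simp: successively_Cons)
      moreover have "ps ! Suc t \<notin> ?U" "ps ! Suc t \<noteq> ?x"
        using xs(2) True by (auto simp: in_set_conv_nth nth_eq_iff_index_eq)
      ultimately show ?thesis using that[of "ps ! Suc t"] xs(3) nth_mem[OF True] by auto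
    next
      case False
      then have "?x = last ps" using t by (metis Suc_lessI diff_Suc_1 last_conv_nth xs(4))
      moreover have "v \<notin> set (take t ps)" "v \<noteq> last ps" using xs(2,4) by (auto dest: in_set_takeD)
      ultimately show ?thesis using that[of v] xs(3,5) by auto
    qed
    obtain R where R: "R = A \<or> R = A\<inverse>" "y \<in> R `` {?x}" using y(3) by (auto simp: adj_iff)
    have finR: "finite (R `` {?x})" "card (R `` {?x}) = card (L ?x)"
      using R(1) fin[OF x(1)] card[OF x(1)] by auto
    have "card (\<phi> ` (R `` {?x} - {y})) \<le> card (R `` {?x} - {y})" using finR(1) by (intro card_image_le) auto
    also have "\<dots> < card (L ?x)" using finR R(2) by (metis card_Diff1_less)
    finally obtain c where c: "c \<in> L ?x" "c \<notin> \<phi> ` (R `` {?x} - {y})"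
      using finR(1) by (metis card_mono finite_Diff finite_imageI linorder_not_less subsetI)
    have free: "\<phi> z \<noteq> c" if "z \<in> R `` {?x}" "z \<in> ?U \<or> z \<notin> S" for z
      using that c(2) y(1,2) by blast
    have US: "?U \<subseteq> S" using xs(3) set_take_subset[of t ps] by auto
    have "\<not> bad_path A S (insert ?x ?U) (\<phi>(?x := c)) p" for p
      using R(1)
    proof
      assume "R = A"
      then show ?thesis using free by (intro no_bad_path_insert_out[OF \<phi>(3) US] irr x) auto
    next
      assume "R = A\<inverse>"
      then show ?thesis using free by (intro no_bad_path_insert_in[OF \<phi>(3) US] irr x) auto
    qed
    moreover have "set (take (Suc t) ps) = insert ?x ?U" unfolding tk by simp
    moreover have "\<forall>x. x \<notin> S \<longrightarrow> (\<phi>(?x := c)) x = \<psi> x" "\<forall>x\<in>insert ?x ?U. (\<phi>(?x := c)) x \<in> L x"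
      using \<phi>(1,2) x c(1) by auto
    ultimately show ?case by metis
  qed
  from this[of "length ps"] obtain \<phi> where "\<forall>x. x \<notin> S \<longrightarrow> \<phi> x = \<psi> x" "\<forall>x\<in>set ps. \<phi> x \<in> L x"
    "\<forall>p. \<not> bad_path A S (set ps) \<phi> p" by auto
  moreover have "S - {v} = set ps" using xs(2,3) by auto
  ultimately show ?thesis unfolding state_def using xs(3) by (intro exI[of _ \<phi>]) auto
qed

text \<open>Moving the hole once around the cycle rotates the colors. The colors next to \<open>v\<close> are determined
  by \<open>L v\<close> and the colors outside of the cycle, hence the rotated sequence has the same ends.\<close>

lemma not_violator:
  assumes "set xs = S" shows "\<not> violator A xs"
proof
  assume viol: "violator A xs"
  obtain v ps where xs: "xs = v # ps" using viol by (cases xs) (auto simp: violator_def ucycle_def)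
  let ?n = "length ps"
  have n: "2 \<le> ?n" using viol xs by (simp add: violator_def ucycle_def)
  then have "ps \<noteq> []" by auto
  have ps: "successively (adj A) (v # ps)" "distinct (v # ps)" "set ps \<subseteq> S" "ps \<noteq> []" "adj A (last ps) v"
    and S: "set (v # ps) = S"
    using viol xs \<open>ps \<noteq> []\<close> assms by (auto simp: violator_def ucycle_def)
  have nthin: "\<not> thin A S" and not_alike: "\<not> (odd (Suc ?n) \<and> alike A v (hd ps) (last ps))"
    using viol xs assms \<open>ps \<noteq> []\<close> by (auto simp: violator_def)
  have chordless: "u = hd ps \<or> u = last ps" if "u \<in> S" "adj A v u" for u
    using viol that xs assms \<open>ps \<noteq> []\<close> by (auto simp: violator_def)
  have hl: "hd ps \<noteq> last ps"
  proof -
    have "ps ! 0 \<noteq> ps ! (?n - 1)" using n ps(2) by (subst nth_eq_iff_index_eq) auto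
    then show ?thesis using \<open>ps \<noteq> []\<close> by (simp add: hd_conv_nth last_conv_nth)
  qed
  obtain \<phi> where st: "state v \<phi>" using stuck_initial_state[OF ps(1,2) S ps(4,5)] by blast
  let ?cs = "map \<phi> ps"
  have hdin: "hd ps \<in> S" "last ps \<in> S" using \<open>ps \<noteq> []\<close> S by auto
  \<comment> \<open>The two ends of \<open>ps\<close> are the only neighbors of \<open>v\<close> on
    the cycle, so the colors there form the same set after any number of rotations.\<close>
  have ends: "{\<theta> |\<theta>. (\<theta> = hd (rotate j ?cs) \<and> (v, hd ps) \<in> R) \<or> (\<theta> = last (rotate j ?cs) \<and> (v, last ps) \<in> R)}
      = \<phi> ` (R `` {v} \<inter> S)" if R: "R = A \<or> R = A\<inverse>" for j R
  proof -
    obtain \<phi>' where \<phi>': "state v \<phi>'" "\<forall>x. x \<notin> set (v # ps) \<longrightarrow> \<phi>' x = \<phi> x" "map \<phi>' ps = rotate j ?cs"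
      using state_rotate[OF st ps] by blast
    have "\<phi>' ` (R `` {v} \<inter> S) = \<phi> ` (R `` {v} \<inter> S)"
      using state_same_colors[OF st \<phi>'(1) R] \<phi>'(2) S by auto
    moreover have "R `` {v} \<inter> S = {u. u = hd ps \<and> (v, hd ps) \<in> R \<or> u = last ps \<and> (v, last ps) \<in> R}"
      using chordless hdin R by (auto simp: adj_iff)
    moreover have "hd (rotate j ?cs) = \<phi>' (hd ps)" "last (rotate j ?cs) = \<phi>' (last ps)"
      unfolding \<phi>'(3)[symmetric] using \<open>ps \<noteq> []\<close> by (simp_all add: hd_map last_map)
    ultimately show ?thesis by auto
  qed
  have hd_rot: "hd (rotate i ?cs) = ?cs ! i" if "i < ?n" for i
    using that by (subst hd_rotate_conv_nth) auto
  have last_rot: "last (rotate (Suc i) ?cs) = ?cs ! i" if "i < ?n" for i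
  proof -
    have "last (rotate (Suc i) ?cs) = rotate (Suc i) ?cs ! (?n - 1)"
      using \<open>ps \<noteq> []\<close> by (subst last_conv_nth) auto
    also have "\<dots> = ?cs ! ((Suc i + (?n - 1)) mod ?n)" using n by (subst nth_rotate) auto
    also have "Suc i + (?n - 1) = i + ?n" using n by simp
    finally show ?thesis using that by simp
  qed
  \<comment> \<open>Only one end counts on this side, so its color is the same after every rotation.
    Each color of the cycle gets there, hence all are equal.\<close>
  have single: "thin A S" if R: "R = A \<or> R = A\<inverse>" and one: "((v, hd ps) \<in> R) \<noteq> ((v, last ps) \<in> R)" for R
  proof -
    obtain c where c: "?cs ! i = c" if "i < ?n" for i
    proof (cases "(v, hd ps) \<in> R")
      case True
      then have "\<phi> ` (R `` {v} \<inter> S) = {hd (rotate j ?cs)}" for j using ends[OF R, of j] one by auto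
      then have "?cs ! i = ?cs ! 0" if "i < ?n" for i
        using hd_rot[OF that] hd_rot[of 0] n by (metis le_zero_eq linorder_not_less not_numeral_le_zero singleton_inject)
      then show ?thesis using that by blast
    next
      case False
      then have "\<phi> ` (R `` {v} \<inter> S) = {last (rotate j ?cs)}" for j using ends[OF R, of j] one by auto
      then have "?cs ! i = ?cs ! 0" if "i < ?n" for i
        using last_rot[OF that] last_rot[of 0] n by (metis le_zero_eq linorder_not_less not_numeral_le_zero singleton_inject)
      then show ?thesis using that by blast
    qed
    have "\<phi> x = c" if "x \<in> set ps" for x
      using that c by (metis in_set_conv_nth nth_map)
    then show ?thesis by (intro mono_imp_thin[OF st ps(1) S])
  qed
  \<comment> \<open>After \<open>Suc i\<close> rotations the ends show the consecutive colors
    \<open>Suc i\<close> and \<open>i\<close>. They always form the same pair of distinct colors, so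
    the colors alternate, and as the two ends differ, their number is even.\<close>
  have double: "even ?n" if R: "R = A \<or> R = A\<inverse>" and both: "(v, hd ps) \<in> R" "(v, last ps) \<in> R" for R
  proof -
    have ab: "{hd (rotate j ?cs), last (rotate j ?cs)} = \<phi> ` (R `` {v} \<inter> S)" for j
      using ends[OF R, of j] both by auto
    define a b where "a = hd ?cs" and "b = last ?cs"
    have "\<phi> (hd ps) \<noteq> \<phi> (last ps)"
      using inj_onD[OF state_bij(2)[OF st R], of "hd ps" "last ps"] both hl by auto
    then have "a \<noteq> b" using \<open>ps \<noteq> []\<close> by (simp add: a_def b_def hd_map last_map)
    have ab': "{hd (rotate j ?cs), last (rotate j ?cs)} = {a, b}" for j
      using ab[of j] ab[of 0] by (simp add: a_def b_def)
    have alt: "?cs ! i = (if even i then a else b)" if "i < ?n" for i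
      using that
    proof (induction i)
      case 0
      then show ?case using \<open>ps \<noteq> []\<close> by (simp add: a_def hd_conv_nth)
    next
      case (Suc i)
      have "{?cs ! Suc i, ?cs ! i} = {a, b}"
        using ab'[of "Suc i"] hd_rot[of "Suc i"] last_rot[of i] Suc.prems by simp
      then show ?case using Suc \<open>a \<noteq> b\<close> by (auto simp: doubleton_eq_iff)
    qed
    have "b = ?cs ! (?n - 1)" using \<open>ps \<noteq> []\<close> by (simp add: b_def last_conv_nth)
    then have "odd (?n - 1)" using alt[of "?n - 1"] \<open>a \<noteq> b\<close> n by (auto split: if_splits)
    then show ?thesis using n by auto
  qed
  have "alike A v (hd ps) (last ps)"
    using single[of A] single[of "A\<inverse>"] nthin by (auto simp: alike_def)
  moreover have "adj A v (hd ps)" using ps(1) \<open>ps \<noteq> []\<close> by (auto simp: successively_Cons)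
  then have "even ?n" using double[of A] double[of "A\<inverse>"] \<open>alike A v (hd ps) (last ps)\<close>
    by (auto simp: alike_def adj_iff)
  ultimately show False using not_alike by simp
qed

end

theorem violator_extension:
  assumes "irrefl A" "violator A xs"
    and "\<And>x. x \<in> set xs \<Longrightarrow> finite (A `` {x}) \<and> finite (A\<inverse> `` {x}) \<and> finite (L x)"
    and "\<And>x. x \<in> set xs \<Longrightarrow> card (A `` {x}) = card (L x) \<and> card (A\<inverse> `` {x}) = card (L x)"
  obtains \<phi> where "\<And>x. x \<notin> set xs \<Longrightarrow> \<phi> x = \<psi> x" "\<And>x. x \<in> set xs \<Longrightarrow> \<phi> x \<in> L x"
    "\<And>p. \<not> bad_path A (set xs) (set xs) \<phi> p"
proof (rule ccontr)
  assume "\<not> thesis"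
  then interpret stuck_set A "set xs" L \<psi>
    using assms that by unfold_locales blast+
  show False using not_violator[OF refl] assms(2) by blast
qed


section \<open>Graphs without violating cycles\<close>

lemma rtrancl_walk:
  assumes "(a, b) \<in> (Restr (underlying A) U)\<^sup>*" "a \<in> U"
  shows "\<exists>ws. ws \<noteq> [] \<and> hd ws = a \<and> last ws = b \<and> set ws \<subseteq> U \<and> successively (adj A) ws"
  using assms(1)
proof induction
  case base
  then show ?case using assms(2) by (intro exI[of _ "[a]"]) auto
next
  case (step y z)
  then obtain ws where "ws \<noteq> []" "hd ws = a" "last ws = y" "set ws \<subseteq> U" "successively (adj A) ws" by blast
  with step(2) show ?case by (intro exI[of _ "ws @ [z]"]) (auto simp: successively_append_iff)
qed

lemma successively_take: "successively P xs \<Longrightarrow> successively P (take n xs)"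
  by (metis append_take_drop_id successively_append_iff)

lemma successively_drop: "successively P xs \<Longrightarrow> successively P (drop n xs)"
  by (metis append_take_drop_id successively_append_iff)

definition geodesic :: "('a \<times> 'a) set \<Rightarrow> 'a set \<Rightarrow> 'a set \<Rightarrow> 'a set \<Rightarrow> 'a list \<Rightarrow> bool" where
  "geodesic A I J U ws \<longleftrightarrow> ws \<noteq> [] \<and> hd ws \<in> I \<and> last ws \<in> J \<and> set ws \<subseteq> U \<and> distinct ws
     \<and> (\<forall>i j. i < j \<longrightarrow> j < length ws \<longrightarrow> (adj A (ws ! i) (ws ! j) \<longleftrightarrow> j = Suc i))
     \<and> (\<forall>i. 0 < i \<longrightarrow> i < length ws \<longrightarrow> ws ! i \<notin> I) \<and> (\<forall>i. Suc i < length ws \<longrightarrow> ws ! i \<notin> J)"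

lemma geodesicD:
  assumes "geodesic A I J U ws"
  shows "ws \<noteq> []" "hd ws \<in> I" "last ws \<in> J" "set ws \<subseteq> U" "distinct ws"
    "\<And>i j. i < j \<Longrightarrow> j < length ws \<Longrightarrow> adj A (ws ! i) (ws ! j) \<longleftrightarrow> j = Suc i"
    "\<And>i. 0 < i \<Longrightarrow> i < length ws \<Longrightarrow> ws ! i \<notin> I"
    "\<And>i. Suc i < length ws \<Longrightarrow> ws ! i \<notin> J"
  using assms by (simp_all add: geodesic_def)

text \<open>A shortest walk from \<open>I\<close> to \<open>J\<close> will do: a chord, a repeated
  vertex or an early visit to \<open>I\<close> or \<open>J\<close> would permit a shorter
  one.\<close>

lemma geodesic_exists:
  assumes "ws0 \<noteq> []" "hd ws0 \<in> I" "last ws0 \<in> J" "set ws0 \<subseteq> U" "successively (adj A) ws0"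
  obtains ws where "geodesic A I J U ws"
proof -
  let ?P = "\<lambda>ws. ws \<noteq> [] \<and> hd ws \<in> I \<and> last ws \<in> J \<and> set ws \<subseteq> U \<and> successively (adj A) ws"
  obtain ws where ws: "?P ws" and least: "\<And>w. ?P w \<Longrightarrow> length ws \<le> length w"
    using ex_has_least_nat[of ?P ws0 length] assms by blast
  have I: "ws ! i \<notin> I" if "0 < i" "i < length ws" for i
  proof
    assume "ws ! i \<in> I"
    then have "?P (drop i ws)" using ws that
      by (auto simp: hd_drop_conv_nth successively_drop dest: in_set_dropD)
    then show False using least[of "drop i ws"] that by simp
  qed
  have J: "ws ! i \<notin> J" if "Suc i < length ws" for i
  proof
    assume "ws ! i \<in> J"
    then have "?P (take (Suc i) ws)" using ws that
      by (auto simp: last_conv_nth successively_take min_def dest: in_set_takeD)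
    then show False using least[of "take (Suc i) ws"] that by auto
  qed
  have short: "\<not> adj A (ws ! i) (ws ! j)" if "Suc i < j" "j < length ws" for i j
  proof
    assume a: "adj A (ws ! i) (ws ! j)"
    let ?w = "take (Suc i) ws @ drop j ws"
    have "last (take (Suc i) ws) = ws ! i" using that by (simp add: take_Suc_conv_app_nth)
    moreover have "hd (drop j ws) = ws ! j" using that by (simp add: hd_drop_conv_nth)
    ultimately have "successively (adj A) ?w"
      using ws that a by (auto simp: successively_append_iff successively_take successively_drop)
    moreover have "hd ?w \<in> I" using ws that by (cases ws) auto
    moreover have "last ?w \<in> J" "set ?w \<subseteq> U" using ws that by (auto dest: in_set_takeD in_set_dropD)
    ultimately have "?P ?w" using that by auto
    then show False using least[of ?w] that by auto
  qed
  have step: "adj A (ws ! i) (ws ! Suc i)" if "Suc i < length ws" for i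
    using ws that successively_nth by blast
  have "ws ! i \<noteq> ws ! j" if "i < j" "j < length ws" for i j
  proof (cases "Suc j < length ws")
    case True
    then show ?thesis using step[OF True] short[of i "Suc j"] that by auto
  next
    case False
    then have "ws ! j = last ws" using that by (metis Suc_lessI diff_Suc_1 last_conv_nth list.size(3) not_less_zero)
    then show ?thesis using J[of i] ws that by auto
  qed
  then have "distinct ws" by (metis distinct_conv_nth nat_neq_iff)
  have path: "adj A (ws ! i) (ws ! j) \<longleftrightarrow> j = Suc i" if "i < j" "j < length ws" for i j
    using short[of i j] step[of i] that by (cases "j = Suc i") auto
  show thesis
    by (rule that[of ws]) (use ws I J path \<open>distinct ws\<close> in \<open>simp add: geodesic_def\<close>)
qed

text \<open>A chordless cycle. Restricting to positions \<open>a < b\<close> avoids arithmetic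
  modulo the length.\<close>

definition icycle :: "('a \<times> 'a) set \<Rightarrow> 'a list \<Rightarrow> bool" where
  "icycle A xs \<longleftrightarrow> 3 \<le> length xs \<and> distinct xs \<and> (\<forall>a b. a < b \<longrightarrow> b < length xs \<longrightarrow>
     (adj A (xs ! a) (xs ! b) \<longleftrightarrow> b = Suc a \<or> (a = 0 \<and> b = length xs - 1)))"

lemma icycle_adj:
  assumes "icycle A xs" "a < b" "b < length xs"
  shows "adj A (xs ! a) (xs ! b) \<longleftrightarrow> b = Suc a \<or> (a = 0 \<and> b = length xs - 1)"
    "adj A (xs ! b) (xs ! a) \<longleftrightarrow> b = Suc a \<or> (a = 0 \<and> b = length xs - 1)"
  using assms by (auto simp: icycle_def adj_sym[of "xs ! b"])

lemma icycle_ucycle: assumes "icycle A xs" shows "ucycle A xs"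
proof -
  have n: "3 \<le> length xs" using assms by (simp add: icycle_def)
  have "successively (adj A) xs" using icycle_adj(1)[OF assms] by (auto simp: successively_conv_nth)
  moreover have "adj A (last xs) (hd xs)"
    using icycle_adj(2)[OF assms, of 0 "length xs - 1"] n by (cases xs) (auto simp: last_conv_nth)
  ultimately show ?thesis using assms by (simp add: icycle_def ucycle_def)
qed

lemma icycle_rotate1: assumes "icycle A xs" shows "icycle A (rotate1 xs)"
  unfolding icycle_def
proof (intro conjI allI impI)
  let ?n = "length xs"
  fix a b assume ab: "a < b" "b < length (rotate1 xs)"
  then have b: "b < ?n" by simp
  have n: "3 \<le> ?n" using assms by (simp add: icycle_def)
  have nth: "rotate1 xs ! i = xs ! (Suc i mod ?n)" if "i < ?n" for i
    using that by (rule nth_rotate1)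
  have a': "rotate1 xs ! a = xs ! Suc a" using nth[of a] ab b by simp
  show "adj A (rotate1 xs ! a) (rotate1 xs ! b) \<longleftrightarrow> b = Suc a \<or> a = 0 \<and> b = length (rotate1 xs) - 1"
  proof (cases "Suc b < ?n")
    case True
    then have "rotate1 xs ! b = xs ! Suc b" using nth[of b] by simp
    then show ?thesis using icycle_adj(1)[OF assms, of "Suc a" "Suc b"] ab True a' by auto
  next
    case False
    then have "Suc b = ?n" using b by simp
    then have "rotate1 xs ! b = xs ! 0" using nth[of b] by simp
    then show ?thesis using icycle_adj(2)[OF assms, of 0 "Suc a"] ab \<open>Suc b = ?n\<close> a' by auto
  qed
qed (use assms in \<open>auto simp: icycle_def\<close>)

lemma icycle_rotate: "icycle A xs \<Longrightarrow> icycle A (rotate i xs)"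
  by (induction i) (auto intro: icycle_rotate1)

lemma icycle_rev: assumes "icycle A xs" shows "icycle A (rev xs)"
  unfolding icycle_def
proof (intro conjI allI impI)
  let ?n = "length xs"
  fix a b assume ab: "a < b" "b < length (rev xs)"
  then show "adj A (rev xs ! a) (rev xs ! b) \<longleftrightarrow> b = Suc a \<or> a = 0 \<and> b = length (rev xs) - 1"
    using icycle_adj(2)[OF assms, of "?n - Suc b" "?n - Suc a"] by (auto simp: rev_nth)
qed (use assms in \<open>auto simp: icycle_def\<close>)

lemma icycle_mod_adj:
  assumes "icycle A xs" "a < length xs"
  shows "adj A (xs ! a) (xs ! (Suc a mod length xs))"
proof (cases "Suc a < length xs")
  case True
  then show ?thesis using icycle_adj(1)[OF assms(1), of a "Suc a"] by simp
next
  case False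
  then have "Suc a = length xs" using assms(2) by simp
  then show ?thesis using icycle_adj(2)[OF assms(1), of 0 a] assms by (auto simp: icycle_def)
qed

lemma icycle_adj_mod:
  assumes "icycle A xs" "a < length xs" "b < length xs" "a \<noteq> b" "adj A (xs ! a) (xs ! b)"
  shows "b = Suc a mod length xs \<or> a = Suc b mod length xs"
proof -
  let ?n = "length xs"
  have *: "j = Suc i mod ?n \<or> i = Suc j mod ?n" if "i < j" "j < ?n" "adj A (xs ! i) (xs ! j)" for i j
  proof -
    have "Suc (?n - 1) = ?n" using that by simp
    then show ?thesis using icycle_adj(1)[OF assms(1) that(1,2)] that by auto
  qed
  show ?thesis using *[of a b] *[of b a] assms by (metis adj_sym nat_neq_iff)
qed

lemma thin_out: "thin A S \<Longrightarrow> u \<in> S \<Longrightarrow> a \<in> S \<Longrightarrow> b \<in> S \<Longrightarrow> (u, a) \<in> A \<Longrightarrow> (u, b) \<in> A \<Longrightarrow> a = b"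
  and thin_in: "thin A S \<Longrightarrow> u \<in> S \<Longrightarrow> a \<in> S \<Longrightarrow> b \<in> S \<Longrightarrow> (a, u) \<in> A \<Longrightarrow> (b, u) \<in> A \<Longrightarrow> a = b"
  unfolding thin_def by blast+

lemma thin_not_alike:
  assumes "thin A S" "v \<in> S" "a \<in> S" "b \<in> S" "a \<noteq> b" "adj A v a" shows "\<not> alike A v a b"
  using thin_out[OF assms(1-4)] thin_in[OF assms(1-4)] assms(5,6) unfolding adj_iff alike_def by blast

lemma thin_three:
  assumes "thin A S" "v \<in> S" "{a, b, c} \<subseteq> S" "distinct [a, b, c]" "adj A v a" "adj A v b" "adj A v c"
  shows False
  using thin_out[OF assms(1,2), of a b] thin_out[OF assms(1,2), of a c] thin_out[OF assms(1,2), of b c]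
    thin_in[OF assms(1,2), of a b] thin_in[OF assms(1,2), of a c] thin_in[OF assms(1,2), of b c] assms(3-)
  unfolding adj_iff by auto

lemma thin_digon:
  assumes "thin A S" "v \<in> S" "{a, b} \<subseteq> S" "a \<noteq> b" "(v, a) \<in> A" "(a, v) \<in> A" "adj A v b"
  shows False
  using thin_out[OF assms(1,2), of a b] thin_in[OF assms(1,2), of a b] assms(3-)
  unfolding adj_iff by auto

text \<open>The direction of one arc propagates around the cycle, since a vertex that has received
  an arc from its predecessor cannot receive another one from its successor. If the first edge
  points backward, the cycle is reversed.\<close>

lemma icycle_thin_dicycle:
  assumes ic: "icycle A xs" and thin: "thin A (set xs)"
  shows "induces_dicycle A (set xs)"
proof -
  have *: "induces_dicycle A (set xs)"
    if ic: "icycle A xs" and thin: "thin A (set xs)" and fst: "(xs ! 0, xs ! 1) \<in> A" for xs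
  proof -
    let ?n = "length xs"
    have n: "3 \<le> ?n" and dist: "distinct xs" using ic by (auto simp: icycle_def)
    have fwd: "a < ?n \<Longrightarrow> (xs ! a, xs ! (Suc a mod ?n)) \<in> A" for a
    proof (induction a)
      case 0
      then show ?case using fst n by simp
    next
      case (Suc a)
      let ?b = "Suc (Suc a) mod ?n"
      have b: "?b < ?n" "?b \<noteq> a"
      proof -
        show "?b < ?n" using n by (intro mod_less_divisor) linarith
        show "?b \<noteq> a"
        proof (cases "Suc (Suc a) < ?n")
          case False
          then have eq: "Suc (Suc a) = ?n" using Suc.prems by simp
          then have "?b = 0" by simp
          then show ?thesis using eq n by linarith
        qed simp
      qed
      have "(xs ! a, xs ! Suc a) \<in> A" using Suc by simp
      moreover have "xs ! ?b \<noteq> xs ! a" using b Suc.prems dist by (simp add: nth_eq_iff_index_eq)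
      ultimately have "(xs ! ?b, xs ! Suc a) \<notin> A"
        using thin_in[OF thin, of "xs ! Suc a" "xs ! ?b" "xs ! a"] b Suc.prems by auto
      then show ?case using icycle_mod_adj[OF ic, of "Suc a"] Suc.prems by (auto simp: adj_iff)
    qed
    have "Restr A (set xs) = cycle_arcs xs"
    proof (intro set_eqI iffI)
      fix e assume e: "e \<in> Restr A (set xs)"
      then obtain a y where ay: "a < ?n" "e = (xs ! a, y)" "y \<in> set xs" "(xs ! a, y) \<in> A"
        by (auto simp: in_set_conv_nth)
      have "0 < ?n" using n by linarith
      with ay have "y = xs ! (Suc a mod ?n)"
        using fwd[of a] mod_less_divisor[of ?n "Suc a"] \<open>a < ?n\<close> by (intro thin_out[OF thin, of "xs ! a"]) (auto intro!: nth_mem)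
      then show "e \<in> cycle_arcs xs" using ay by (auto simp: cycle_arcs_def)
    next
      fix e assume "e \<in> cycle_arcs xs"
      then obtain a where "a < ?n" "e = (xs ! a, xs ! (Suc a mod ?n))" by (auto simp: cycle_arcs_def)
      moreover have "Suc a mod ?n < ?n" using n by (intro mod_less_divisor) linarith
      ultimately show "e \<in> Restr A (set xs)" using fwd by auto
    qed
    then show ?thesis unfolding induces_dicycle_def using n dist by (intro exI[of _ xs]) auto
  qed
  have n: "3 \<le> length xs" using ic by (simp add: icycle_def)
  show ?thesis
  proof (cases "(xs ! 0, xs ! 1) \<in> A")
    case True
    then show ?thesis using *[OF ic thin] by simp
  next
    case False
    then have "(xs ! 1, xs ! 0) \<in> A" using icycle_adj(1)[OF ic, of 0 1] n by (auto simp: adj_iff)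
    moreover obtain x y zs where xs: "xs = x # y # zs" using n by (cases xs; cases "tl xs") auto
    \<comment> \<open>The reversed cycle, listed so that it starts with the same edge.\<close>
    moreover have "rev (rotate 2 xs) = y # x # rev zs" unfolding xs by (simp add: numeral_2_eq_2)
    ultimately show ?thesis
      using *[of "rev (rotate 2 xs)"] icycle_rev[OF icycle_rotate[OF ic, of 2]] thin
      by (auto simp: insert_commute)
  qed
qed

lemma icycle_odd_cycle:
  assumes ic: "icycle A xs" and irr: "irrefl A" and "odd (length xs)"
    and digon: "\<And>x y. x \<in> set xs \<Longrightarrow> y \<in> set xs \<Longrightarrow> adj A x y \<Longrightarrow> (x, y) \<in> A"
  shows "induces_odd_cycle A (set xs)"
proof -
  let ?n = "length xs"
  have n: "3 \<le> ?n" and dist: "distinct xs" using ic by (auto simp: icycle_def)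
  have "Restr A (set xs) = symmetrization (cycle_edges xs)"
  proof (intro set_eqI iffI)
    fix e assume e: "e \<in> Restr A (set xs)"
    then obtain a b where ab: "a < ?n" "b < ?n" "e = (xs ! a, xs ! b)" "(xs ! a, xs ! b) \<in> A"
      by (auto simp: in_set_conv_nth)
    then have "a \<noteq> b" using irr by (auto simp: irrefl_def)
    then have "b = Suc a mod ?n \<or> a = Suc b mod ?n" using icycle_adj_mod[OF ic ab(1,2)] ab(4) by (auto simp: adj_iff)
    then show "e \<in> symmetrization (cycle_edges xs)"
      using ab by (auto simp: symmetrization_def cycle_edges_def)
  next
    fix e assume "e \<in> symmetrization (cycle_edges xs)"
    then obtain x y a where e: "e = (x, y)" "a < ?n" "{x, y} = {xs ! a, xs ! (Suc a mod ?n)}"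
      by (auto simp: symmetrization_def cycle_edges_def)
    moreover have "Suc a mod ?n < ?n" using n by (intro mod_less_divisor) linarith
    ultimately have "x \<in> set xs" "y \<in> set xs" "adj A x y"
      using icycle_mod_adj[OF ic e(2)] by (auto simp: doubleton_eq_iff adj_sym)
    then show "e \<in> Restr A (set xs)" using digon e by auto
  qed
  then show ?thesis unfolding induces_odd_cycle_def using n dist assms(3) by (intro exI[of _ xs]) auto
qed

locale violator_free =
  fixes A :: "('a \<times> 'a) set" and K :: "'a set"
  assumes irr: "irrefl A" and no_violator: "\<And>xs. set xs \<subseteq> K \<Longrightarrow> \<not> violator A xs"
begin

text \<open>The form in which the absence of violators is applied: chords are excluded at the one
  vertex \<open>v\<close> only.\<close>

lemma cycle_cases:
  assumes "ucycle A (v # ps)" "set (v # ps) \<subseteq> K"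
    "\<And>u. u \<in> set ps \<Longrightarrow> adj A v u \<Longrightarrow> u = hd ps \<or> u = last ps"
  shows "thin A (set (v # ps)) \<or> odd (Suc (length ps)) \<and> alike A v (hd ps) (last ps)"
proof -
  have "ps \<noteq> []" using assms(1) by (auto simp: ucycle_def)
  moreover have "\<not> adj A v v" using irr by (auto simp: adj_iff irrefl_def)
  ultimately show ?thesis
    using no_violator[OF assms(2)] assms(1,3) by (auto simp: violator_def)
qed

text \<open>On an induced cycle every vertex may play the part of \<open>v\<close>. If the cycle is
  not thin, each vertex is joined alike to both neighbors, so forward and backward arcs swap roles
  from edge to edge. Around an odd cycle this forces every edge to be symmetric.\<close>

lemma icycle_cases:
  assumes ic: "icycle A xs" and K: "set xs \<subseteq> K"
  shows "thin A (set xs) \<or> odd (length xs) \<and> (\<forall>x\<in>set xs. \<forall>y\<in>set xs. adj A x y \<longrightarrow> (x, y) \<in> A)"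
proof (cases "thin A (set xs)")
  case False
  let ?n = "length xs"
  have n: "3 \<le> ?n" using ic by (simp add: icycle_def)
  have al: "odd ?n \<and> alike A (xs ! i) (xs ! (Suc i mod ?n)) (xs ! ((i + (?n - 1)) mod ?n))" if "i < ?n" for i
  proof -
    let ?r = "rotate i xs"
    obtain v ps where r: "?r = v # ps" using n by (metis length_rotate list.exhaust list.size(3) not_numeral_le_zero)
    have lr: "length ?r = ?n" by simp
    then have lps: "length ps = ?n - 1" using r by simp
    then have "ps \<noteq> []" using n by auto
    have rc: "icycle A ?r" using ic by (rule icycle_rotate)
    have v: "v = ?r ! 0" and hd: "hd ps = ?r ! 1" and lst: "last ps = ?r ! (?n - 1)"
      using r lps n \<open>ps \<noteq> []\<close> by (auto simp: hd_conv_nth last_conv_nth nth_Cons')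
    have "thin A (set ?r) \<or> odd (Suc (length ps)) \<and> alike A v (hd ps) (last ps)"
      unfolding r
    proof (rule cycle_cases)
      show "ucycle A (v # ps)" using icycle_ucycle[OF rc] r by simp
      have "set (v # ps) = set xs" unfolding r[symmetric] by simp
      then show "set (v # ps) \<subseteq> K" using K by simp
      fix u assume u: "u \<in> set ps" "adj A v u"
      then obtain b where b: "b < length ps" "u = ps ! b" by (auto simp: in_set_conv_nth)
      then have "u = ?r ! Suc b" using r by simp
      then have "Suc b = 1 \<or> Suc b = ?n - 1"
        using icycle_adj(1)[OF rc, of 0 "Suc b"] u(2) v b lps by auto
      then show "u = hd ps \<or> u = last ps" using \<open>u = ?r ! Suc b\<close> hd lst by metis
    qed
    then have "odd ?n" "alike A (?r ! 0) (?r ! 1) (?r ! (?n - 1))"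
      using False lps n v hd lst by auto
    moreover have "?r ! j = xs ! ((i + j) mod ?n)" if "j < ?n" for j
      using that by (simp add: nth_rotate)
    moreover from this[of 0] have "?r ! 0 = xs ! i" using n that by (cases "xs = []") auto
    ultimately show ?thesis using n that by simp
  qed
  have "odd ?n" using al[of 0] n by force
  define F where "F a \<longleftrightarrow> (xs ! a, xs ! (Suc a mod ?n)) \<in> A" for a
  define B where "B a \<longleftrightarrow> (xs ! (Suc a mod ?n), xs ! a) \<in> A" for a
  have stp: "(F (Suc a) \<longleftrightarrow> B a) \<and> (B (Suc a) \<longleftrightarrow> F a)" if "Suc a < ?n" for a
  proof -
    have "Suc a + (?n - 1) = a + ?n" using that by simp
    then have "(Suc a + (?n - 1)) mod ?n = a" using that by simp
    then show ?thesis using al[of "Suc a"] that by (auto simp: F_def B_def alike_def)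
  qed
  have "Suc (?n - 1) = ?n" using n by linarith
  then have "(0 + (?n - 1)) mod ?n = ?n - 1" "Suc (?n - 1) mod ?n = 0" by (auto simp del: One_nat_def)
  then have wrap: "(F 0 \<longleftrightarrow> B (?n - 1)) \<and> (B 0 \<longleftrightarrow> F (?n - 1))"
    using al[of 0] n \<open>Suc (?n - 1) = ?n\<close> by (cases "xs = []") (auto simp: F_def B_def alike_def)
  have par: "a < ?n \<Longrightarrow> (F a \<longleftrightarrow> (if even a then F 0 else B 0)) \<and> (B a \<longleftrightarrow> (if even a then B 0 else F 0))" for a
    by (induction a) (use stp in auto)
  have "B (?n - 1) \<longleftrightarrow> B 0" using par[of "?n - 1"] \<open>odd ?n\<close> n by simp
  then have "F 0 \<longleftrightarrow> B 0" using wrap by blast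
  moreover have "F 0 \<or> B 0" using icycle_mod_adj[OF ic, of 0] n by (cases "xs = []") (auto simp: F_def B_def adj_iff)
  ultimately have FB: "F a \<and> B a" if "a < ?n" for a using par[OF that] by (auto split: if_splits)
  have "(x, y) \<in> A" if xy: "x \<in> set xs" "y \<in> set xs" "adj A x y" for x y
  proof -
    obtain a b where ab: "a < ?n" "b < ?n" "x = xs ! a" "y = xs ! b" using xy by (auto simp: in_set_conv_nth)
    have "a \<noteq> b" using ab xy(3) irr by (auto simp: adj_iff irrefl_def)
    then show ?thesis using icycle_adj_mod[OF ic ab(1,2)] ab xy(3) FB[of a] FB[of b] by (auto simp: F_def B_def)
  qed
  then show ?thesis using \<open>odd ?n\<close> by blast
qed simp

subsection \<open>From a missing edge to a long induced cycle\<close>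

text \<open>The path closes up through \<open>y\<close> to a cycle, and so does its part up to
  position \<open>j\<close>; neither has a chord at \<open>ws ! 0\<close>. The long one is not thin
  because \<open>y\<close> has three neighbors on it, so it is odd and \<open>ws ! 0\<close> is
  joined alike to \<open>ws ! 1\<close> and \<open>y\<close>. This keeps the short one from being
  thin, so it is odd as well.\<close>

lemma path_chord_odd:
  assumes y: "y \<in> K" and ws: "set ws \<subseteq> K - {y}" "distinct ws" "3 \<le> length ws"
    and ind: "\<And>i j. i < j \<Longrightarrow> j < length ws \<Longrightarrow> adj A (ws ! i) (ws ! j) \<longleftrightarrow> j = Suc i"
    and ends: "adj A y (ws ! 0)" "adj A y (ws ! (length ws - 1))"
    and j: "0 < j" "Suc j < length ws" "adj A y (ws ! j)"
  shows "odd (length ws - 1)" "odd j"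
proof -
  let ?m = "length ws - 1"
  have cases: "thin A (insert y (set (take (Suc i) ws))) \<or> odd i \<and> alike A (ws ! 0) (ws ! 1) y"
    if i: "1 \<le> i" "i < length ws" "adj A y (ws ! i)" for i
  proof -
    obtain v ps where vps: "take (Suc i) ws = v # ps" using ws(3) by (cases ws) auto
    have lps: "length ps = i" using vps i by (metis Suc_leI add_right_cancel length_Cons length_take min.absorb2 Suc_inject)
    have nth: "(v # ps) ! a = ws ! a" if "a \<le> i" for a using that vps by (metis le_imp_less_Suc nth_take)
    have v: "v = ws ! 0" using nth[of 0] by simp
    have "last (v # ps) = (v # ps) ! i" using last_conv_nth[of "v # ps"] lps by (simp del: last.simps)
    then have lst: "last (v # ps) = ws ! i" using nth[of i] by simp
    have "ps \<noteq> []" using lps i by auto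
    then have hd: "hd ps = ws ! 1" "ps \<noteq> []" using nth[of 1] lps i by (auto simp: hd_conv_nth)
    have sub: "set (v # ps) \<subseteq> set ws" unfolding vps[symmetric] by (rule set_take_subset)
    have "thin A (set (v # (ps @ [y]))) \<or> odd (Suc (length (ps @ [y]))) \<and> alike A v (hd (ps @ [y])) (last (ps @ [y]))"
    proof (rule cycle_cases)
      have "successively (adj A) ws" using ind by (auto simp: successively_conv_nth)
      then have "successively (adj A) (v # ps)" unfolding vps[symmetric] by (rule successively_take)
      moreover have "distinct (v # ps)" unfolding vps[symmetric] using ws(2) by simp
      moreover have "y \<notin> set (v # ps)" using sub ws(1) by blast
      moreover have "successively (adj A) ((v # ps) @ [y])"
        unfolding successively_append_iff
        using \<open>successively (adj A) (v # ps)\<close> i(3) lst adj_sym[of y "ws ! i" A] by simp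
      ultimately show "ucycle A (v # ps @ [y])"
        using ends(1) v lps i hd(2) by (auto simp: ucycle_def)
      show "set (v # ps @ [y]) \<subseteq> K" using sub ws(1) y by auto
      fix u assume u: "u \<in> set (ps @ [y])" "adj A v u"
      show "u = hd (ps @ [y]) \<or> u = last (ps @ [y])"
      proof (cases "u = y")
        case False
        then obtain a where a: "a < length ps" "u = ps ! a" using u(1) by (auto simp: in_set_conv_nth)
        then have "u = ws ! Suc a" using nth[of "Suc a"] lps by simp
        then have "Suc a = 1" using ind[of 0 "Suc a"] u(2) v a lps i by auto
        then show ?thesis using \<open>u = ws ! Suc a\<close> hd by simp
      qed simp
    qed
    moreover have "set (v # (ps @ [y])) = insert y (set (take (Suc i) ws))" unfolding vps by auto
    ultimately show ?thesis using lps hd v by auto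
  qed
  have in_set: "ws ! a \<in> set (take (Suc i) ws)" if "a \<le> i" "i < length ws" for a i
    using that by (auto simp: in_set_conv_nth intro!: exI[of _ a])
  have ne: "ws ! a \<noteq> ws ! b" if "a \<noteq> b" "a < length ws" "b < length ws" for a b
    using that ws(2) by (simp add: nth_eq_iff_index_eq)
  have yw: "ws ! a \<noteq> y" if "a < length ws" for a using that ws(1) nth_mem by blast
  have "ws \<noteq> []" using ws(3) by auto
  have "\<not> thin A (insert y (set (take (Suc ?m) ws)))"
  proof
    assume "thin A (insert y (set (take (Suc ?m) ws)))"
    then show False
      by (rule thin_three[of A _ y "ws ! 0" "ws ! j" "ws ! ?m"])
        (use in_set[of _ ?m] ne[of 0 j] ne[of 0 ?m] ne[of j ?m] j ends ws(3) yw[of 0] \<open>ws \<noteq> []\<close> in auto)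
  qed
  then have m: "odd ?m" "alike A (ws ! 0) (ws ! 1) y" using cases[of ?m] ends ws(3) by auto
  then show "odd ?m" by simp
  have "\<not> thin A (insert y (set (take (Suc j) ws)))"
  proof
    assume "thin A (insert y (set (take (Suc j) ws)))"
    from thin_not_alike[OF this, of "ws ! 0" "ws ! 1" y] show False
      using in_set[of _ j] j yw[of 1] ind[of 0 1] m(2) by auto
  qed
  then show "odd j" using cases[of j] j by auto
qed

text \<open>A geodesic between non-adjacent vertices starts with \<open>a\<close>, \<open>y\<close>,
  \<open>b\<close>, where \<open>a\<close> and \<open>b\<close> are not adjacent, and
  biconnectedness provides a geodesic from \<open>b\<close> to \<open>a\<close> that avoids
  \<open>y\<close>. With \<open>y\<close> it forms a cycle whose chords could only start at
  \<open>y\<close>. A chord at position \<open>j\<close> would make \<open>j\<close>,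
  \<open>?m - j\<close> and their sum \<open>?m\<close> all odd.\<close>

lemma long_icycle:
  assumes bic: "biconnected A K" and xz: "x \<in> K" "z \<in> K" "x \<noteq> z" "\<not> adj A x z"
  shows "\<exists>xs. icycle A xs \<and> 4 \<le> length xs \<and> set xs \<subseteq> K"
proof -
  have "(x, z) \<in> (Restr (underlying A) K)\<^sup>*" using bic xz by (auto simp: biconnected_def connected_in_def)
  from rtrancl_walk[OF this xz(1)] obtain w0 where w0: "w0 \<noteq> []" "hd w0 \<in> {x}" "last w0 \<in> {z}"
    "set w0 \<subseteq> K" "successively (adj A) w0" by blast
  obtain w where "geodesic A {x} {z} K w" using geodesic_exists[OF w0] by blast
  note w = geodesicD[OF this]
  have w3: "3 \<le> length w"
  proof (rule ccontr)
    assume "\<not> 3 \<le> length w"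
    then consider "length w = 1" | "length w = 2" using w(1) by (cases "length w") (auto simp: not_le, linarith)
    then show False
    proof cases
      case 1
      then show False using w(1-3) xz(3) by (cases w) auto
    next
      case 2
      then show False using w(6)[of 0 1] w(1-3) xz(4) by (simp add: hd_conv_nth last_conv_nth)
    qed
  qed
  define a y b where "a = w ! 0" and "y = w ! 1" and "b = w ! 2"
  have ayb: "a \<in> K" "y \<in> K" "b \<in> K" using w3 unfolding a_def y_def b_def by (auto intro!: subsetD[OF w(4)] nth_mem)
  have adj: "adj A a y" "adj A y b" "\<not> adj A a b"
    using w(6)[of 0 1] w(6)[of 1 2] w(6)[of 0 2] w3 by (auto simp: a_def y_def b_def)
  have ne: "a \<noteq> b" "a \<noteq> y" "b \<noteq> y" 
    using nth_eq_iff_index_eq[OF w(5), of 0 2] nth_eq_iff_index_eq[OF w(5), of 0 1]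
      nth_eq_iff_index_eq[OF w(5), of 2 1] w(1) w3 by (auto simp: a_def y_def b_def)
  have "(b, a) \<in> (Restr (underlying A) (K - {y}))\<^sup>*"
    using bic ayb ne by (auto simp: biconnected_def connected_in_def)
  from rtrancl_walk[OF this] ayb ne obtain v0 where v0: "v0 \<noteq> []" "hd v0 \<in> {b}" "last v0 \<in> {a}"
    "set v0 \<subseteq> K - {y}" "successively (adj A) v0" by blast
  obtain ws where "geodesic A {b} {a} (K - {y}) ws" using geodesic_exists[OF v0] by blast
  note ws = geodesicD[OF this]
  have hl: "ws ! 0 = b" "ws ! (length ws - 1) = a" using ws(1-3) by (auto simp: hd_conv_nth last_conv_nth)
  have ws3: "3 \<le> length ws"
  proof (rule ccontr)
    assume "\<not> 3 \<le> length ws"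
    then consider "length ws = 1" | "length ws = 2" using ws(1) by (cases "length ws") (auto simp: not_le, linarith)
    then show False
    proof cases
      case 1
      then show False using hl ne by auto
    next
      case 2
      then show False using ws(6)[of 0 1] hl adj(3) by (auto simp: adj_sym)
    qed
  qed
  let ?m = "length ws - 1"
  have ends: "adj A y (ws ! 0)" "adj A y (ws ! ?m)" using adj hl by (auto simp: adj_sym)
  have chord: "\<not> adj A y (ws ! j)" if j: "0 < j" "Suc j < length ws" for j
  proof
    assume a: "adj A y (ws ! j)"
    have 1: "odd ?m" "odd j" using path_chord_odd[OF ayb(2) ws(4,5) ws3 ws(6) ends j a] by auto
    have "odd (?m - j)"
    proof (rule path_chord_odd(2)[of y "rev ws"])
      show "adj A (rev ws ! i) (rev ws ! k) \<longleftrightarrow> k = Suc i" if "i < k" "k < length (rev ws)" for i k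
        using ws(6)[of "length ws - Suc k" "length ws - Suc i"] that by (auto simp: rev_nth adj_sym)
    qed (use ayb ws(1,4,5) ws3 ends j a in \<open>auto simp: rev_nth Suc_diff_Suc\<close>)
    then show False using 1 j by auto
  qed
  have "icycle A (y # ws)"
    unfolding icycle_def
  proof (intro conjI allI impI)
    fix i k assume ik: "i < k" "k < length (y # ws)"
    show "adj A ((y # ws) ! i) ((y # ws) ! k) \<longleftrightarrow> k = Suc i \<or> i = 0 \<and> k = length (y # ws) - 1"
    proof (cases i)
      case 0
      obtain k' where k': "k = Suc k'" "k' < length ws" using ik by (cases k) auto
      have "adj A y (ws ! k') \<longleftrightarrow> k' = 0 \<or> k' = ?m"
        using chord[of k'] ends k' by (metis Suc_lessI diff_Suc_1 gr0I)
      then show ?thesis using 0 k' ws3 by auto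
    next
      case (Suc i')
      then show ?thesis using ik ws(6)[of i' "k - 1"] by (cases k) auto
    qed
  qed (use ws(4,5) ws3 in auto)
  then show ?thesis using ws(4) ws3 ayb by (intro exI[of _ "y # ws"]) auto
qed

subsection \<open>Ears of induced cycles\<close>

text \<open>Nothing is required of the neighbors of the last vertex of \<open>ps\<close> on the
  cycle apart from \<open>xs ! 0\<close>; there may be none or many of them.\<close>

definition ear :: "'a list \<Rightarrow> 'a list \<Rightarrow> bool" where
  "ear xs ps \<longleftrightarrow> icycle A xs \<and> 4 \<le> length xs \<and> set xs \<subseteq> K \<and> ps \<noteq> [] \<and> distinct ps \<and> set ps \<subseteq> K
     \<and> set ps \<inter> set xs = {}
     \<and> (\<forall>a b. a < b \<longrightarrow> b < length ps \<longrightarrow> (adj A (ps ! a) (ps ! b) \<longleftrightarrow> b = Suc a))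
     \<and> (\<forall>a<length ps. adj A (ps ! a) (xs ! 0) \<longleftrightarrow> a = 0)
     \<and> (\<forall>a b. Suc a < length ps \<longrightarrow> 1 \<le> b \<longrightarrow> b < length xs \<longrightarrow> \<not> adj A (ps ! a) (xs ! b))"

text \<open>The position of the first neighbor of the end of the ear, counted from the vertex \<open>xs ! 0\<close>
  where the ear starts.\<close>

definition first_nbr :: "'a list \<Rightarrow> 'a list \<Rightarrow> nat \<Rightarrow> bool" where
  "first_nbr xs ps i \<longleftrightarrow> 1 \<le> i \<and> i < length xs \<and> adj A (last ps) (xs ! i)
     \<and> (\<forall>b. 1 \<le> b \<longrightarrow> b < i \<longrightarrow> \<not> adj A (last ps) (xs ! b))"

text \<open>The same cycle with the same start in the opposite direction, so that facts about the
  first neighbor of the end of an ear also apply to the last one.\<close>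

definition mirror :: "'a list \<Rightarrow> 'a list" where
  "mirror xs = hd xs # rev (tl xs)"

lemma mirror_nth:
  assumes "b < length xs" shows "mirror xs ! b = xs ! ((length xs - b) mod length xs)"
proof (cases xs)
  case (Cons x ys)
  then show ?thesis using assms by (cases b) (auto simp: mirror_def rev_nth nth_Cons' Suc_diff_Suc)
qed (use assms in simp)

lemma set_mirror: "xs \<noteq> [] \<Longrightarrow> set (mirror xs) = set xs"
  by (cases xs) (auto simp: mirror_def)

lemma length_mirror: "xs \<noteq> [] \<Longrightarrow> length (mirror xs) = length xs"
  by (cases xs) (auto simp: mirror_def)

lemma icycle_mirror: assumes "icycle A xs" shows "icycle A (mirror xs)"
proof -
  obtain x ys where xs: "xs = x # ys" using assms by (cases xs) (auto simp: icycle_def)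
  then have "mirror xs = rev (rotate1 xs)" by (simp add: mirror_def)
  then show ?thesis using icycle_rev[OF icycle_rotate1[OF assms]] by simp
qed

lemma ear_mirror: assumes "ear xs ps" shows "ear (mirror xs) ps"
proof -
  let ?n = "length xs"
  have n: "4 \<le> ?n" "xs \<noteq> []" using assms by (auto simp: ear_def)
  have 0: "mirror xs ! 0 = xs ! 0" using mirror_nth[of 0 xs] n by simp
  have b: "mirror xs ! b = xs ! (?n - b)" if "1 \<le> b" "b < ?n" for b
    using mirror_nth[of b xs] that by simp
  have "\<not> adj A (ps ! a) (mirror xs ! b)" if "Suc a < length ps" "1 \<le> b" "b < ?n" for a b
    using assms that b[OF that(2,3)] by (auto simp: ear_def)
  then show ?thesis
    using assms icycle_mirror[of xs] 0 n unfolding ear_def by (simp add: set_mirror length_mirror)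
qed

lemma ear_facts:
  assumes "ear xs ps"
  shows "icycle A xs" "4 \<le> length xs" "set xs \<subseteq> K" "ps \<noteq> []" "distinct ps" "set ps \<subseteq> K"
    "set ps \<inter> set xs = {}" "distinct xs"
    "\<And>a b. a < b \<Longrightarrow> b < length ps \<Longrightarrow> adj A (ps ! a) (ps ! b) \<longleftrightarrow> b = Suc a"
    "\<And>a. a < length ps \<Longrightarrow> adj A (ps ! a) (xs ! 0) \<longleftrightarrow> a = 0"
    "\<And>a b. Suc a < length ps \<Longrightarrow> 1 \<le> b \<Longrightarrow> b < length xs \<Longrightarrow> \<not> adj A (ps ! a) (xs ! b)"
    "successively (adj A) xs" "successively (adj A) ps"
    "xs ! 0 \<noteq> ps ! 0" "ps ! 0 \<in> set ps" "\<And>b. b < length xs \<Longrightarrow> xs ! b \<notin> set ps" "xs \<noteq> []"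
proof -
  show "successively (adj A) ps" using assms by (auto simp: ear_def successively_conv_nth)
  show "successively (adj A) xs" using assms icycle_ucycle by (auto simp: ear_def ucycle_def)
  show "distinct xs" using assms by (auto simp: ear_def icycle_def)
  have len: "0 < length ps" "0 < length xs" using assms by (auto simp: ear_def)
  then show "ps ! 0 \<in> set ps" by simp
  show no: "xs ! b \<notin> set ps" if "b < length xs" for b using assms that nth_mem unfolding ear_def by blast
  show "xs ! 0 \<noteq> ps ! 0" using no[of 0] len by (metis nth_mem)
qed (use assms in \<open>auto simp: ear_def\<close>)

text \<open>The bound on \<open>i\<close> excludes the predecessor of \<open>xs ! 0\<close>, so the
  part of the cycle up to \<open>i\<close> is an induced path. As \<open>i\<close> is the first
  neighbor, the end of the ear adds no chord.\<close>

lemma ear_icycle: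
  assumes ear: "ear xs ps" and i: "first_nbr xs ps i" "Suc (Suc i) \<le> length xs"
  shows "icycle A (take (Suc i) xs @ rev ps)"
  unfolding icycle_def
proof (intro conjI allI impI)
  note e = ear_facts[OF ear]
  let ?l = "take (Suc i) xs @ rev ps" and ?s = "length ps"
  have i1: "1 \<le> i" "i < length xs" using i(1) by (auto simp: first_nbr_def)
  have s: "1 \<le> ?s" using e(4) by (cases ps) auto
  have len: "length ?l = Suc i + ?s" using i1 by simp
  show "3 \<le> length ?l" using len i1 s by simp
  show "distinct ?l" using e(5,7,8) by (auto dest: in_set_takeD)
  fix a b assume ab: "a < b" "b < length ?l"
  have l1: "?l ! a = xs ! a" if "a \<le> i" for a using that i1 by (simp add: nth_append)
  have l2: "?l ! (Suc i + t) = ps ! (?s - Suc t)" if "t < ?s" for t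
    using that i1 by (simp add: nth_append rev_nth)
  show "adj A (?l ! a) (?l ! b) \<longleftrightarrow> b = Suc a \<or> a = 0 \<and> b = length ?l - 1"
  proof (cases "b \<le> i")
    case True
    then show ?thesis using icycle_adj(1)[OF e(1), of a b] ab i i1 l1 s len by auto
  next
    case False
    then obtain t where t: "b = Suc i + t" "t < ?s"
      using ab(2) len by (metis add_less_cancel_left le_Suc_ex not_less_eq_eq)
    show ?thesis
    proof (cases "a \<le> i")
      case True
      show ?thesis
      proof (cases "a = 0")
        case True
        then have "adj A (?l ! a) (?l ! b) \<longleftrightarrow> ?s - Suc t = 0"
          using l1[of 0] l2[OF t(2)] t e(10)[of "?s - Suc t"] s by (simp add: adj_sym)
        then show ?thesis using True t len i1 by auto
      next
        case False
        have "adj A (?l ! a) (?l ! b) \<longleftrightarrow> adj A (ps ! (?s - Suc t)) (xs ! a)"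
          using l1[OF True] l2[OF t(2)] t by (simp add: adj_sym)
        also have "\<dots> \<longleftrightarrow> t = 0 \<and> a = i"
        proof (cases "t = 0")
          case t0: True
          then have "ps ! (?s - Suc t) = last ps" using e(4) by (simp add: last_conv_nth)
          then show ?thesis using i(1) t0 True False by (cases "a = i") (auto simp: first_nbr_def)
        next
          case False
          then show ?thesis using e(11)[of "?s - Suc t" a] \<open>a \<noteq> 0\<close> True i1 t(2) by auto
        qed
        finally show ?thesis using False True t by auto
      qed
    next
      case False
      then obtain u where u: "a = Suc i + u" "u < t"
        using ab(1) t by (metis add_less_cancel_left le_Suc_ex not_less_eq_eq)
      have "adj A (?l ! a) (?l ! b) \<longleftrightarrow> adj A (ps ! (?s - Suc t)) (ps ! (?s - Suc u))"
        using l2[of u] l2[of t] t u by (simp add: adj_sym)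
      also have "\<dots> \<longleftrightarrow> ?s - Suc u = Suc (?s - Suc t)" using e(9)[of "?s - Suc t" "?s - Suc u"] t u by auto
      finally show ?thesis using t u by auto
    qed
  qed
qed

lemma ear_start_adj:
  assumes ear: "ear xs ps"
  shows "adj A (xs ! 0) (xs ! 1)" "adj A (xs ! 0) (xs ! (length xs - 1))" "adj A (xs ! 0) (ps ! 0)"
    "xs ! 1 \<noteq> xs ! (length xs - 1)" "xs ! 1 \<noteq> ps ! 0" "xs ! (length xs - 1) \<noteq> ps ! 0"
proof -
  note e = ear_facts[OF ear]
  have n: "0 < length xs" "1 < length xs" "length xs - 1 < length xs" using e(2) by auto
  show "adj A (xs ! 0) (xs ! 1)" "adj A (xs ! 0) (xs ! (length xs - 1))"
    using icycle_adj(1)[OF e(1), of 0] n by auto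
  show "adj A (xs ! 0) (ps ! 0)" using e(10)[of 0] e(4) by (simp add: adj_sym)
  show "xs ! 1 \<noteq> xs ! (length xs - 1)"
    using nth_eq_iff_index_eq[OF e(8) n(2,3)] e(2) by simp
  show "xs ! 1 \<noteq> ps ! 0" "xs ! (length xs - 1) \<noteq> ps ! 0" using e(15) e(16) n by metis+
qed

text \<open>On a thin cycle the edge between \<open>xs ! 0\<close> and \<open>xs ! 1\<close> is not
  symmetric. It also lies on the induced cycle through the ear, which is therefore thin, too, and
  continues in the direction of this edge.\<close>

lemma ear_thin:
  assumes ear: "ear xs ps" and i: "first_nbr xs ps i" "Suc (Suc i) \<le> length xs" and thin: "thin A (set xs)"
  shows "(xs ! 0, xs ! 1) \<in> A \<Longrightarrow> (ps ! 0, xs ! 0) \<in> A \<and> (xs ! 0, ps ! 0) \<notin> A"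
    "(xs ! 1, xs ! 0) \<in> A \<Longrightarrow> (xs ! 0, ps ! 0) \<in> A \<and> (ps ! 0, xs ! 0) \<notin> A"
proof -
  note e = ear_facts[OF ear] and st = ear_start_adj[OF ear]
  let ?l = "take (Suc i) xs @ rev ps"
  have i1: "1 \<le> i" "i < length xs" using i(1) by (auto simp: first_nbr_def)
  have x01: "xs ! 0 \<in> set ?l" "xs ! 1 \<in> set ?l"
    using nth_mem[of 0 "take (Suc i) xs"] nth_mem[of 1 "take (Suc i) xs"] i1 by auto
  have p0: "ps ! 0 \<in> set ?l" using e(15) by simp
  have mem: "xs ! 0 \<in> set xs" "xs ! 1 \<in> set xs" "xs ! (length xs - 1) \<in> set xs" using e(2,17) by auto
  have single: "\<not> ((xs ! 0, xs ! 1) \<in> A \<and> (xs ! 1, xs ! 0) \<in> A)"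
    using thin_digon[OF thin mem(1), of "xs ! 1" "xs ! (length xs - 1)"] mem st by auto
  have "set ?l \<subseteq> K" using e(3,6) by (auto dest: in_set_takeD)
  then have "thin A (set ?l)" using icycle_cases[OF ear_icycle[OF ear i]] single x01 st(1) by (auto simp: adj_sym)
  then show "(xs ! 0, xs ! 1) \<in> A \<Longrightarrow> (ps ! 0, xs ! 0) \<in> A \<and> (xs ! 0, ps ! 0) \<notin> A"
    "(xs ! 1, xs ! 0) \<in> A \<Longrightarrow> (xs ! 0, ps ! 0) \<in> A \<and> (ps ! 0, xs ! 0) \<notin> A"
    using thin_out[OF _ x01(1) x01(2) p0] thin_in[OF _ x01(1) x01(2) p0] st(3,5) by (auto simp: adj_iff)
qed

text \<open>Of the edges of \<open>xs\<close>, only the one from \<open>xs ! 0\<close> to the last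
  vertex is replaced by the ear. The cycle obtained has no chord at \<open>xs ! 1\<close>, and it is
  not thin because three neighbors of \<open>xs ! 0\<close> lie on it.\<close>

lemma ear_last:
  assumes ear: "ear xs ps" and i: "first_nbr xs ps (length xs - 1)"
  shows "odd (length xs + length ps)" "alike A (xs ! 1) (xs ! 2) (xs ! 0)"
proof -
  note e = ear_facts[OF ear] and st = ear_start_adj[OF ear]
  obtain u0 u1 u2 r where xs: "xs = u0 # u1 # u2 # r" "r \<noteq> []"
    using e(2) by (cases xs; cases "tl xs"; cases "tl (tl xs)"; cases "tl (tl (tl xs))") auto
  let ?ps = "u2 # r @ rev ps @ [u0]"
  have u: "xs ! 0 = u0" "xs ! 1 = u1" "xs ! 2 = u2" by (simp_all add: xs)
  have lst: "last xs = xs ! (length xs - 1)" using xs by (simp add: last_conv_nth)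
  have set_eq: "set (u1 # ?ps) = set xs \<union> set ps" by (auto simp: xs)
  have "thin A (set (u1 # ?ps)) \<or> odd (Suc (length ?ps)) \<and> alike A u1 (hd ?ps) (last ?ps)"
  proof (rule cycle_cases)
    have sxs: "successively (adj A) (u1 # u2 # r)" using e(12) xs by simp
    have "successively (adj A) (rev ps)" using e(13) by (simp add: adj_sym[of _ _ A])
    moreover have "adj A (last (u1 # u2 # r)) (hd (rev ps))"
      using i lst xs by (simp add: first_nbr_def hd_rev adj_sym)
    moreover have "adj A (last (rev ps)) u0" using st(3) e(4) u by (simp add: last_rev hd_conv_nth adj_sym)
    ultimately have "successively (adj A) ((u1 # u2 # r) @ rev ps @ [u0])"
      unfolding successively_append_iff using sxs e(4) by (auto simp: hd_append)
    moreover have "adj A (last (u1 # ?ps)) u1" using st(1) u by simp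
    ultimately show "ucycle A (u1 # ?ps)"
      using e(5,7,8) unfolding ucycle_def xs(1) by auto
    show "set (u1 # ?ps) \<subseteq> K" unfolding set_eq using e(3,6) by simp
    fix w assume w: "w \<in> set ?ps" "adj A u1 w"
    show "w = hd ?ps \<or> w = last ?ps"
    proof (cases "w \<in> set ps")
      case True
      then obtain a where a: "a < length ps" "w = ps ! a" by (auto simp: in_set_conv_nth)
      have "adj A (ps ! a) (xs ! 1)" using w a u by (simp add: adj_sym)
      then have "\<not> Suc a < length ps" using e(11)[of a 1] e(2) by auto
      then have "ps ! a = last ps" using a e(4) by (metis Suc_lessI diff_Suc_1 last_conv_nth)
      then show ?thesis using i \<open>adj A (ps ! a) (xs ! 1)\<close> e(2) by (auto simp: first_nbr_def)
    next
      case False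
      then have "w \<in> set xs" using w(1) by (auto simp: xs)
      then obtain b where b: "b < length xs" "w = xs ! b" by (auto simp: in_set_conv_nth)
      have "b \<noteq> 1" using w(2) b u irr by (auto simp: adj_iff irrefl_def)
      then consider "b = 0" | "1 < b" by linarith
      then show ?thesis
      proof cases
        case 2
        then have "b = 2" using icycle_adj(1)[OF e(1), of 1 b] w(2) b u by auto
        then show ?thesis using b u by simp
      qed (use b u in simp)
    qed
  qed
  moreover have "\<not> thin A (set (u1 # ?ps))"
  proof
    assume "thin A (set (u1 # ?ps))"
    then show False unfolding set_eq
      by (rule thin_three[of A _ "xs ! 0" "xs ! 1" "xs ! (length xs - 1)" "ps ! 0"])
        (use st e(2,15,17) in auto)
  qed
  ultimately show "odd (length xs + length ps)" "alike A (xs ! 1) (xs ! 2) (xs ! 0)"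
    using u by (auto simp: xs)
qed

text \<open>The ear and the vertices of \<open>xs\<close> from position \<open>i\<close> on form a
  cycle with \<open>xs ! 0\<close>. It misses \<open>xs ! 1\<close>, so it has no chord at
  \<open>xs ! 0\<close>; the symmetric edge to the last vertex of \<open>xs\<close> rules out that
  it is thin.\<close>

lemma ear_second_cycle:
  assumes ear: "ear xs ps" and i: "first_nbr xs ps i" "2 \<le> i"
    and digon: "\<And>x y. x \<in> set xs \<Longrightarrow> y \<in> set xs \<Longrightarrow> adj A x y \<Longrightarrow> (x, y) \<in> A"
  shows "odd (Suc (length ps + (length xs - i)))"
proof -
  note e = ear_facts[OF ear] and st = ear_start_adj[OF ear]
  have i1: "1 \<le> i" "i < length xs" using i(1) by (auto simp: first_nbr_def)
  let ?d = "drop i xs" and ?v = "xs ! 0"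
  have d: "?d \<noteq> []" "hd ?d = xs ! i" "last ?d = xs ! (length xs - 1)"
    using i1 by (auto simp: hd_drop_conv_nth last_conv_nth)
  have vd: "?v \<notin> set ?d"
  proof
    assume "?v \<in> set ?d"
    then obtain a where "a < length xs - i" "xs ! (i + a) = xs ! 0" using i1 by (auto simp: in_set_conv_nth)
    then show False using nth_eq_iff_index_eq[OF e(8), of "i + a" 0] i(2) e(17) by auto
  qed
  have nd: "\<not> thin A (set (?v # ps @ ?d))"
  proof
    assume "thin A (set (?v # ps @ ?d))"
    moreover have "xs ! (length xs - 1) \<in> set ?d" using d by (metis last_in_set)
    moreover have "?v \<in> set xs" "xs ! (length xs - 1) \<in> set xs" using e(2,17) by auto
 then have "(?v, xs ! (length xs - 1)) \<in> A" "(xs ! (length xs - 1), ?v) \<in> A"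
      using digon st(2) by (auto simp: adj_sym)
    ultimately show False
      using thin_digon[of A "set (?v # ps @ ?d)" ?v "xs ! (length xs - 1)" "ps ! 0"] st e(15) by auto
  qed
  have "thin A (set (?v # ps @ ?d)) \<or> odd (Suc (length (ps @ ?d))) \<and> alike A ?v (hd (ps @ ?d)) (last (ps @ ?d))"
  proof (rule cycle_cases)
    have "successively (adj A) ([?v] @ ps @ ?d)"
      unfolding successively_append_iff
      using e(4,13) successively_drop[OF e(12), of i] st(3) i(1) d by (auto simp: hd_conv_nth first_nbr_def nth_append)
    moreover have "distinct (?v # ps @ ?d)"
      using vd e(5,7,8,17) e(16)[of 0] i1 by (auto dest: in_set_dropD)
    moreover have "adj A (last (?v # ps @ ?d)) ?v" using d st(2) by (simp add: adj_sym)
    moreover have "3 \<le> length (?v # ps @ ?d)" using e(4) d(1) i1 by (cases ps) auto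
    ultimately show "ucycle A (?v # ps @ ?d)" by (simp add: ucycle_def)
    have "?v \<in> K" using e(2,3,17) by (auto intro!: subsetD[OF e(3)])
    then show "set (?v # ps @ ?d) \<subseteq> K" using e(3,6) by (auto dest: in_set_dropD)
    fix w assume w: "w \<in> set (ps @ ?d)" "adj A ?v w"
    show "w = hd (ps @ ?d) \<or> w = last (ps @ ?d)"
    proof (cases "w \<in> set ps")
      case True
      then obtain a where a: "a < length ps" "w = ps ! a" by (auto simp: in_set_conv_nth)
      then have "a = 0" using e(10)[of a] w(2) by (simp add: adj_sym)
      then show ?thesis using a e(4) by (simp add: hd_conv_nth nth_append)
    next
      case False
      then obtain b where b: "b < length xs - i" "w = xs ! (i + b)" using w(1) by (auto simp: in_set_conv_nth)
      then have "i + b = 1 \<or> i + b = length xs - 1"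
        using icycle_adj(1)[OF e(1), of 0 "i + b"] w(2) i1 by auto
      then show ?thesis using b d i(2) by auto
    qed
  qed
  then show ?thesis using nd by auto
qed

text \<open>The symmetric edge between \<open>xs ! 0\<close> and \<open>xs ! 1\<close> keeps the
  induced cycle through the ear from being thin, so its length is odd.\<close>

lemma ear_digon_mid:
  assumes ear: "ear xs ps" and i: "first_nbr xs ps i" "Suc (Suc i) \<le> length xs"
    and digon: "\<And>x y. x \<in> set xs \<Longrightarrow> y \<in> set xs \<Longrightarrow> adj A x y \<Longrightarrow> (x, y) \<in> A"
  shows "odd (Suc i + length ps)"
proof -
  note e = ear_facts[OF ear] and st = ear_start_adj[OF ear]
  let ?l = "take (Suc i) xs @ rev ps"
  have i1: "1 \<le> i" "i < length xs" using i(1) by (auto simp: first_nbr_def)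
  have x01: "xs ! 0 \<in> set ?l" "xs ! 1 \<in> set ?l"
    using nth_mem[of 0 "take (Suc i) xs"] nth_mem[of 1 "take (Suc i) xs"] i1 by auto
  have mem: "xs ! 0 \<in> set xs" "xs ! 1 \<in> set xs" using e(2,17) by auto
  have "set ?l \<subseteq> K" using e(3,6) by (auto dest: in_set_takeD)
  moreover have "\<not> thin A (set ?l)"
    using thin_digon[of A "set ?l" "xs ! 0" "xs ! 1" "ps ! 0"] x01 e(15) st digon[OF mem] digon[OF mem(2,1)]
    by (auto simp: adj_sym)
  ultimately have "odd (length ?l)" using icycle_cases[OF ear_icycle[OF ear i]] by blast
  then show ?thesis using i1 by simp
qed

text \<open>The cycle runs along the ear to \<open>xs ! 1\<close> and on around \<open>xs\<close>
  back to \<open>xs ! 0\<close>. It has no chord at the first vertex of the ear, which sees only its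
  successor in the ear and \<open>xs ! 0\<close>.\<close>

lemma ear_digon_long:
  assumes ear: "ear xs ps" and "2 \<le> length ps" and l: "adj A (last ps) (xs ! 1)"
    and digon: "\<And>x y. x \<in> set xs \<Longrightarrow> y \<in> set xs \<Longrightarrow> adj A x y \<Longrightarrow> (x, y) \<in> A"
  shows "odd (length xs + length ps)"
proof -
  note e = ear_facts[OF ear] and st = ear_start_adj[OF ear]
  obtain p q rs where ps: "ps = p # q # rs" using assms(2) by (cases ps; cases "tl ps") auto
  obtain u ys where xs: "xs = u # ys" "ys \<noteq> []" using e(2) by (cases xs; cases "tl xs") auto
  let ?ps = "q # rs @ ys @ [u]"
  have set_eq: "set (p # ?ps) = set xs \<union> set ps" by (auto simp: xs ps)
  have "thin A (set (p # ?ps)) \<or> odd (Suc (length ?ps)) \<and> alike A p (hd ?ps) (last ?ps)"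
  proof (rule cycle_cases)
    have "hd ys = xs ! 1" using xs by (simp add: hd_conv_nth)
    moreover have "successively (adj A) ys" using e(12) xs by (cases ys) auto
    moreover have "last ys = xs ! (length xs - 1)" using xs by (simp add: last_conv_nth)
    ultimately have "successively (adj A) (ps @ ys @ [u])"
      unfolding successively_append_iff
      using e(13) l xs st(2) by (auto simp: adj_sym)
    then have "successively (adj A) (p # ?ps)" by (simp add: ps)
    moreover have "adj A (last (p # ?ps)) p" using st(3) by (simp add: ps xs)
    ultimately show "ucycle A (p # ?ps)"
      using e(5,7,8) unfolding ucycle_def xs(1) ps by auto
    show "set (p # ?ps) \<subseteq> K" unfolding set_eq using e(3,6) by simp
    fix w assume w: "w \<in> set ?ps" "adj A p w"
    show "w = hd ?ps \<or> w = last ?ps"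
    proof (cases "w \<in> set ps")
      case True
      then obtain a where a: "a < length ps" "w = ps ! a" by (auto simp: in_set_conv_nth)
      have "a \<noteq> 0"
      proof
        assume "a = 0"
        then have "w = p" using a by (simp add: ps)
        then show False using w(2) irr by (auto simp: adj_iff irrefl_def)
      qed
      then have "a = 1" using e(9)[of 0 a] a w(2) by (auto simp: ps)
      then show ?thesis using a by (simp add: ps)
    next
      case False
      then have "w \<in> set xs" using w(1) by (auto simp: xs ps)
      then obtain b where b: "b < length xs" "w = xs ! b" by (auto simp: in_set_conv_nth)
      have "b = 0" using e(11)[of 0 b] b w(2) by (cases "b = 0") (auto simp: ps)
      then show ?thesis using b by (simp add: xs)
    qed
  qed
  moreover have "\<not> thin A (set (p # ?ps))"
  proof
    assume t: "thin A (set (p # ?ps))"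
    have mem: "xs ! 0 \<in> set xs" "xs ! 1 \<in> set xs" using e(2,17) by auto
    show False
      using thin_digon[OF t, of "xs ! 0" "xs ! 1" "ps ! 0"] unfolding set_eq
      using mem e(15) st digon[OF mem] digon[OF mem(2,1)] by (auto simp: adj_sym)
  qed
  ultimately show ?thesis by (auto simp: xs ps)
qed

text \<open>The ear vertex and \<open>xs ! 0\<close> with its two neighbors on \<open>xs\<close>
  form a 4-cycle without a chord at \<open>xs ! 1\<close>. Being even it has to be thin, against the
  symmetric edges at \<open>xs ! 0\<close>.\<close>

lemma ear_digon_short:
  assumes ear: "ear xs ps" and l: "length ps = 1" "adj A (last ps) (xs ! 1)" "adj A (last ps) (xs ! (length xs - 1))"
    and digon: "\<And>x y. x \<in> set xs \<Longrightarrow> y \<in> set xs \<Longrightarrow> adj A x y \<Longrightarrow> (x, y) \<in> A"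
  shows False
proof -
  note e = ear_facts[OF ear] and st = ear_start_adj[OF ear]
  define q a u b where "q = ps ! 0" and "a = xs ! 1" and "u = xs ! 0" and "b = xs ! (length xs - 1)"
  have ps: "last ps = q" using l(1) e(4) by (simp add: last_conv_nth q_def)
  have mem: "a \<in> set xs" "u \<in> set xs" "b \<in> set xs" using e(2,17) by (auto simp: a_def u_def b_def)
  have q: "q \<notin> set xs" "q \<in> K" using e(6,7,15) by (auto simp: q_def)
  have ne: "a \<noteq> b" "a \<noteq> u" "u \<noteq> b"
    using st(4) nth_eq_iff_index_eq[OF e(8), of 1 0] nth_eq_iff_index_eq[OF e(8), of 0 "length xs - 1"] e(2,17)
    by (auto simp: a_def b_def u_def)
  have nab: "\<not> adj A a b"
    using icycle_adj(1)[OF e(1), of 1 "length xs - 1"] e(2) by (auto simp: a_def b_def)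
  have adjs: "adj A a u" "adj A u b" "adj A b q" "adj A q a"
    using st l ps by (auto simp: a_def b_def u_def adj_sym)
  have "thin A (set (a # [u, b, q])) \<or> odd (Suc (length [u, b, q])) \<and> alike A a (hd [u, b, q]) (last [u, b, q])"
    by (rule cycle_cases) (use adjs ne nab q mem e(3) in \<open>auto simp: ucycle_def\<close>)
  then have t: "thin A (set [a, u, b, q])" by simp
  have "(u, a) \<in> A" "(a, u) \<in> A" using digon mem adjs by (auto simp: adj_sym)
  then show False using thin_digon[OF t, of u a b] ne adjs by auto
qed

lemma first_nbr_exists:
  assumes "1 \<le> b" "b < length xs" "adj A (last ps) (xs ! b)"
  obtains i where "first_nbr xs ps i" "i \<le> b"
proof -
  let ?P = "\<lambda>b. 1 \<le> b \<and> b < length xs \<and> adj A (last ps) (xs ! b)"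
  define i where "i = (LEAST b. ?P b)"
  have P: "?P i" unfolding i_def using assms by (intro LeastI[of ?P b]) simp
  have le: "i \<le> b" unfolding i_def using assms by (intro Least_le) simp
  have least: "\<not> ?P c" if "c < i" for c using not_less_Least[of c ?P] that unfolding i_def by blast
  have "first_nbr xs ps i"
    unfolding first_nbr_def
  proof (intro conjI allI impI)
    show "\<not> adj A (last ps) (xs ! c)" if "1 \<le> c" "c < i" for c using least[of c] P that by simp
  qed (use P in auto)
  then show thesis using that le by blast
qed

text \<open>If \<open>xs\<close> is thin, its two directions prescribe opposite directions for the
  first edge of the ear. Otherwise \<open>xs\<close> is odd with symmetric edges, and the parities
  of the cycles through the ear exclude all cases; only a single vertex adjacent to both neighbors
  of \<open>xs ! 0\<close> calls for the 4-cycle.\<close>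

lemma no_ear:
  assumes ear: "ear xs ps" and b: "1 \<le> b" "b < length xs" "adj A (last ps) (xs ! b)"
  shows False
proof -
  note e = ear_facts[OF ear] and st = ear_start_adj[OF ear]
  let ?n = "length xs"
  have n: "xs \<noteq> []" using e(2) by auto
  note ear' = ear_mirror[OF ear]
  have set': "set (mirror xs) = set xs" and len': "length (mirror xs) = ?n"
    using n set_mirror length_mirror by auto
  have mir: "mirror xs ! b = xs ! (?n - b)" if "1 \<le> b" "b < ?n" for b
    using mirror_nth[of b xs] that by simp
  have mir0: "mirror xs ! 0 = xs ! 0" using mirror_nth[of 0 xs] n by simp
  obtain i where i: "first_nbr xs ps i" "i \<le> b" using first_nbr_exists[OF b] by blast
  have i1: "1 \<le> i" "i < ?n" "adj A (last ps) (xs ! i)" using i by (auto simp: first_nbr_def)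
  have "adj A (last ps) (mirror xs ! (?n - i))" using mir[of "?n - i"] i1 by simp
  moreover have "1 \<le> ?n - i" "?n - i < length (mirror xs)" using i1 len' by auto
  ultimately obtain j where j: "first_nbr (mirror xs) ps j" "j \<le> ?n - i"
    using first_nbr_exists by blast
  have j1: "1 \<le> j" "j < ?n" using j len' by (auto simp: first_nbr_def)
  have adj_j: "adj A (last ps) (xs ! (?n - j))" using j mir[OF j1] by (simp add: first_nbr_def)
  have mir1: "mirror xs ! 1 = xs ! (?n - 1)" "mirror xs ! (?n - 1) = xs ! 1"
    using mir[of 1] mir[of "?n - 1"] e(2) by auto
  have thin_case: False if thin: "thin A (set xs)"
  proof -
    have nl: "Suc (Suc i) \<le> ?n" if ear: "ear xs ps" and i: "first_nbr xs ps i" and thin: "thin A (set xs)" and n4: "4 \<le> length xs" and n: "length xs = ?n"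
      for xs i
    proof (rule ccontr)
      assume "\<not> Suc (Suc i) \<le> ?n"
      then have "i = length xs - 1" using i n by (auto simp: first_nbr_def)
      then have al: "alike A (xs ! 1) (xs ! 2) (xs ! 0)" using ear_last(2)[OF ear] i by simp
      have ic: "icycle A xs" using ear by (simp add: ear_def)
      have "adj A (xs ! 1) (xs ! 2)" using icycle_adj(1)[OF ic, of 1 2] n4 by simp
      moreover have "xs ! 2 \<noteq> xs ! 0"
        using ear_facts(8)[OF ear] n4 nth_eq_iff_index_eq[of xs 2 0] by (cases "xs = []") auto
      moreover have "xs ! 0 \<in> set xs" "xs ! 1 \<in> set xs" "xs ! 2 \<in> set xs"
        using n4 by (auto intro!: nth_mem)
      ultimately show False using thin_not_alike[OF thin, of "xs ! 1" "xs ! 2" "xs ! 0"] al by blast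
    qed
    have i2: "Suc (Suc i) \<le> ?n" by (rule nl[OF ear i(1) thin e(2) refl])
    have j2: "Suc (Suc j) \<le> length (mirror xs)"
      using nl[OF ear' j(1)] thin set' e(2) len' by simp
    note 1 = ear_thin[OF ear i(1) i2 thin]
    have thin': "thin A (set (mirror xs))" using thin set' by simp
    note 2 = ear_thin[OF ear' j(1) j2 thin', unfolded mir0 mir1]
    have mem: "xs ! 0 \<in> set xs" "xs ! 1 \<in> set xs" "xs ! (?n - 1) \<in> set xs" using e(2,17) by auto
    show False
      using 1 2 thin_out[OF thin mem] thin_in[OF thin mem] st(1,2,4) by (auto simp: adj_iff)
  qed
  have "\<not> thin A (set xs)" using thin_case by blast
  then have oddn: "odd ?n" and dig: "\<And>x y. x \<in> set xs \<Longrightarrow> y \<in> set xs \<Longrightarrow> adj A x y \<Longrightarrow> (x, y) \<in> A"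
    using icycle_cases[OF e(1,3)] by blast+
  have dig': "\<And>x y. x \<in> set (mirror xs) \<Longrightarrow> y \<in> set (mirror xs) \<Longrightarrow> adj A x y \<Longrightarrow> (x, y) \<in> A"
    using dig set' by simp
  \<comment> \<open>Two cycle lengths would be odd although their sum
    \<open>?n + 2 * length ps + 2\<close> is odd.\<close>
  have i_end: "i = 1 \<or> i = ?n - 1"
  proof (rule ccontr)
    assume "\<not> ?thesis"
    then have i2: "2 \<le> i" "Suc (Suc i) \<le> ?n" using i1 by auto
    have "odd (Suc i + length ps)" by (rule ear_digon_mid[OF ear i(1) i2(2) dig])
    moreover have "odd (Suc (length ps + (?n - i)))" by (rule ear_second_cycle[OF ear i(1) i2(1) dig])
    ultimately show False using oddn i1 by auto
  qed
  have j_end: "j = 1 \<or> j = ?n - 1"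
  proof (rule ccontr)
    assume "\<not> ?thesis"
    then have j2: "2 \<le> j" "Suc (Suc j) \<le> length (mirror xs)" using j1 len' by auto
    have "odd (Suc j + length ps)" by (rule ear_digon_mid[OF ear' j(1) j2(2) dig'])
    moreover have "odd (Suc (length ps + (length (mirror xs) - j)))" by (rule ear_second_cycle[OF ear' j(1) j2(1) dig'])
    ultimately show False using oddn j1 len' by auto
  qed
  show False
  proof (cases "i = ?n - 1")
    case True
    then have "j = 1" using j(2) j1 by simp
    have "odd (?n + length ps)" using ear_last(1)[OF ear] i(1) True by simp
    moreover have "odd (Suc j + length ps)"
      using ear_digon_mid[OF ear' j(1) _ dig'] \<open>j = 1\<close> len' e(2) by simp
    ultimately show False using oddn \<open>j = 1\<close> by simp
  next
    case False
    then have "i = 1" using i_end by simp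
    have o: "odd (Suc i + length ps)"
      using ear_digon_mid[OF ear i(1) _ dig] \<open>i = 1\<close> e(2) by simp
    show False
    proof (cases "j = ?n - 1")
      case True
      have "odd (length (mirror xs) + length ps)" using ear_last(1)[OF ear'] j(1) True len' by simp
      then show False using o oddn len' \<open>i = 1\<close> by simp
    next
      case False
      then have "j = 1" using j_end by simp
      then have l2: "adj A (last ps) (xs ! (?n - 1))" using adj_j by simp
      have l1: "adj A (last ps) (xs ! 1)" using i1 \<open>i = 1\<close> by simp
      show False
      proof (cases "length ps = 1")
        case True
        then show False using ear_digon_short[OF ear _ l1 l2 dig] by simp
      next
        case False
        moreover have "length ps \<noteq> 0" using e(4) by simp
        ultimately have "2 \<le> length ps" by linarith
        then show False using ear_digon_long[OF ear _ l1 dig] o \<open>i = 1\<close> oddn by simp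
      qed
    qed
  qed
qed

text \<open>Some edge leaves the cycle at a vertex \<open>u\<close>, and by biconnectedness there is
  a way back that avoids \<open>u\<close>. With the cycle rotated to start at \<open>u\<close>, a
  geodesic outside of it from neighbors of \<open>u\<close> to neighbors of other cycle vertices is
  an ear.\<close>

lemma ear_exists:
  assumes bic: "biconnected A K" and ic: "icycle A xs0" "4 \<le> length xs0" "set xs0 \<subseteq> K" and p: "p \<in> K" "p \<notin> set xs0"
  shows "\<exists>xs ps b. ear xs ps \<and> 1 \<le> b \<and> b < length xs \<and> adj A (last ps) (xs ! b)"
proof -
  let ?C = "set xs0"
  have ne: "xs0 \<noteq> []" using ic(2) by auto
  have "(xs0 ! 0, p) \<in> (Restr (underlying A) K)\<^sup>*"
  proof -
    have "connected_in A K" using bic by (simp add: biconnected_def)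
    moreover have "xs0 ! 0 \<in> K" using ne ic(3) nth_mem by blast
    ultimately show ?thesis using p unfolding connected_in_def by blast
  qed
  moreover have "xs0 ! 0 \<in> ?C" using ne by simp
  ultimately have "\<exists>u\<in>?C. \<exists>q\<in>K - ?C. adj A u q"
    using p(2)
  proof (induction rule: rtrancl_induct)
    case (step y z)
    then show ?case by (cases "y \<in> ?C") auto
  qed simp
  then obtain u q where uq: "u \<in> ?C" "q \<in> K" "q \<notin> ?C" "adj A u q" by blast
  obtain t where t: "t < length xs0" "u = xs0 ! t" using uq(1) by (auto simp: in_set_conv_nth)
  define xs where "xs = rotate t xs0"
  have xs: "icycle A xs" "4 \<le> length xs" "set xs = ?C" "distinct xs" "xs \<noteq> []"
    using icycle_rotate[OF ic(1)] ic(2) ne by (auto simp: xs_def icycle_def)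
  have u0: "xs ! 0 = u" using t ne by (simp add: xs_def nth_rotate)
  let ?J = "{w \<in> K - ?C. \<exists>z\<in>?C - {u}. adj A w z}" and ?I = "{w \<in> K - ?C. adj A w u}"
  have x1: "xs ! 1 \<in> ?C" "xs ! 1 \<noteq> u"
    using xs nth_mem[of 1 xs] nth_eq_iff_index_eq[OF xs(4), of 1 0] u0 by auto
  have "(q, xs ! 1) \<in> (Restr (underlying A) (K - {u}))\<^sup>*"
  proof -
    have "connected_in A (K - {u})" using bic ic(3) uq(1) by (auto simp: biconnected_def)
    moreover have "q \<in> K - {u}" "xs ! 1 \<in> K - {u}" using uq x1 ic(3) by auto
    ultimately show ?thesis unfolding connected_in_def by blast
  qed
  from rtrancl_walk[OF this] uq obtain w where w: "w \<noteq> []" "hd w = q" "last w = xs ! 1" "set w \<subseteq> K - {u}"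
    "successively (adj A) w" by blast
  let ?w = "takeWhile (\<lambda>x. x \<notin> ?C) w" and ?d = "dropWhile (\<lambda>x. x \<notin> ?C) w"
  have wd: "w = ?w @ ?d" by simp
  have "?w \<noteq> []" using w(1,2) uq(3) by (cases w) auto
  have "?d \<noteq> []"
  proof
    assume "?d = []"
    then have "last w \<notin> ?C" using w(1) by (auto simp: dropWhile_eq_Nil_conv)
    then show False using x1 w(3) by simp
  qed
  have hd_d: "hd ?d \<in> ?C" using hd_dropWhile[OF \<open>?d \<noteq> []\<close>] by simp
  have sub_w: "set ?w \<subseteq> K - ?C" using w(4) by (auto dest: set_takeWhileD)
  have "hd ?d \<in> set w" using \<open>?d \<noteq> []\<close> by (metis hd_in_set set_dropWhileD)
  then have "hd ?d \<noteq> u" using w(4) by blast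
  have "successively (adj A) (?w @ ?d)" using w(5) by simp
  then have suc: "successively (adj A) ?w" "adj A (last ?w) (hd ?d)"
    unfolding successively_append_iff using \<open>?w \<noteq> []\<close> \<open>?d \<noteq> []\<close> by auto
  have lJ: "last ?w \<in> ?J" using sub_w \<open>?w \<noteq> []\<close> suc(2) hd_d \<open>hd ?d \<noteq> u\<close> last_in_set by blast
  have "hd ?w = q" using w(2) \<open>?w \<noteq> []\<close> by (metis hd_append2 wd)
  then have hI: "hd ?w \<in> ?I" using uq by (simp add: adj_sym)
  obtain ps where "geodesic A ?I ?J (K - ?C) ps"
    by (rule geodesic_exists[OF \<open>?w \<noteq> []\<close> hI lJ sub_w suc(1)])
  note ps = geodesicD[OF this]
  have mem: "ps ! a \<in> K - ?C" if "a < length ps" for a using ps(4) that nth_mem by blast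
  have "ear xs ps"
    unfolding ear_def
  proof (intro conjI allI impI)
    show "adj A (ps ! a) (xs ! 0) \<longleftrightarrow> a = 0" if "a < length ps" for a
      using ps(1,2) ps(7)[of a] mem[OF that] that by (auto simp: u0 hd_conv_nth)
    show "\<not> adj A (ps ! a) (xs ! b)" if "Suc a < length ps" "1 \<le> b" "b < length xs" for a b
    proof -
      have "xs ! b \<in> ?C" using that xs(3) nth_mem by blast
      moreover have "xs ! b \<noteq> u" using nth_eq_iff_index_eq[OF xs(4), of b 0] that u0 xs(5) by auto
      moreover have "ps ! a \<in> K - ?C" using mem[of a] that by simp
      ultimately show ?thesis using ps(8)[OF that(1)] by blast
    qed
  qed (use xs ps ic(3) in auto)
  moreover obtain z where "z \<in> ?C - {u}" "adj A (last ps) z" using ps(3) by blast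
  moreover from this obtain b where "b < length xs" "z = xs ! b" unfolding xs(3)[symmetric] by (auto simp: in_set_conv_nth)
  ultimately show ?thesis using u0 by (intro exI[of _ xs] exI[of _ ps] exI[of _ b]) (cases b; auto)
qed

text \<open>A triangle has no chords at any vertex. So a single arc forms a directed triangle with
  every further vertex, as otherwise alikeness at all vertices would make the arc symmetric. Applied
  to two arcs, this leaves no room for a fourth vertex.\<close>

lemma complete_cases:
  assumes complete: "\<And>x y. x \<in> K \<Longrightarrow> y \<in> K \<Longrightarrow> x \<noteq> y \<Longrightarrow> adj A x y" and "finite K"
  shows "induces_dicycle A K \<or> induces_complete A K \<or> (\<exists>u v. K = {u, v})"
proof (cases "\<exists>a\<in>K. \<exists>b\<in>K. (a, b) \<in> A \<and> (b, a) \<notin> A")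
  case False
  have "Restr A K = symmetrization (complete_edges K)"
  proof (intro set_eqI iffI)
    fix e assume e: "e \<in> Restr A K"
    then show "e \<in> symmetrization (complete_edges K)"
      using irr by (cases e) (auto simp: symmetrization_def complete_edges_def irrefl_def card_insert_if)
  next
    fix e assume "e \<in> symmetrization (complete_edges K)"
    then obtain x y where "e = (x, y)" "x \<in> K" "y \<in> K" "x \<noteq> y"
      by (cases e) (auto simp: symmetrization_def complete_edges_def card_insert_if split: if_splits)
    then show "e \<in> Restr A K" using complete[of x y] False by (auto simp: adj_iff)
  qed
  then show ?thesis using \<open>finite K\<close> by (simp add: induces_complete_def)
next
  case True
  have tri: "(b, c) \<in> A \<and> (c, a) \<in> A \<and> (a, c) \<notin> A \<and> (c, b) \<notin> A"
    if K: "a \<in> K" "b \<in> K" "c \<in> K" and ab: "(a, b) \<in> A" "(b, a) \<notin> A" and c: "c \<noteq> a" "c \<noteq> b" for a b c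
  proof -
    have "a \<noteq> b" using ab by auto
    have adjs: "adj A a b" "adj A b c" "adj A c a" using complete K c \<open>a \<noteq> b\<close> by auto
    have t: "thin A (set [a, b, c]) \<or> alike A a b c" "thin A (set [b, c, a]) \<or> alike A b c a"
      using cycle_cases[of a "[b, c]"] cycle_cases[of b "[c, a]"] K adjs \<open>a \<noteq> b\<close> c by (auto simp: ucycle_def)
    have "thin A {a, b, c}"
    proof (rule ccontr)
      assume nt: "\<not> thin A {a, b, c}"
      then have "alike A a b c" "alike A b c a" using t by (auto simp: insert_commute)
      moreover have "thin A (set [c, a, b]) \<or> alike A c a b"
        using cycle_cases[of c "[a, b]"] K adjs \<open>a \<noteq> b\<close> c by (auto simp: ucycle_def)
      ultimately show False using nt ab adjs by (auto simp: alike_def adj_iff insert_commute)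
    qed
    note th = thin_out[OF this] thin_in[OF this]
    have "(a, c) \<notin> A" using th(1)[of a b c] ab c by auto
    moreover have "(c, b) \<notin> A" using th(2)[of b a c] ab c by auto
    ultimately show ?thesis using adjs by (auto simp: adj_iff)
  qed
  obtain a b where ab: "a \<in> K" "b \<in> K" "(a, b) \<in> A" "(b, a) \<notin> A" using True by blast
  then have "a \<noteq> b" by auto
  show ?thesis
  proof (cases "\<exists>c\<in>K. c \<noteq> a \<and> c \<noteq> b")
    case False
    then show ?thesis using ab by blast
  next
    case True
    then obtain c where c: "c \<in> K" "c \<noteq> a" "c \<noteq> b" by blast
    note 1 = tri[OF ab(1,2) c(1) ab(3,4) c(2,3)]
    have "d = c" if d: "d \<in> K" "d \<noteq> a" "d \<noteq> b" for d
    proof (rule ccontr)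
      assume "d \<noteq> c"
      have "(b, d) \<in> A" "(d, b) \<notin> A" using tri[OF ab(1,2) d(1) ab(3,4) d(2,3)] by auto
      moreover have "(d, b) \<in> A" using tri[OF ab(2) c(1) d(1) _ _ d(3) \<open>d \<noteq> c\<close>] 1 by auto
      ultimately show False by simp
    qed
    then have K: "K = {a, b, c}" using ab(1,2) c(1) by blast
    have loops: "(a, a) \<notin> A" "(b, b) \<notin> A" "(c, c) \<notin> A" using irr by (auto simp: irrefl_def)
    have "cycle_arcs [a, b, c] = {(a, b), (b, c), (c, a)}"
    proof -
      have "{i. i < length [a, b, c]} = {0, 1, 2}" by auto
      then have "cycle_arcs [a, b, c] = (\<lambda>i. ([a, b, c] ! i, [a, b, c] ! (Suc i mod length [a, b, c]))) ` {0, 1, 2}"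
        unfolding cycle_arcs_def by blast
      then show ?thesis by (simp add: numeral_2_eq_2)
    qed
    moreover have "Restr A K = {(a, b), (b, c), (c, a)}" unfolding K using 1 ab loops by auto
    ultimately have "induces_dicycle A K"
      unfolding induces_dicycle_def using \<open>a \<noteq> b\<close> c K by (intro exI[of _ "[a, b, c]"]) auto
    then show ?thesis by simp
  qed
qed

text \<open>Pairs are a case of their own: one joined by a single arc is of none of the three kinds
  and contains no cycle that could be a violator.\<close>

theorem biconnected_cases:
  assumes bic: "biconnected A K" and fin: "\<And>x. x \<in> K \<Longrightarrow> finite {y. adj A x y}"
  shows "induces_dicycle A K \<or> induces_odd_cycle A K \<or> induces_complete A K \<or> (\<exists>u v. K = {u, v})"
proof (cases "\<exists>x\<in>K. \<exists>z\<in>K. x \<noteq> z \<and> \<not> adj A x z")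
  case True
  then obtain xs where xs: "icycle A xs" "4 \<le> length xs" "set xs \<subseteq> K" using long_icycle[OF bic] by blast
  have K: "set xs = K"
  proof (rule ccontr)
    assume "set xs \<noteq> K"
    then obtain p where "p \<in> K" "p \<notin> set xs" using xs(3) by blast
    then show False using ear_exists[OF bic xs] no_ear by blast
  qed
  from icycle_cases[OF xs(1,3)] show ?thesis
  proof
    assume "thin A (set xs)"
    then show ?thesis using icycle_thin_dicycle[OF xs(1)] K by simp
  next
    assume "odd (length xs) \<and> (\<forall>x\<in>set xs. \<forall>y\<in>set xs. adj A x y \<longrightarrow> (x, y) \<in> A)"
    then show ?thesis using icycle_odd_cycle[OF xs(1) irr] K by simp
  qed
next
  case False
  then have complete: "adj A x y" if "x \<in> K" "y \<in> K" "x \<noteq> y" for x y using that by blast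
  obtain x where "x \<in> K" using bic by (auto simp: biconnected_def)
  then have "K \<subseteq> insert x {y. adj A x y}" using complete by blast
  then have "finite K" using fin[OF \<open>x \<in> K\<close>] by (metis finite_insert finite_subset)
  then show ?thesis using complete_cases[OF complete] by blast
qed

end

section \<open>Cycles as biconnected sets\<close>

lemma path_connected_in:
  assumes "successively (adj A) ws" shows "connected_in A (set ws)"
proof -
  have "\<forall>x\<in>set ws. (hd ws, x) \<in> (Restr (underlying A) (set ws))\<^sup>*"
    using assms
  proof (induction ws rule: rev_induct)
    case (snoc y ws)
    show ?case
    proof (cases "ws = []")
      case False
      have mono: "(Restr (underlying A) (set ws))\<^sup>* \<subseteq> (Restr (underlying A) (set (ws @ [y])))\<^sup>*"
        by (rule rtrancl_mono) auto
      have IH: "\<forall>x\<in>set ws. (hd ws, x) \<in> (Restr (underlying A) (set (ws @ [y])))\<^sup>*"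
        using snoc mono by (auto simp: successively_append_iff)
      moreover have "(last ws, y) \<in> Restr (underlying A) (set (ws @ [y]))"
        using snoc.prems False by (auto simp: successively_append_iff)
      ultimately show ?thesis using False by (auto intro: rtrancl_into_rtrancl[of _ "last ws"])
    qed simp
  qed simp
  moreover have "sym ((Restr (underlying A) (set ws))\<^sup>*)"
    by (intro sym_rtrancl symI) (auto simp: underlying_def)
  ultimately show ?thesis unfolding connected_in_def by (meson rtrancl_trans symD)
qed

lemma ucycle_biconnected:
  assumes "ucycle A xs" shows "biconnected A (set xs)"
proof -
  have xs: "distinct xs" "successively (adj A) xs" "adj A (last xs) (hd xs)" "3 \<le> length xs"
    using assms by (auto simp: ucycle_def)
  obtain x y zs where "xs = x # y # zs" using xs(4) by (cases xs; cases "tl xs") auto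
  then have "\<exists>x\<in>set xs. \<exists>y\<in>set xs. x \<noteq> y" using xs(1) by auto
  moreover have "connected_in A (set xs - {s})" if "s \<in> set xs" for s
  proof -
    obtain a b where ab: "xs = a @ s # b" using split_list[OF \<open>s \<in> set xs\<close>] by blast
    have "successively (adj A) (b @ a)"
      using xs(2,3) unfolding ab by (cases "a = []"; cases "b = []") (auto simp: successively_append_iff successively_Cons)
    then have "connected_in A (set (b @ a))" by (rule path_connected_in)
    moreover have "set (b @ a) = set xs - {s}" using xs(1) unfolding ab by auto
    ultimately show ?thesis by simp
  qed
  ultimately show ?thesis using path_connected_in[OF xs(2)] by (simp add: biconnected_def)
qed

text \<open>A dicycle through the arc provides a second connection of its ends, and a shortest one
  closes up with the arc to a cycle of length at least 3. Thus a pair joined by a single arc on a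
  dicycle is not a maximal biconnected set.\<close>

lemma arc_in_dicycle_biconnected:
  assumes uv: "(u, v) \<in> R" "(v, u) \<notin> R" "(v, u) \<in> R\<^sup>*" "R \<subseteq> C \<times> C"
  obtains T where "{u, v} \<subseteq> T" "T \<noteq> {u, v}" "T \<subseteq> C" "biconnected R T"
proof -
  \<comment> \<open>Without the arcs that leave \<open>u\<close>, the return walk survives up to its
    first visit to \<open>u\<close>, but the arc \<open>(u, v)\<close> is gone.\<close>
  let ?R = "R - {u} \<times> UNIV"
  have "(v, w) \<in> ?R\<^sup>* \<or> (v, u) \<in> ?R\<^sup>*" if "(v, w) \<in> R\<^sup>*" for w
    using that
  proof induction
    case (step y z)
    then show ?case by (cases "y = u") (auto intro: rtrancl_into_rtrancl)
  qed simp
  from this[OF uv(3)] have "(v, u) \<in> ?R\<^sup>*" by simp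
  moreover have "?R\<^sup>* \<subseteq> (Restr (underlying ?R) UNIV)\<^sup>*" by (rule rtrancl_mono) (auto simp: underlying_def)
  ultimately have "(v, u) \<in> (Restr (underlying ?R) UNIV)\<^sup>*" by (rule subsetD[rotated])
  from rtrancl_walk[OF this] obtain w where w: "w \<noteq> []" "hd w \<in> {v}" "last w \<in> {u}" "set w \<subseteq> UNIV"
    "successively (adj ?R) w" by auto
  obtain ws where "geodesic ?R {v} {u} UNIV ws" using geodesic_exists[OF w] by blast
  note ws = geodesicD[OF this]
  have "u \<noteq> v" using uv by auto
  have hl: "ws ! 0 = v" "ws ! (length ws - 1) = u" using ws(1-3) by (auto simp: hd_conv_nth last_conv_nth)
  have n: "3 \<le> length ws"
  proof (rule ccontr)
    assume "\<not> 3 \<le> length ws"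
    then consider "length ws = 1" | "length ws = 2" using ws(1) by (cases "length ws") (auto simp: not_le, linarith)
    then show False
    proof cases
      case 1
      then show False using hl \<open>u \<noteq> v\<close> by auto
    next
      case 2
      then have "adj ?R v u" using ws(6)[of 0 1] hl by auto
      then show False using uv by (auto simp: adj_iff)
    qed
  qed
  have suc: "successively (adj R) ws"
    using ws(6) by (auto simp: successively_conv_nth underlying_def)
  have "adj R (last ws) (hd ws)" using uv(1) ws(2,3) by (auto simp: adj_iff)
  then have cyc: "ucycle R ws" using n ws(5) suc by (simp add: ucycle_def)
  have "card (set ws) = length ws" using ws(5) by (rule distinct_card)
  then have "set ws \<noteq> {u, v}" using n \<open>u \<noteq> v\<close> by auto
  moreover have "{u, v} \<subseteq> set ws" using ws(1-3) by auto
  moreover have "set ws \<subseteq> C"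
  proof
    fix x assume "x \<in> set ws"
    have "(x, u) \<in> (Restr (underlying R) (set ws))\<^sup>*"
      using path_connected_in[OF suc] \<open>x \<in> set ws\<close> \<open>{u, v} \<subseteq> set ws\<close> by (auto simp: connected_in_def)
    then have "x = u \<or> (\<exists>y. (x, y) \<in> underlying R)" by (cases rule: converse_rtranclE) auto
    then show "x \<in> C" using uv(1,4) by (auto simp: underlying_def)
  qed
  ultimately show thesis by (intro that[of "set ws"] ucycle_biconnected[OF cyc])
qed


section \<open>Borel enumerations of finite lists\<close>

lemma pred_cong_space:
  assumes "Measurable.pred X P" "\<And>x. x \<in> space X \<Longrightarrow> P x \<longleftrightarrow> Q x"
  shows "Measurable.pred X Q"
  using assms(1) measurable_cong[of X P Q "count_space UNIV"] assms(2) by blast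

lemma Polish_base:
  assumes "Polish_space T"
  obtains U :: "nat \<Rightarrow> 'b set" where "\<And>n. openin T (U n)"
    "\<And>W y. openin T W \<Longrightarrow> y \<in> W \<Longrightarrow> \<exists>n. y \<in> U n \<and> U n \<subseteq> W"
    "\<And>y z. y \<in> topspace T \<Longrightarrow> y \<noteq> z \<Longrightarrow> \<exists>n. y \<in> U n \<and> z \<notin> U n"
proof -
  obtain M d where "Metric_space M d" and T: "T = Metric_space.mtopology M d"
    using assms unfolding Polish_space_def completely_metrizable_space_def by blast
  then interpret Metric_space M d by simp
  have top: "topspace T = M" using T by simp
  obtain D where D: "countable D" "D \<subseteq> M" "T closure_of D = M"
    using assms top unfolding Polish_space_def separable_space_def by blast
  \<comment> \<open>The empty set keeps the family nonempty, and thus enumerable by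
    \<open>nat\<close>, when the space is empty.\<close>
  let ?\<B> = "insert {} ((\<lambda>(x, k). mball x (1 / real (Suc k))) ` (D \<times> UNIV))"
  define U where "U = from_nat_into ?\<B>"
  have rng: "range U = ?\<B>" unfolding U_def by (intro range_from_nat_into) (use D(1) in auto)
  have opn: "openin T (U n)" for n
  proof -
    have "U n \<in> ?\<B>" using rng by blast
    then show ?thesis by (auto simp: T)
  qed
  have base: "\<exists>n. y \<in> U n \<and> U n \<subseteq> W" if W: "openin T W" "y \<in> W" for W y
  proof -
    obtain r where r: "0 < r" "mball y r \<subseteq> W" using W unfolding T openin_mtopology by blast
    have yM: "y \<in> M" using W openin_subset top by blast
    obtain k where k: "1 / real (Suc k) < r / 2" using nat_approx_posE[of "r / 2"] r(1) by auto
    have "y \<in> T closure_of D" using yM D by simp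
    then have "\<exists>x\<in>D. x \<in> mball y (1 / real (Suc k))"
      unfolding T metric_closure_of by (auto dest!: spec[of _ "1 / real (Suc k)"])
    then obtain x where x: "x \<in> D" "d y x < 1 / real (Suc k)" by auto
    have xM: "x \<in> M" using x D by auto
    have "mball x (1 / real (Suc k)) \<subseteq> mball y r"
    proof
      fix z assume "z \<in> mball x (1 / real (Suc k))"
      then show "z \<in> mball y r" using triangle[OF yM xM, of z] x k yM by auto
    qed
    moreover have "y \<in> mball x (1 / real (Suc k))" using x xM yM commute[of x y] by simp
    moreover have "mball x (1 / real (Suc k)) \<in> range U" unfolding rng using x(1) by auto
    ultimately show ?thesis using r(2) by (metis (no_types, lifting) order_trans rangeE)
  qed
  have "\<exists>n. y \<in> U n \<and> z \<notin> U n" if "y \<in> topspace T" "y \<noteq> z" for y z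
  proof (cases "z \<in> M")
    case True
    have "openin T (mball y (d y z))" by (simp add: T)
    moreover have "y \<in> mball y (d y z)" using that True top by simp
    ultimately obtain n where "y \<in> U n" "U n \<subseteq> mball y (d y z)" using base by blast
    then show ?thesis by auto
  next
    case False
    have "openin T M" using top openin_topspace by metis
    moreover have "y \<in> M" using that top by simp
    ultimately obtain n where "y \<in> U n" "U n \<subseteq> M" using base[of M y] by blast
    then show ?thesis using False by auto
  qed
  then show thesis by (intro that[of U] opn base)
qed

lemma sets_borel_of: "sets (borel_of T) = sigma_sets (topspace T) {U. openin T U}"
  and space_borel_of: "space (borel_of T) = topspace T"
  unfolding borel_of_def using openin_subset by (auto simp: space_measure_of_conv intro!: sets_measure_of)

lemma openin_sets_borel_of: "openin T U \<Longrightarrow> U \<in> sets (borel_of T)"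
  by (simp add: sets_borel_of sigma_sets.Basic)

lemma measurable_borel_ofI:
  assumes "\<And>x. x \<in> space X \<Longrightarrow> f x \<in> topspace T"
    and "\<And>U. openin T U \<Longrightarrow> {x \<in> space X. f x \<in> U} \<in> sets X"
  shows "f \<in> measurable X (borel_of T)"
  unfolding borel_of_def
proof (rule measurable_measure_of)
  show "{U. openin T U} \<subseteq> Pow (topspace T)" using openin_subset by auto
  show "f \<in> space X \<rightarrow> topspace T" using assms(1) by auto
  fix U assume "U \<in> {U. openin T U}"
  then have "{x \<in> space X. f x \<in> U} \<in> sets X" using assms(2) by simp
  moreover have "f -` U \<inter> space X = {x \<in> space X. f x \<in> U}" by auto
  ultimately show "f -` U \<inter> space X \<in> sets X" by simp
qed

lemma pred_eq_borel_of:
  fixes T :: "'b topology" and X :: "'a measure"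
  assumes "Polish_space T" and f: "f \<in> measurable X (borel_of T)" and g: "g \<in> measurable X (borel_of T)"
  shows "Measurable.pred X (\<lambda>x. f x = g x)"
proof -
  obtain U :: "nat \<Rightarrow> 'b set" where U: "\<And>n. openin T (U n)"
    "\<And>y z. y \<in> topspace T \<Longrightarrow> y \<noteq> z \<Longrightarrow> \<exists>n. y \<in> U n \<and> z \<notin> U n"
    using Polish_base[OF assms(1)] by metis
  have [measurable]: "Measurable.pred X (\<lambda>x. f x \<in> U n)" "Measurable.pred X (\<lambda>x. g x \<in> U n)" for n
    using f g openin_sets_borel_of[OF U(1)] by (auto intro: pred_sets2)
  have "Measurable.pred X (\<lambda>x. \<forall>n. f x \<in> U n \<longleftrightarrow> g x \<in> U n)" by measurable
  moreover have "(\<forall>n. f x \<in> U n \<longleftrightarrow> g x \<in> U n) \<longleftrightarrow> f x = g x" if "x \<in> space X" for x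
    using U(2)[of "f x" "g x"] measurable_space[OF f that] space_borel_of by metis
  ultimately show ?thesis by (rule pred_cong_space)
qed

lemma finite_subsets_hit:
  assumes L: "L \<in> measurable X (finite_subsets Y)" and "openin Y U"
  shows "Measurable.pred X (\<lambda>x. L x \<inter> U \<noteq> {})"
proof -
  let ?H = "{F. finite F \<and> F \<subseteq> topspace Y \<and> F \<inter> U \<noteq> {}}"
  have "?H \<in> sets (finite_subsets Y)"
    unfolding finite_subsets_def using assms(2) by (subst sets_measure_of) (auto intro!: sigma_sets.Basic)
  then have "Measurable.pred X (\<lambda>x. L x \<in> ?H)" using L by (intro pred_sets2)
  moreover have "L x \<in> ?H \<longleftrightarrow> L x \<inter> U \<noteq> {}" if "x \<in> space X" for x
    using measurable_space[OF L that] by (simp add: finite_subsets_def space_measure_of_conv)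
  ultimately show ?thesis by (rule pred_cong_space)
qed

lemma finite_subsetsD:
  assumes "L \<in> measurable X (finite_subsets Y)" "x \<in> space X"
  shows "finite (L x)" "L x \<subseteq> topspace Y"
  using measurable_space[OF assms] by (simp_all add: finite_subsets_def space_measure_of_conv)

lemma measurable_finite_subsetsI:
  assumes "\<And>x. x \<in> space X \<Longrightarrow> finite (L x) \<and> L x \<subseteq> topspace Y"
    and "\<And>U. openin Y U \<Longrightarrow> Measurable.pred X (\<lambda>x. L x \<inter> U \<noteq> {})"
  shows "L \<in> measurable X (finite_subsets Y)"
  unfolding finite_subsets_def
proof (rule measurable_measure_of)
  fix H assume "H \<in> {{F. finite F \<and> F \<subseteq> topspace Y \<and> F \<inter> U \<noteq> {}} |U. openin Y U}"
  then obtain U where U: "openin Y U" "H = {F. finite F \<and> F \<subseteq> topspace Y \<and> F \<inter> U \<noteq> {}}" by blast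
  have "L -` H \<inter> space X = {x \<in> space X. L x \<inter> U \<noteq> {}}" unfolding U(2) using assms(1) by auto
  then show "L -` H \<inter> space X \<in> sets X" using assms(2)[OF U(1)] by (simp add: pred_def)
qed (use assms(1) in auto)

text \<open>The base sets are processed one after another, and \<open>L x\<close> is cut down to every base set that it
  still hits. Only intersections with open sets occur, and a single point survives.\<close>

lemma finite_subsets_selector:
  fixes X :: "'a measure" and Y :: "'b topology"
  assumes Y: "Polish_space Y" and L: "L \<in> measurable X (finite_subsets Y)"
    and ne: "\<And>x. x \<in> space X \<Longrightarrow> L x \<noteq> {}"
  obtains l where "l \<in> measurable X (borel_of Y)" "\<And>x. x \<in> space X \<Longrightarrow> l x \<in> L x"
proof -
  obtain U :: "nat \<Rightarrow> 'b set" where U: "\<And>n. openin Y (U n)"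
    "\<And>W y. openin Y W \<Longrightarrow> y \<in> W \<Longrightarrow> \<exists>n. y \<in> U n \<and> U n \<subseteq> W"
    "\<And>y z. y \<in> topspace Y \<Longrightarrow> y \<noteq> z \<Longrightarrow> \<exists>n. y \<in> U n \<and> z \<notin> U n"
    using Polish_base[OF Y] by metis
  define Q where "Q bs = topspace Y \<inter> (\<Inter>m\<in>{m. m < length bs \<and> bs ! m}. U m)" for bs
  have Q_open: "openin Y (Q bs)" for bs
  proof -
    have "Q bs = \<Inter> (insert (topspace Y) (U ` {m. m < length bs \<and> bs ! m}))" by (auto simp: Q_def)
    also have "openin Y \<dots>" using U(1) by (intro openin_Inter) auto
    finally show ?thesis .
  qed
  \<comment> \<open>The record of the answers so far determines the current open set
    \<open>Q\<close>. There are only countably many records, which keeps every step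
    measurable.\<close>
  define bl where "bl = rec_nat (\<lambda>_. []) (\<lambda>n b x. b x @ [L x \<inter> (Q (b x) \<inter> U n) \<noteq> {}])"
  have bl: "bl 0 x = []" "bl (Suc n) x = bl n x @ [L x \<inter> (Q (bl n x) \<inter> U n) \<noteq> {}]" for n x
    by (simp_all add: bl_def)
  have len: "length (bl n x) = n" for n x by (induction n) (simp_all add: bl)
  have [measurable]: "bl n \<in> measurable X (count_space UNIV)" for n
  proof (induction n)
    case 0
    have "bl 0 = (\<lambda>_. [])" by (auto simp: bl)
    then show ?case by simp
  next
    case (Suc n)
    note [measurable] = Suc
    have [measurable]: "Measurable.pred X (\<lambda>x. L x \<inter> (Q bs \<inter> U n) \<noteq> {})" for bs
      using Q_open U(1) by (intro finite_subsets_hit[OF L] openin_Int)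
    have "(\<lambda>x. bs @ [L x \<inter> (Q bs \<inter> U n) \<noteq> {}]) \<in> measurable X (count_space UNIV)" for bs by measurable
    then have "(\<lambda>x. bl n x @ [L x \<inter> (Q (bl n x) \<inter> U n) \<noteq> {}]) \<in> measurable X (count_space UNIV)"
      by (rule measurable_compose_countable) (rule Suc)
    then show ?case by (simp add: bl[abs_def])
  qed
  have Q_Suc: "Q (bl (Suc n) x) = (if L x \<inter> (Q (bl n x) \<inter> U n) \<noteq> {} then Q (bl n x) \<inter> U n else Q (bl n x))" for n x
    unfolding Q_def bl using len[of n x] by (auto simp: nth_append less_Suc_eq split: if_splits)
  have Q_mono: "Q (bl n x) \<subseteq> Q (bl m x)" if "m \<le> n" for m n x
    using that by (rule lift_Suc_antimono_le[of "\<lambda>n. Q (bl n x)", rotated]) (auto simp: Q_Suc)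
  have Q_ne: "L x \<inter> Q (bl n x) \<noteq> {}" if x: "x \<in> space X" for n x
  proof (induction n)
    case 0
    then show ?case using ne[OF x] finite_subsetsD(2)[OF L x] by (auto simp: Q_def bl)
  next
    case (Suc n)
    then show ?case by (auto simp: Q_Suc)
  qed
  \<comment> \<open>The decreasing sets \<open>Q (bl n x)\<close> all meet the finite set
    \<open>L x\<close>, so they have one of its points in common.\<close>
  have ex: "\<exists>y. y \<in> L x \<and> (\<forall>n. y \<in> Q (bl n x))" if x: "x \<in> space X" for x
  proof (rule ccontr)
    assume "\<not> ?thesis"
    then have "\<forall>y\<in>L x. \<exists>n. y \<notin> Q (bl n x)" by blast
    then obtain N where N: "\<And>y. y \<in> L x \<Longrightarrow> y \<notin> Q (bl (N y) x)" by metis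
    let ?m = "Max (N ` L x)"
    have "y \<notin> Q (bl ?m x)" if "y \<in> L x" for y
    proof -
      have "N y \<le> ?m" using that finite_subsetsD(1)[OF L x] by auto
      then show ?thesis using N[OF that] Q_mono by blast
    qed
    then show False using Q_ne[OF x] by blast
  qed
  define l where "l x = (SOME y. y \<in> L x \<and> (\<forall>n. y \<in> Q (bl n x)))" for x
  have l: "l x \<in> L x" "l x \<in> Q (bl n x)" if "x \<in> space X" for x n
    using someI_ex[OF ex[OF that]] by (auto simp: l_def)
  have lU: "l x \<in> U n \<longleftrightarrow> L x \<inter> (Q (bl n x) \<inter> U n) \<noteq> {}" if "x \<in> space X" for x n
    using l(1)[OF that] l(2)[OF that, of n] l(2)[OF that, of "Suc n"] by (auto simp: Q_Suc split: if_splits)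
  have "l \<in> measurable X (borel_of Y)"
  proof (rule measurable_borel_ofI)
    show "l x \<in> topspace Y" if "x \<in> space X" for x using l(1)[OF that] finite_subsetsD(2)[OF L that] by blast
    fix W assume W: "openin Y W"
    have "Measurable.pred X (\<lambda>x. L x \<inter> (Q bs \<inter> U n) \<noteq> {})" for bs n
      using Q_open U(1) by (intro finite_subsets_hit[OF L] openin_Int)
    then have [measurable]: "Measurable.pred X (\<lambda>x. L x \<inter> (Q (bl n x) \<inter> U n) \<noteq> {})" for n
      by (rule measurable_compose_countable) measurable
    have "Measurable.pred X (\<lambda>x. \<exists>n. U n \<subseteq> W \<and> L x \<inter> (Q (bl n x) \<inter> U n) \<noteq> {})" by measurable
    then have "Measurable.pred X (\<lambda>x. l x \<in> W)"
    proof (rule pred_cong_space)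
      fix x assume x: "x \<in> space X"
      have "(\<exists>n. U n \<subseteq> W \<and> l x \<in> U n) \<longleftrightarrow> l x \<in> W" using U(2)[OF W, of "l x"] by blast
      then show "(\<exists>n. U n \<subseteq> W \<and> L x \<inter> (Q (bl n x) \<inter> U n) \<noteq> {}) \<longleftrightarrow> l x \<in> W" by (simp add: lU[OF x])
    qed
    then show "{x \<in> space X. l x \<in> W} \<in> sets X" by (simp add: pred_def)
  qed
  then show thesis using that l(1) by blast
qed

text \<open>The selector is applied repeatedly, and each selected point is removed before the next
  round. A last point is kept, so that the sets stay nonempty and the enumeration continues with
  repetitions.\<close>

theorem finite_subsets_enumeration:
  fixes X :: "'a measure" and Y :: "'b topology"
  assumes Y: "Polish_space Y" and L: "L \<in> measurable X (finite_subsets Y)"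
    and ne: "\<And>x. x \<in> space X \<Longrightarrow> L x \<noteq> {}"
  obtains l :: "nat \<Rightarrow> 'a \<Rightarrow> 'b" where "\<And>i. l i \<in> measurable X (borel_of Y)"
    "\<And>x. x \<in> space X \<Longrightarrow> range (\<lambda>i. l i x) = L x"
proof -
  obtain U :: "nat \<Rightarrow> 'b set" where U: "\<And>n. openin Y (U n)"
    "\<And>W y. openin Y W \<Longrightarrow> y \<in> W \<Longrightarrow> \<exists>n. y \<in> U n \<and> U n \<subseteq> W"
    "\<And>y z. y \<in> topspace Y \<Longrightarrow> y \<noteq> z \<Longrightarrow> \<exists>n. y \<in> U n \<and> z \<notin> U n"
    using Polish_base[OF Y] by metis
  let ?P = "\<lambda>L. L \<in> measurable X (finite_subsets Y) \<and> (\<forall>x\<in>space X. L x \<noteq> {})"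
  have "\<forall>L. \<exists>l. ?P L \<longrightarrow> l \<in> measurable X (borel_of Y) \<and> (\<forall>x\<in>space X. l x \<in> L x)"
    using finite_subsets_selector[OF Y] by metis
  from choice[OF this] obtain sel where
    "\<forall>L. ?P L \<longrightarrow> sel L \<in> measurable X (borel_of Y) \<and> (\<forall>x\<in>space X. sel L x \<in> L x)" ..
  then have sel: "\<And>L. ?P L \<Longrightarrow> sel L \<in> measurable X (borel_of Y)"
    "\<And>L x. ?P L \<Longrightarrow> x \<in> space X \<Longrightarrow> sel L x \<in> L x" by blast+
  define nxt where "nxt L x = (if L x \<subseteq> {sel L x} then L x else L x - {sel L x})" for L x
  define LL where "LL n = (nxt ^^ n) L" for n
  have LL: "LL 0 = L" "LL (Suc n) = nxt (LL n)" for n by (simp_all add: LL_def)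
  have P: "?P (LL n)" for n
  proof (induction n)
    case 0
    then show ?case using L ne by (simp add: LL)
  next
    case (Suc n)
    let ?L = "LL n"
    have L': "?L \<in> measurable X (finite_subsets Y)" using Suc by blast
    note s = sel(1)[OF Suc] sel(2)[OF Suc]
    have hit: "Measurable.pred X (\<lambda>x. (?L x - {sel ?L x}) \<inter> W \<noteq> {})" if W: "openin Y W" for W
    proof -
      have [measurable]: "Measurable.pred X (\<lambda>x. ?L x \<inter> (U m \<inter> W) \<noteq> {})" for m
        using U(1) W by (intro finite_subsets_hit[OF L'] openin_Int)
      have [measurable]: "Measurable.pred X (\<lambda>x. sel ?L x \<in> U m)" for m
        using s(1) openin_sets_borel_of[OF U(1)] by (intro pred_sets2)
      have "Measurable.pred X (\<lambda>x. \<exists>m. ?L x \<inter> (U m \<inter> W) \<noteq> {} \<and> sel ?L x \<notin> U m)" by measurable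
      moreover have "(\<exists>m. ?L x \<inter> (U m \<inter> W) \<noteq> {} \<and> sel ?L x \<notin> U m) \<longleftrightarrow> (?L x - {sel ?L x}) \<inter> W \<noteq> {}"
        if x: "x \<in> space X" for x
      proof
        assume "(?L x - {sel ?L x}) \<inter> W \<noteq> {}"
        then obtain z where z: "z \<in> ?L x" "z \<noteq> sel ?L x" "z \<in> W" by blast
        then obtain m where "z \<in> U m" "sel ?L x \<notin> U m"
          using U(3)[of z "sel ?L x"] finite_subsetsD(2)[OF L' x] by blast
        then show "\<exists>m. ?L x \<inter> (U m \<inter> W) \<noteq> {} \<and> sel ?L x \<notin> U m" using z by blast
      qed blast
      ultimately show ?thesis by (rule pred_cong_space)
    qed
    have [measurable]: "Measurable.pred X (\<lambda>x. ?L x \<subseteq> {sel ?L x})"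
    proof -
      have "Measurable.pred X (\<lambda>x. \<not> (?L x - {sel ?L x}) \<inter> topspace Y \<noteq> {})"
        using hit[OF openin_topspace] by measurable
      moreover have "\<not> (?L x - {sel ?L x}) \<inter> topspace Y \<noteq> {} \<longleftrightarrow> ?L x \<subseteq> {sel ?L x}" if "x \<in> space X" for x
        using finite_subsetsD(2)[OF L' that] by blast
      ultimately show ?thesis by (rule pred_cong_space)
    qed
    have "LL (Suc n) \<in> measurable X (finite_subsets Y)"
      unfolding LL
    proof (rule measurable_finite_subsetsI)
      show "finite (nxt ?L x) \<and> nxt ?L x \<subseteq> topspace Y" if "x \<in> space X" for x
        using finite_subsetsD[OF L' that] by (auto simp: nxt_def)
      fix W assume W: "openin Y W"
      note [measurable] = hit[OF W] finite_subsets_hit[OF L' W]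
      have "Measurable.pred X (\<lambda>x. if ?L x \<subseteq> {sel ?L x} then ?L x \<inter> W \<noteq> {} else (?L x - {sel ?L x}) \<inter> W \<noteq> {})"
        by measurable
      then show "Measurable.pred X (\<lambda>x. nxt ?L x \<inter> W \<noteq> {})"
        by (rule pred_cong_space) (simp add: nxt_def)
    qed
    moreover have "\<forall>x\<in>space X. LL (Suc n) x \<noteq> {}" using Suc by (auto simp: LL nxt_def)
    ultimately show ?case by blast
  qed
  define l where "l n = sel (LL n)" for n
  have sub: "LL n x \<subseteq> L x" for n x by (induction n) (auto simp: LL nxt_def)
  have "range (\<lambda>i. l i x) = L x" if x: "x \<in> space X" for x
  proof
    show "range (\<lambda>i. l i x) \<subseteq> L x" using sel(2)[OF P x] sub by (auto simp: l_def)
    show "L x \<subseteq> range (\<lambda>i. l i x)"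
    proof (rule ccontr)
      assume "\<not> ?thesis"
      then obtain y where y: "y \<in> L x" "\<And>i. y \<noteq> l i x" by blast
      have fin: "finite (LL n x)" for n using finite_subsetsD(1)[OF conjunct1[OF P[of n]] x] .
      \<comment> \<open>If some point were never selected, a point would be removed in every round,
        and the cardinality would decrease forever.\<close>
      have "y \<in> LL n x \<and> card (LL n x) + n = card (L x)" for n
      proof (induction n)
        case 0
        then show ?case using y by (simp add: LL)
      next
        case (Suc n)
        then have "\<not> LL n x \<subseteq> {l n x}" using y by blast
        then have eq: "LL (Suc n) x = LL n x - {l n x}" by (simp add: LL nxt_def l_def)
        have "l n x \<in> LL n x" using sel(2)[OF P x] by (simp add: l_def)
        then have "card (LL n x) = Suc (card (LL n x - {l n x}))" using fin by (metis card.remove)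
        then show ?case using Suc y(1) y(2)[of n] unfolding eq by simp
      qed
      from this[of "card (L x)"] show False using fin[of "card (L x)"] by auto
    qed
  qed
  then show thesis using that[of l] sel(1)[OF P] by (simp add: l_def)
qed


section \<open>The Borel construction\<close>

text \<open>The right-hand side quantifies over lists of natural numbers, which makes comparisons of
  cardinalities Borel.\<close>

lemma le_card_iff:
  fixes g :: "nat \<Rightarrow> 'c"
  assumes "finite {g i |i. c i}"
  shows "m \<le> card {g i |i. c i} \<longleftrightarrow>
    (\<exists>is. length is = m \<and> (\<forall>a<m. c (is ! a)) \<and> (\<forall>a<m. \<forall>b<a. g (is ! a) \<noteq> g (is ! b)))"
proof
  assume "m \<le> card {g i |i. c i}"
  then obtain T where T: "T \<subseteq> {g i |i. c i}" "card T = m" "finite T"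
    by (rule obtain_subset_with_card_n)
  obtain xs where xs: "set xs = T" "distinct xs" using finite_distinct_list[OF T(3)] by blast
  have "\<forall>y\<in>T. \<exists>i. c i \<and> g i = y" using T(1) by blast
  then obtain f where f: "\<And>y. y \<in> T \<Longrightarrow> c (f y) \<and> g (f y) = y" by metis
  have len: "length xs = m" using distinct_card[OF xs(2)] xs(1) T(2) by simp
  have "c (map f xs ! a)" "g (map f xs ! a) = xs ! a" if "a < m" for a
    using f[of "xs ! a"] that len xs(1) by (auto simp: nth_mem)
  moreover have "xs ! a \<noteq> xs ! b" if "a < m" "b < a" for a b
    using that xs(2) len by (simp add: nth_eq_iff_index_eq)
  ultimately show "\<exists>is. length is = m \<and> (\<forall>a<m. c (is ! a)) \<and> (\<forall>a<m. \<forall>b<a. g (is ! a) \<noteq> g (is ! b))"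
    using len by (intro exI[of _ "map f xs"]) auto
next
  assume "\<exists>is. length is = m \<and> (\<forall>a<m. c (is ! a)) \<and> (\<forall>a<m. \<forall>b<a. g (is ! a) \<noteq> g (is ! b))"
  then obtain "is" where iprops: "length is = m" "\<And>a. a < m \<Longrightarrow> c (is ! a)" "\<And>a b. a < m \<Longrightarrow> b < a \<Longrightarrow> g (is ! a) \<noteq> g (is ! b)"
    by blast
  have "inj_on (\<lambda>a. g (is ! a)) {..<m}"
  proof (rule inj_onI)
    fix a b assume "a \<in> {..<m}" "b \<in> {..<m}" "g (is ! a) = g (is ! b)"
    then show "a = b" using iprops(3)[of a b] iprops(3)[of b a] by (metis lessThan_iff nat_neq_iff)
  qed
  then have "m = card ((\<lambda>a. g (is ! a)) ` {..<m})" by (simp add: card_image)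
  also have "\<dots> \<le> card {g i |i. c i}" using assms iprops(2) by (intro card_mono) auto
  finally show "m \<le> card {g i |i. c i}" .
qed

lemma pred_count_rel:
  fixes f :: "'a \<Rightarrow> 'c::countable" and g :: "'a \<Rightarrow> 'd::countable"
  assumes f: "f \<in> measurable M (count_space UNIV)" and g: "g \<in> measurable M (count_space UNIV)"
  shows "Measurable.pred M (\<lambda>x. P (f x) (g x))"
proof (rule measurable_compose_countable[OF _ f])
  show "Measurable.pred M (\<lambda>x. P k (g x))" for k
    by (rule measurable_compose[OF g]) simp
qed

lemmas pred_nat_eq [measurable (raw)] = pred_count_rel[where P = "(=) :: nat \<Rightarrow> nat \<Rightarrow> bool"]
lemmas pred_nat_le [measurable (raw)] = pred_count_rel[where P = "(\<le>) :: nat \<Rightarrow> nat \<Rightarrow> bool"]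

lemma rat_interval_avoiding:
  fixes t :: real
  assumes "finite F" "t \<notin> F"
  shows "\<exists>p q. real_of_rat p < t \<and> t < real_of_rat q \<and> (\<forall>s\<in>F. \<not> (real_of_rat p < s \<and> s < real_of_rat q))"
  using assms
proof (induction F)
  case empty
  then show ?case using of_rat_dense[of "t - 1" t] of_rat_dense[of t "t + 1"] by auto
next
  case (insert f F)
  then obtain p q where pq: "real_of_rat p < t" "t < real_of_rat q" "\<forall>s\<in>F. \<not> (real_of_rat p < s \<and> s < real_of_rat q)"
    by auto
  define lo hi where "lo = (if f < t then max (real_of_rat p) f else real_of_rat p)"
    and "hi = (if t < f then min (real_of_rat q) f else real_of_rat q)"
  have "lo < t" "t < hi" using pq by (auto simp: lo_def hi_def)
  then obtain p' q' where p': "lo < real_of_rat p'" "real_of_rat p' < t"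
    and q': "t < real_of_rat q'" "real_of_rat q' < hi" using of_rat_dense by metis
  have "f \<noteq> t" using insert.prems by auto
  then have "\<not> (real_of_rat p' < s \<and> s < real_of_rat q')" if "s \<in> insert f F" for s
    using that pq(3) p' q' by (auto simp: lo_def hi_def split: if_splits)
  then show ?case using p' q' by blast
qed

text \<open>Only positions are quantified. With vertices given by Borel functions of a base point,
  this is a finite combination of Borel conditions.\<close>

lemma violator_nth:
  assumes "3 \<le> length xs"
  shows "violator A xs \<longleftrightarrow> (\<forall>a<length xs. \<forall>b<a. xs ! a \<noteq> xs ! b)
    \<and> (\<forall>a. Suc a < length xs \<longrightarrow> adj A (xs ! a) (xs ! Suc a)) \<and> adj A (xs ! (length xs - 1)) (xs ! 0)
    \<and> (\<forall>b<length xs. adj A (xs ! 0) (xs ! b) \<longrightarrow> xs ! b = xs ! 1 \<or> xs ! b = xs ! (length xs - 1))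
    \<and> \<not> (\<forall>a<length xs. \<forall>b<length xs. \<forall>c<length xs.
          ((xs ! a, xs ! b) \<in> A \<and> (xs ! a, xs ! c) \<in> A \<longrightarrow> xs ! b = xs ! c)
          \<and> ((xs ! b, xs ! a) \<in> A \<and> (xs ! c, xs ! a) \<in> A \<longrightarrow> xs ! b = xs ! c))
    \<and> \<not> (odd (length xs) \<and> ((xs ! 0, xs ! 1) \<in> A \<longleftrightarrow> (xs ! 0, xs ! (length xs - 1)) \<in> A)
          \<and> ((xs ! 1, xs ! 0) \<in> A \<longleftrightarrow> (xs ! (length xs - 1), xs ! 0) \<in> A))"
proof -
  have ne: "xs \<noteq> []" "tl xs \<noteq> []" using assms by (cases xs; cases "tl xs"; auto)+
  have hd: "hd xs = xs ! 0" "last xs = xs ! (length xs - 1)" "hd (tl xs) = xs ! 1"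
    using ne by (simp_all add: hd_conv_nth last_conv_nth) (cases xs; simp)
  have "distinct xs \<longleftrightarrow> (\<forall>a<length xs. \<forall>b<a. xs ! a \<noteq> xs ! b)"
    unfolding distinct_conv_nth by (metis order.strict_trans nat_neq_iff)
  then show ?thesis
    unfolding violator_def ucycle_def thin_def alike_def hd all_set_conv_all_nth successively_conv_nth
    using assms by simp
qed

locale borel_setting =
  fixes X :: "'a measure" and A :: "('a \<times> 'a) set" and nb :: "nat \<Rightarrow> 'a \<Rightarrow> 'a" and \<kappa> :: "'a \<Rightarrow> real"
    and Y :: "'b topology" and L :: "'a \<Rightarrow> 'b set" and l :: "nat \<Rightarrow> 'a \<Rightarrow> 'b"
  assumes irr: "irrefl A" and A_sub: "A \<subseteq> space X \<times> space X" and A_meas: "A \<in> sets (X \<Otimes>\<^sub>M X)"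
    and fin: "\<And>x. x \<in> space X \<Longrightarrow> finite {y. adj A x y}"
    and nb_meas [measurable]: "\<And>i. nb i \<in> measurable X X"
    and nb_adj: "\<And>x i. x \<in> space X \<Longrightarrow> nb i x = x \<or> adj A x (nb i x)"
    and nb_all: "\<And>x y. adj A x y \<Longrightarrow> \<exists>i. nb i x = y"
    and \<kappa>_meas [measurable]: "\<kappa> \<in> borel_measurable X" and \<kappa>_inj: "inj_on \<kappa> (space X)"
    and Y: "Polish_space Y"
    and l_meas [measurable]: "\<And>i. l i \<in> measurable X (borel_of Y)"
    and l_range: "\<And>x. x \<in> space X \<Longrightarrow> range (\<lambda>i. l i x) = L x"
    and L_fin: "\<And>x. x \<in> space X \<Longrightarrow> finite (L x)"
    and L_deg: "\<And>x. x \<in> space X \<Longrightarrow> maxdeg A x \<le> card (L x)"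
    and not_Gallai: "\<And>C. C \<in> conn_components (space X) A \<Longrightarrow> \<not> Gallai_tree A C"
begin

subsection \<open>Words and connected components\<close>

text \<open>The functions \<open>nb i\<close> enumerate the neighbors of a vertex, possibly with the vertex itself, so
  the component of a vertex consists of its images under words. Quantifiers over components become
  countable in this way.\<close>

definition nw :: "nat list \<Rightarrow> 'a \<Rightarrow> 'a" where "nw w = fold nb w"

lemma nw_Nil [simp]: "nw [] x = x" and nw_Cons [simp]: "nw (i # w) x = nw w (nb i x)"
  and nw_append [simp]: "nw (u @ w) x = nw w (nw u x)"
  by (simp_all add: nw_def)

lemma nb_space: "x \<in> space X \<Longrightarrow> nb i x \<in> space X"
  using measurable_space[OF nb_meas] .

lemma nw_space: "x \<in> space X \<Longrightarrow> nw w x \<in> space X"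
  by (induction w arbitrary: x) (auto simp: nb_space)

lemma nw_meas [measurable]: "nw w \<in> measurable X X"
proof (induction w)
  case (Cons i w)
  have "nw (i # w) = (\<lambda>x. nw w (nb i x))" by (simp add: fun_eq_iff)
  then show ?case using measurable_compose[OF nb_meas Cons] by (simp only:)
next
  case Nil
  have "nw [] = (\<lambda>x. x)" by (simp add: fun_eq_iff)
  then show ?case by simp
qed

lemma adj_space: "adj A x y \<Longrightarrow> x \<in> space X \<and> y \<in> space X"
  using A_sub by (auto simp: adj_iff)

lemma adj_neq: "adj A x y \<Longrightarrow> x \<noteq> y"
  using irr by (auto simp: adj_iff irrefl_def)

lemma nw_rev:
  assumes "x \<in> space X" shows "\<exists>w'. length w' \<le> length w \<and> nw w' (nw w x) = x"
  using assms
proof (induction w arbitrary: x)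
  case (Cons i w)
  let ?y = "nb i x"
  obtain w' where w': "length w' \<le> length w" "nw w' (nw w ?y) = ?y" using Cons nb_space by blast
  show ?case
  proof (cases "?y = x")
    case True
    then show ?thesis using w' by (intro exI[of _ w']) auto
  next
    case False
    then have "adj A ?y x" using nb_adj[OF Cons.prems] by (metis adj_sym)
    then obtain j where "nb j ?y = x" using nb_all by blast
    then show ?thesis using w' by (intro exI[of _ "w' @ [j]"]) auto
  qed
qed simp

lemma rtrancl_iff_nw:
  assumes "x \<in> space X" shows "(x, y) \<in> (underlying A)\<^sup>* \<longleftrightarrow> (\<exists>w. nw w x = y)"
proof
  assume "(x, y) \<in> (underlying A)\<^sup>*"
  then show "\<exists>w. nw w x = y"
  proof induction
    case base
    show ?case by (intro exI[of _ "[]"]) simp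
  next
    case (step y z)
    then obtain w i where "nw w x = y" "nb i y = z" using nb_all by blast
    then show ?case by (intro exI[of _ "w @ [i]"]) simp
  qed
next
  have "(x, nw w x) \<in> (underlying A)\<^sup>*" for w
    using assms
  proof (induction w arbitrary: x)
    case (Cons i w)
    then have "(nb i x, nw w (nb i x)) \<in> (underlying A)\<^sup>*" using nb_space by blast
    then show ?case using nb_adj[OF Cons.prems, of i] by (auto intro: converse_rtrancl_into_rtrancl)
  qed simp
  then show "\<exists>w. nw w x = y \<Longrightarrow> (x, y) \<in> (underlying A)\<^sup>*" by blast
qed

lemma finite_nb: assumes "x \<in> space X" shows "finite (range (\<lambda>i. nb i x))"
proof (rule finite_subset)
  show "range (\<lambda>i. nb i x) \<subseteq> insert x {y. adj A x y}" using nb_adj[OF assms] by blast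
qed (use fin[OF assms] in simp)

lemma finite_ball: "x \<in> space X \<Longrightarrow> finite {nw w x |w. length w \<le> R}"
proof (induction R arbitrary: x)
  case (Suc R)
  have "{nw w x |w. length w \<le> Suc R} \<subseteq> insert x (\<Union>z\<in>range (\<lambda>i. nb i x). {nw w z |w. length w \<le> R})"
  proof
    fix y assume "y \<in> {nw w x |w. length w \<le> Suc R}"
    then obtain w where w: "y = nw w x" "length w \<le> Suc R" by blast
    then show "y \<in> insert x (\<Union>z\<in>range (\<lambda>i. nb i x). {nw w z |w. length w \<le> R})" by (cases w) auto
  qed
  moreover have "finite \<dots>"
    by (intro finite.insertI finite_UN_I finite_nb Suc.prems) (use Suc nb_space in auto)
  ultimately show ?case by (rule finite_subset)
qed simp

lemma pred_eqX [measurable (raw)]: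
  assumes [measurable]: "f \<in> measurable M X" "g \<in> measurable M X"
  shows "Measurable.pred M (\<lambda>x. f x = g x)"
proof (rule pred_cong_space)
  have [measurable]: "(\<lambda>x. \<kappa> (f x)) \<in> borel_measurable M" "(\<lambda>x. \<kappa> (g x)) \<in> borel_measurable M" by measurable
  show "Measurable.pred M (\<lambda>x. \<kappa> (f x) = \<kappa> (g x))" by measurable
  show "\<kappa> (f x) = \<kappa> (g x) \<longleftrightarrow> f x = g x" if "x \<in> space M" for x
    using inj_on_eq_iff[OF \<kappa>_inj] measurable_space[OF assms(1) that] measurable_space[OF assms(2) that] by blast
qed

lemma pred_eqY [measurable (raw)]:
  "f \<in> measurable M (borel_of Y) \<Longrightarrow> g \<in> measurable M (borel_of Y) \<Longrightarrow> Measurable.pred M (\<lambda>x. f x = g x)"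
  by (rule pred_eq_borel_of[OF Y])

lemma pred_A [measurable (raw)]:
  assumes [measurable]: "f \<in> measurable M X" "g \<in> measurable M X"
  shows "Measurable.pred M (\<lambda>x. (f x, g x) \<in> A)"
proof -
  have "(\<lambda>x. (f x, g x)) \<in> measurable M (X \<Otimes>\<^sub>M X)" by measurable
  then show ?thesis by (rule pred_sets2[OF A_meas])
qed

lemma pred_adj [measurable (raw)]:
  assumes [measurable]: "f \<in> measurable M X" "g \<in> measurable M X"
  shows "Measurable.pred M (\<lambda>x. (f x, g x) \<in> underlying A)"
  unfolding adj_iff by measurable

subsection \<open>Arcs in dicycles\<close>

text \<open>The arcs on dicycles, the only ones that matter for a dicoloring. Degrees are compared
  with lists in \<open>A0\<close>, so that at a vertex without a spare color every arc lies on a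
  dicycle.\<close>

definition A0 :: "('a \<times> 'a) set" where "A0 = {(x, y) \<in> A. (y, x) \<in> A\<^sup>*}"

lemma A0_sub: "A0 \<subseteq> A" by (auto simp: A0_def)

lemma rtrancl_A_iff_nw:
  assumes x: "x \<in> space X"
  shows "(x, y) \<in> A\<^sup>* \<longleftrightarrow> (\<exists>w. (\<forall>k<length w. (nw (take k w) x, nw (take (Suc k) w) x) \<in> A) \<and> nw w x = y)"
proof
  assume "(x, y) \<in> A\<^sup>*"
  then show "\<exists>w. (\<forall>k<length w. (nw (take k w) x, nw (take (Suc k) w) x) \<in> A) \<and> nw w x = y"
  proof induction
    case base
    show ?case by (intro exI[of _ "[]"]) simp
  next
    case (step y z)
    then obtain w where w: "\<forall>k<length w. (nw (take k w) x, nw (take (Suc k) w) x) \<in> A" "nw w x = y" by blast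
    obtain i where i: "nb i y = z" using nb_all[of y z] step(2) by (auto simp: adj_iff)
    have "(nw (take k (w @ [i])) x, nw (take (Suc k) (w @ [i])) x) \<in> A" if "k < length (w @ [i])" for k
    proof (cases "k < length w")
      case True
      then show ?thesis using w(1) by simp
    next
      case False
      then have "k = length w" using that by simp
      then show ?thesis using w(2) i step(2) by simp
    qed
    then show ?case using w(2) i by (intro exI[of _ "w @ [i]"]) simp
  qed
next
  assume "\<exists>w. (\<forall>k<length w. (nw (take k w) x, nw (take (Suc k) w) x) \<in> A) \<and> nw w x = y"
  then obtain w where w: "\<And>k. k < length w \<Longrightarrow> (nw (take k w) x, nw (take (Suc k) w) x) \<in> A" "nw w x = y" by blast
  have "k \<le> length w \<Longrightarrow> (x, nw (take k w) x) \<in> A\<^sup>*" for k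
  proof (induction k)
    case (Suc k)
    then show ?case using w(1)[of k] by (auto intro: rtrancl_into_rtrancl)
  qed simp
  from this[of "length w"] show "(x, y) \<in> A\<^sup>*" using w(2) by simp
qed

lemma pred_A0 [measurable (raw)]:
  assumes [measurable]: "f \<in> measurable M X" "g \<in> measurable M X"
  shows "Measurable.pred M (\<lambda>x. (f x, g x) \<in> A0)"
proof (rule pred_cong_space)
  show "Measurable.pred M (\<lambda>x. (f x, g x) \<in> A \<and>
    (\<exists>w. (\<forall>k<length w. (nw (take k w) (g x), nw (take (Suc k) w) (g x)) \<in> A) \<and> nw w (g x) = f x))"
    by measurable
  show "((f x, g x) \<in> A \<and> (\<exists>w. (\<forall>k<length w. (nw (take k w) (g x), nw (take (Suc k) w) (g x)) \<in> A)
      \<and> nw w (g x) = f x)) \<longleftrightarrow> (f x, g x) \<in> A0" if "x \<in> space M" for x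
    using rtrancl_A_iff_nw[of "g x" "f x"] measurable_space[OF assms(2) that] by (simp add: A0_def)
qed

lemma finite_out: "x \<in> space X \<Longrightarrow> finite (A `` {x})" "x \<in> space X \<Longrightarrow> finite (A\<inverse> `` {x})"
  by (rule finite_subset[OF _ fin[of x]]; auto simp: adj_iff)+

lemma finite_out0: "x \<in> space X \<Longrightarrow> finite (A0 `` {x})" "x \<in> space X \<Longrightarrow> finite (A0\<inverse> `` {x})"
  using A0_sub by (auto intro: finite_subset[OF _ finite_out(1)] finite_subset[OF _ finite_out(2)])

definition slack :: "'a \<Rightarrow> bool" where
  "slack x \<longleftrightarrow> card (A0 `` {x}) < card (L x) \<or> card (A0\<inverse> `` {x}) < card (L x)"

lemma pred_slack [measurable]: "Measurable.pred X slack"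
proof -
  let ?c = "\<lambda>(c :: nat \<Rightarrow> 'a \<Rightarrow> bool) m x. \<exists>is. length is = m \<and> (\<forall>a<m. c (is ! a) x) \<and>
      (\<forall>a<m. \<forall>b<a. nb (is ! a) x \<noteq> nb (is ! b) x)"
  let ?l = "\<lambda>m x. \<exists>is. length is = m \<and> (\<forall>a<m. \<forall>b<a. l (is ! a) x \<noteq> l (is ! b) x)"
  have out: "m \<le> card (A0 `` {x}) \<longleftrightarrow> ?c (\<lambda>i x. (x, nb i x) \<in> A0) m x"
    "m \<le> card (A0\<inverse> `` {x}) \<longleftrightarrow> ?c (\<lambda>i x. (nb i x, x) \<in> A0) m x" if x: "x \<in> space X" for x m
  proof -
    have e: "A0 `` {x} = {nb i x |i. (x, nb i x) \<in> A0}" "A0\<inverse> `` {x} = {nb i x |i. (nb i x, x) \<in> A0}"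
      using nb_all[of x] A0_sub by (auto simp: adj_iff)
    have f: "finite {nb i x |i. (x, nb i x) \<in> A0}" "finite {nb i x |i. (nb i x, x) \<in> A0}"
      unfolding e[symmetric] using finite_out0[OF x] by auto
    show "m \<le> card (A0 `` {x}) \<longleftrightarrow> ?c (\<lambda>i x. (x, nb i x) \<in> A0) m x"
      "m \<le> card (A0\<inverse> `` {x}) \<longleftrightarrow> ?c (\<lambda>i x. (nb i x, x) \<in> A0) m x"
      unfolding e using le_card_iff[OF f(1)] le_card_iff[OF f(2)] by simp_all
  qed
  have lst: "m \<le> card (L x) \<longleftrightarrow> ?l m x" if x: "x \<in> space X" for x m
  proof -
    have e: "L x = {l i x |i. True}" using l_range[OF x] by auto
    have f: "finite {l i x |i. True}" unfolding e[symmetric] by (rule L_fin[OF x])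
    show ?thesis unfolding e using le_card_iff[OF f, of m] by simp
  qed
  have "Measurable.pred X (\<lambda>x. \<exists>m. ?l (Suc m) x \<and> (\<not> ?c (\<lambda>i x. (x, nb i x) \<in> A0) (Suc m) x
      \<or> \<not> ?c (\<lambda>i x. (nb i x, x) \<in> A0) (Suc m) x))" by measurable
  then show ?thesis
  proof (rule pred_cong_space)
    fix x assume x: "x \<in> space X"
    have "slack x \<longleftrightarrow> (\<exists>m. Suc m \<le> card (L x) \<and> (\<not> Suc m \<le> card (A0 `` {x}) \<or> \<not> Suc m \<le> card (A0\<inverse> `` {x})))"
      unfolding slack_def by (auto simp: Suc_le_eq not_less intro: le_less_trans)
    then show "(\<exists>m. ?l (Suc m) x \<and> (\<not> ?c (\<lambda>i x. (x, nb i x) \<in> A0) (Suc m) x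
      \<or> \<not> ?c (\<lambda>i x. (nb i x, x) \<in> A0) (Suc m) x)) \<longleftrightarrow> slack x"
      unfolding lst[OF x] out[OF x] by simp
  qed
qed

text \<open>The list size is at most the degree in \<open>A0\<close>, this is at most the degree in
  \<open>A\<close>, and this is at most the list size again; so equality holds throughout.\<close>

lemma not_slack:
  assumes x: "x \<in> space X" "\<not> slack x"
  shows "A0 `` {x} = A `` {x}" "A0\<inverse> `` {x} = A\<inverse> `` {x}" "card (A `` {x}) = card (L x)" "card (A\<inverse> `` {x}) = card (L x)"
proof -
  have sub: "A0 `` {x} \<subseteq> A `` {x}" "A0\<inverse> `` {x} \<subseteq> A\<inverse> `` {x}" using A0_sub by auto
  have e: "A `` {x} = {y. (x, y) \<in> A}" "A\<inverse> `` {x} = {y. (y, x) \<in> A}" by auto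
  have le: "card (A `` {x}) \<le> card (L x)" "card (A\<inverse> `` {x}) \<le> card (L x)"
    using L_deg[OF x(1)] unfolding e maxdeg_def outdeg_def indeg_def by auto
  have ge: "card (L x) \<le> card (A0 `` {x})" "card (L x) \<le> card (A0\<inverse> `` {x})"
    using x(2) by (auto simp: slack_def)
  have mono: "card (A0 `` {x}) \<le> card (A `` {x})" "card (A0\<inverse> `` {x}) \<le> card (A\<inverse> `` {x})"
    using card_mono[OF finite_out(1)[OF x(1)] sub(1)] card_mono[OF finite_out(2)[OF x(1)] sub(2)] by auto
  show "card (A `` {x}) = card (L x)" "card (A\<inverse> `` {x}) = card (L x)" using le ge mono by linarith+
  show "A0 `` {x} = A `` {x}" "A0\<inverse> `` {x} = A\<inverse> `` {x}"
    using card_subset_eq[OF finite_out(1)[OF x(1)] sub(1)] card_subset_eq[OF finite_out(2)[OF x(1)] sub(2)]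
      le ge mono by linarith+
qed

subsection \<open>Good sets\<close>

definition vs :: "nat list list \<Rightarrow> 'a \<Rightarrow> 'a list" where "vs W x = map (\<lambda>w. nw w x) W"

text \<open>A good set is coded by the words which lead to its vertices from a base point.\<close>

definition good :: "nat list list \<Rightarrow> 'a \<Rightarrow> bool" where
  "good W x \<longleftrightarrow> W = [[]] \<and> slack x \<or> violator A (vs W x) \<and> (\<forall>a<length W. \<not> slack (nw (W ! a) x))"

lemma pred_good [measurable]: "Measurable.pred X (good W)"
proof (cases "3 \<le> length W")
  case False
  then have "good W x \<longleftrightarrow> W = [[]] \<and> slack x" for x by (auto simp: good_def violator_def ucycle_def vs_def)
  then have "good W = (\<lambda>x. W = [[]] \<and> slack x)" by auto
  then show ?thesis by simp
next
  case True
  let ?n = "length W" and ?v = "\<lambda>a x. nw (W ! a) x"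
  have len: "0 < ?n" "1 < ?n" "?n - 1 < ?n" using True by auto
  have viol: "violator A (vs W x) \<longleftrightarrow> (\<forall>a<?n. \<forall>b<a. ?v a x \<noteq> ?v b x)
    \<and> (\<forall>a. Suc a < ?n \<longrightarrow> adj A (?v a x) (?v (Suc a) x)) \<and> adj A (?v (?n - 1) x) (?v 0 x)
    \<and> (\<forall>b<?n. adj A (?v 0 x) (?v b x) \<longrightarrow> ?v b x = ?v 1 x \<or> ?v b x = ?v (?n - 1) x)
    \<and> \<not> (\<forall>a<?n. \<forall>b<?n. \<forall>c<?n.
          ((?v a x, ?v b x) \<in> A \<and> (?v a x, ?v c x) \<in> A \<longrightarrow> ?v b x = ?v c x)
          \<and> ((?v b x, ?v a x) \<in> A \<and> (?v c x, ?v a x) \<in> A \<longrightarrow> ?v b x = ?v c x))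
    \<and> \<not> (odd ?n \<and> ((?v 0 x, ?v 1 x) \<in> A \<longleftrightarrow> (?v 0 x, ?v (?n - 1) x) \<in> A)
          \<and> ((?v 1 x, ?v 0 x) \<in> A \<longleftrightarrow> (?v (?n - 1) x, ?v 0 x) \<in> A))" for x
  proof -
    have n: "length (vs W x) = ?n" and nth: "\<And>a. a < ?n \<Longrightarrow> vs W x ! a = ?v a x" by (auto simp: vs_def)
    show ?thesis
      using True nth[OF len(1)] by (subst violator_nth) (simp_all add: n nth len cong: conj_cong imp_cong)
  qed
  have [measurable]: "Measurable.pred X (\<lambda>x. violator A (vs W x))"
    unfolding viol by measurable
  have "W \<noteq> [[]]" using True by auto
  then have "good W = (\<lambda>x. violator A (vs W x) \<and> (\<forall>a<length W. \<not> slack (nw (W ! a) x)))"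
    by (auto simp: good_def)
  moreover have "Measurable.pred X (\<lambda>x. violator A (vs W x) \<and> (\<forall>a<length W. \<not> slack (nw (W ! a) x)))"
    by measurable
  ultimately show ?thesis by simp
qed

text \<open>Without good sets the component has neither slack vertices nor violators. Then each of
  its blocks is of an admissible kind, against the assumption that it is not a Gallai tree.\<close>

lemma good_exists:
  assumes x: "x \<in> space X" shows "\<exists>w W. good W (nw w x)"
proof (rule ccontr)
  assume none: "\<not> ?thesis"
  define C where "C = {y \<in> space X. (x, y) \<in> (underlying A)\<^sup>*}"
  have C_nw: "y \<in> C \<longleftrightarrow> (\<exists>w. y = nw w x)" for y
    using rtrancl_iff_nw[OF x, of y] nw_space[OF x] by (auto simp: C_def)
  have C_adj: "z \<in> C" if "y \<in> C" "adj A y z" for y z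
    using that adj_space[OF that(2)] by (auto simp: C_def intro: rtrancl_into_rtrancl)
  have C_sub: "C \<subseteq> space X" by (auto simp: C_def)
  have nslack: "\<not> slack y" if "y \<in> C" for y
  proof
    assume "slack y"
    then have "good [[]] y" by (simp add: good_def)
    then show False using none that C_nw by metis
  qed
  \<comment> \<open>A violator is coded by words that lead from its first vertex to all of its
    vertices.\<close>
  have nviol: "\<not> violator A xs" if "set xs \<subseteq> C" for xs
  proof
    assume v: "violator A xs"
    then have ne: "xs \<noteq> []" by (auto simp: violator_def ucycle_def)
    then have "hd xs \<in> C" using \<open>set xs \<subseteq> C\<close> by auto
    then obtain u where u: "nw u x = hd xs" using C_nw[of "hd xs"] by auto
    obtain u' where u': "nw u' (hd xs) = x" using nw_rev[OF x, of u] u by auto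
    have "\<forall>y\<in>set xs. \<exists>w. nw w (hd xs) = y"
    proof
      fix y assume "y \<in> set xs"
      then obtain w where "y = nw w x" using \<open>set xs \<subseteq> C\<close> C_nw by blast
      then have "nw (u' @ w) (hd xs) = y" using u' by simp
      then show "\<exists>w. nw w (hd xs) = y" by blast
    qed
    then obtain f where f: "\<And>y. y \<in> set xs \<Longrightarrow> nw (f y) (hd xs) = y" by metis
    have "vs (map f xs) (hd xs) = xs" using f by (auto simp: vs_def intro: map_idI)
    moreover have "\<not> slack (nw (map f xs ! a) (hd xs))" if a: "a < length (map f xs)" for a
    proof -
      have m: "xs ! a \<in> set xs" using a by simp
      then have "xs ! a \<in> C" using \<open>set xs \<subseteq> C\<close> by blast
      then show ?thesis using f[OF m] nslack a by simp
    qed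
    ultimately have "good (map f xs) (hd xs)" using v by (simp add: good_def)
    then show False using none u by metis
  qed
  have "C \<in> conn_components (space X) A" unfolding conn_components_def C_def using x by blast
  from not_Gallai[OF this] obtain S where S: "block C (Restr A C) S" and
    bad: "\<not> induces_dicycle A S" "\<not> induces_odd_cycle A S" "\<not> induces_complete A S"
    unfolding Gallai_tree_def by blast
  have SC: "S \<subseteq> C" and bicR: "biconnected (Restr A C) S" using S by (auto simp: block_def)
  have conn: "connected_in (Restr A C) T \<longleftrightarrow> connected_in A T" if "T \<subseteq> C" for T
  proof -
    have "Restr (underlying (Restr A C)) T = Restr (underlying A) T" using that by (auto simp: underlying_def)
    then show ?thesis by (simp add: connected_in_def)
  qed
  have bic_eq: "biconnected (Restr A C) T \<longleftrightarrow> biconnected A T" if "T \<subseteq> C" for T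
    unfolding biconnected_def using that conn[of T] conn[of "T - {_}"] by (metis Diff_subset order_trans)
  have bic: "biconnected A S" using bicR bic_eq[OF SC] by simp
  interpret vf: violator_free A S
    by unfold_locales (use irr nviol SC in auto)
  obtain u v where S_eq: "S = {u, v}"
    using vf.biconnected_cases[OF bic] bad fin C_sub SC by blast
  have uv: "u \<in> C" "v \<in> C" using SC S_eq by auto
  have ne: "u \<noteq> v" using bic unfolding biconnected_def S_eq by auto
  have "(u, v) \<in> (Restr (underlying A) S)\<^sup>*" using bic S_eq by (simp add: biconnected_def connected_in_def)
  then obtain z where "(u, z) \<in> Restr (underlying A) S" using ne by (meson converse_rtranclE)
  then have a: "adj A u v" using S_eq adj_neq by auto
  \<comment> \<open>As its ends have no slack, the arc lies on a dicycle, which yields a larger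
    biconnected set and contradicts the maximality of the block.\<close>
  have single: False if uv: "u \<in> C" "v \<in> C" "S = {u, v}" "(u, v) \<in> A" "(v, u) \<notin> A" for u v
  proof -
    have "(u, v) \<in> A0" using not_slack(1)[of u] nslack[OF uv(1)] uv(1,4) C_sub by auto
    then have vu: "(v, u) \<in> A\<^sup>*" by (simp add: A0_def)
    have "(v, y) \<in> (Restr A C)\<^sup>* \<and> y \<in> C" if "(v, y) \<in> A\<^sup>*" for y
      using that
    proof induction
      case (step y z)
      then have "z \<in> C" using C_adj[of y z] by (simp add: adj_iff)
      then show ?case using step by (auto intro: rtrancl_into_rtrancl)
    qed (use uv in simp)
    then have "(v, u) \<in> (Restr A C)\<^sup>*" using vu by blast
    then obtain T where T: "{u, v} \<subseteq> T" "T \<noteq> {u, v}" "T \<subseteq> C" "biconnected (Restr A C) T"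
      using arc_in_dicycle_biconnected[of u v "Restr A C" C] uv by blast
    then show False using S uv(3) unfolding block_def by blast
  qed
  have "(u, v) \<in> A" "(v, u) \<in> A"
    using single[OF uv S_eq] single[OF uv(2,1)] S_eq a by (auto simp: adj_iff insert_commute)
  moreover have "symmetrization (complete_edges S) = {(u, v), (v, u)}"
    unfolding S_eq symmetrization_def complete_edges_def using ne
    by (auto simp: card_insert_if split: if_splits)
  moreover have "(u, u) \<notin> A" "(v, v) \<notin> A" using irr by (auto simp: irrefl_def)
  ultimately have "induces_complete A S" unfolding induces_complete_def S_eq by auto
  then show False using bad by simp
qed

subsection \<open>Markers\<close>

text \<open>Minimizing over the whole component makes the code constant on it, so that within a
  component all marked sets have one shape and one radius.\<close>

definition gcode :: "'a \<Rightarrow> nat" where "gcode x = (LEAST k. \<exists>w. good (from_nat k) (nw w x))"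

definition code :: "'a \<Rightarrow> nat list list" where "code x = from_nat (gcode x)"

lemma gcode_meas [measurable]: "gcode \<in> measurable X (count_space UNIV)"
  unfolding gcode_def[abs_def] by (intro measurable_Least) measurable

lemma gcode_nw:
  assumes "x \<in> space X" shows "gcode (nw w x) = gcode x"
proof -
  obtain w' where w': "nw w' (nw w x) = x" using nw_rev[OF assms] by blast
  have "(\<exists>u. good W (nw u (nw w x))) \<longleftrightarrow> (\<exists>u. good W (nw u x))" for W
    using w' by (metis nw_append)
  then show ?thesis by (simp add: gcode_def)
qed

lemma code_nw: "x \<in> space X \<Longrightarrow> code (nw w x) = code x"
  by (simp add: code_def gcode_nw)

lemma code_good: assumes "x \<in> space X" shows "\<exists>w. good (code x) (nw w x)"
proof -
  obtain w W where "good W (nw w x)" using good_exists[OF assms] by blast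
  then have "\<exists>k w. good (from_nat k) (nw w x)" by (metis from_nat_to_nat)
  from LeastI_ex[OF this] show ?thesis by (simp add: code_def gcode_def)
qed

definition separates :: "nat \<Rightarrow> real \<Rightarrow> bool" where
  "separates m t \<longleftrightarrow> real_of_rat (fst (from_nat m :: rat \<times> rat)) < t
     \<and> t < real_of_rat (snd (from_nat m :: rat \<times> rat))"

text \<open>A Borel coloring with natural numbers in which distinct points at distance at most
  \<open>R\<close> differ. The color is a rational interval that isolates the point from the finite
  ball around it.\<close>

definition sep :: "nat \<Rightarrow> 'a \<Rightarrow> nat" where
  "sep R x = (LEAST m. separates m (\<kappa> x) \<and> (\<forall>w. length w \<le> R \<longrightarrow> nw w x \<noteq> x \<longrightarrow> \<not> separates m (\<kappa> (nw w x))))"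

lemma sep_meas [measurable]: "sep R \<in> measurable X (count_space UNIV)"
  unfolding sep_def[abs_def] separates_def by (intro measurable_Least) measurable

lemma sep_props:
  assumes x: "x \<in> space X"
  shows "separates (sep R x) (\<kappa> x)"
    "\<And>w. length w \<le> R \<Longrightarrow> nw w x \<noteq> x \<Longrightarrow> \<not> separates (sep R x) (\<kappa> (nw w x))"
proof -
  let ?F = "\<kappa> ` ({nw w x |w. length w \<le> R} - {x})"
  have "finite ?F" using finite_ball[OF x] by simp
  moreover have "\<kappa> x \<notin> ?F" using \<kappa>_inj x nw_space[OF x] by (auto simp: inj_on_def)
  ultimately have "\<exists>p q. real_of_rat p < \<kappa> x \<and> \<kappa> x < real_of_rat q
    \<and> (\<forall>s\<in>?F. \<not> (real_of_rat p < s \<and> s < real_of_rat q))" by (rule rat_interval_avoiding)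
  then obtain p q where pq: "real_of_rat p < \<kappa> x \<and> \<kappa> x < real_of_rat q
    \<and> (\<forall>s\<in>?F. \<not> (real_of_rat p < s \<and> s < real_of_rat q))" by (elim exE)
  have "separates (to_nat (p, q)) (\<kappa> x)
    \<and> (\<forall>w. length w \<le> R \<longrightarrow> nw w x \<noteq> x \<longrightarrow> \<not> separates (to_nat (p, q)) (\<kappa> (nw w x)))"
    using pq by (auto simp: separates_def)
  from LeastI[of "\<lambda>m. separates m (\<kappa> x) \<and> (\<forall>w. length w \<le> R \<longrightarrow> nw w x \<noteq> x \<longrightarrow> \<not> separates m (\<kappa> (nw w x)))", OF this]
  show "separates (sep R x) (\<kappa> x)"
    "\<And>w. length w \<le> R \<Longrightarrow> nw w x \<noteq> x \<Longrightarrow> \<not> separates (sep R x) (\<kappa> (nw w x))"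
    unfolding sep_def by blast+
qed

lemma sep_neq:
  assumes "x \<in> space X" "length w \<le> R" "nw w x \<noteq> x" shows "sep R (nw w x) \<noteq> sep R x"
  using sep_props(2)[OF assms] sep_props(1)[OF nw_space[OF assms(1)]] by metis

lemma sep_adj: assumes "adj A x y" shows "sep 1 x \<noteq> sep 1 y"
proof -
  obtain i where "nb i x = y" using nb_all[OF assms] by blast
  then show ?thesis using sep_neq[of x "[i]" 1] adj_space[OF assms] adj_neq[OF assms] by auto
qed

text \<open>Touching or overlapping copies of a set coded by \<open>W\<close> have base points at distance at most
  \<open>rad W\<close>.\<close>

definition rad :: "nat list list \<Rightarrow> nat" where "rad W = Suc (2 * sum_list (map length W))"

definition c1 :: "'a \<Rightarrow> nat" where "c1 x = sep (rad (code x)) x"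

lemma c1_meas [measurable]: "c1 \<in> measurable X (count_space UNIV)"
proof -
  have "(\<lambda>x. sep (rad (from_nat (gcode x))) x) \<in> measurable X (count_space UNIV)"
    by (rule measurable_compose_countable[of "\<lambda>k x. sep (rad (from_nat k)) x", OF sep_meas gcode_meas])
  then show ?thesis by (simp add: c1_def[abs_def] code_def)
qed

definition M0 :: "'a \<Rightarrow> bool" where "M0 x \<longleftrightarrow> good (code x) x"

text \<open>The code is constant on each component. Markers have the least color \<open>c1\<close> among the admissible
  base points of their component, and points of the same color are far apart.\<close>

definition marker :: "'a \<Rightarrow> bool" where "marker x \<longleftrightarrow> M0 x \<and> (\<forall>w. M0 (nw w x) \<longrightarrow> c1 x \<le> c1 (nw w x))"

lemma M0_meas [measurable]: "Measurable.pred X M0"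
proof -
  have "Measurable.pred X (\<lambda>x. good (from_nat (gcode x)) x)"
    by (rule measurable_compose_countable[of "\<lambda>k x. good (from_nat k) x", OF pred_good gcode_meas])
  then show ?thesis by (simp add: M0_def[abs_def] code_def)
qed

lemma marker_meas [measurable]: "Measurable.pred X marker"
proof -
  have [measurable]: "(\<lambda>x. c1 (nw w x)) \<in> measurable X (count_space UNIV)" "Measurable.pred X (\<lambda>x. M0 (nw w x))" for w
    by (rule measurable_compose[OF nw_meas c1_meas], rule measurable_compose[OF nw_meas M0_meas])
  show ?thesis unfolding marker_def[abs_def] by measurable
qed

lemma marker_exists:
  assumes x: "x \<in> space X" shows "\<exists>w. marker (nw w x)"
proof -
  obtain w0 where "good (code x) (nw w0 x)" using code_good[OF x] by blast
  then have "M0 (nw w0 x)" by (simp add: M0_def code_nw[OF x])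
  then obtain w where w: "M0 (nw w x)" "\<And>u. M0 (nw u x) \<Longrightarrow> c1 (nw w x) \<le> c1 (nw u x)"
    using ex_has_least_nat[of "\<lambda>w. M0 (nw w x)" w0 "\<lambda>w. c1 (nw w x)"] by blast
  then have "marker (nw w x)" unfolding marker_def by (metis nw_append)
  then show ?thesis by blast
qed

definition mset :: "'a \<Rightarrow> 'a set" where "mset x = set (vs (code x) x)"

lemma mset_nw: "y \<in> mset x \<longleftrightarrow> (\<exists>a<length (code x). nw (code x ! a) x = y)"
  unfolding mset_def vs_def in_set_conv_nth by auto

text \<open>Base points of sets that touch are within \<open>rad\<close>, so if distinct they differ
  in \<open>c1\<close>. But both colors are least in the same component.\<close>

lemma marker_apart:
  assumes x: "x \<in> space X" and m: "marker x" "marker (nw u x)" and s: "s \<in> mset x" and t: "t \<in> mset (nw u x)"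
    and st: "s = t \<or> adj A s t"
  shows "nw u x = x"
proof (rule ccontr)
  let ?y = "nw u x" and ?W = "code x"
  assume ne: "?y \<noteq> x"
  have y: "?y \<in> space X" using nw_space[OF x] .
  have cy: "code ?y = ?W" using code_nw[OF x] .
  obtain w where w: "w \<in> set ?W" "s = nw w x" using s unfolding mset_nw by (metis nth_mem)
  obtain v where v: "v \<in> set ?W" "t = nw v ?y" using t unfolding mset_nw cy by (metis nth_mem)
  obtain v' where v': "length v' \<le> length v" "nw v' t = ?y" using nw_rev[OF y, of v] v(2) by auto
  have len: "length w \<le> sum_list (map length ?W)" "length v \<le> sum_list (map length ?W)"
    using w(1) v(1) by (auto intro!: member_le_sum_list)
  have "\<exists>i. length i \<le> 1 \<and> nw i s = t"
  proof (cases "s = t")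
    case True
    then show ?thesis by (intro exI[of _ "[]"]) simp
  next
    case False
    then obtain i where "nb i s = t" using st nb_all by blast
    then show ?thesis by (intro exI[of _ "[i]"]) simp
  qed
  then obtain i where i: "length i \<le> 1" "nw i s = t" by blast
  let ?p = "w @ i @ v'"
  have p: "nw ?p x = ?y" using w(2) i(2) v'(2) by simp
  have "length ?p \<le> rad ?W" using len v'(1) i(1) by (simp add: rad_def)
  then have "sep (rad ?W) ?y \<noteq> sep (rad ?W) x" using sep_neq[OF x, of ?p "rad ?W"] p ne by simp
  then have "c1 ?y \<noteq> c1 x" by (simp add: c1_def cy)
  moreover have "c1 x \<le> c1 ?y" using m by (simp add: marker_def)
  moreover have "c1 ?y \<le> c1 x"
  proof -
    obtain u' where "nw u' ?y = x" using nw_rev[OF x] by blast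
    then show ?thesis using m unfolding marker_def by metis
  qed
  ultimately show False by simp
qed

text \<open>The union of the sets of all markers. The code is quantified as a number in order to
  make the definition visibly Borel.\<close>

definition B :: "'a \<Rightarrow> bool" where
  "B y \<longleftrightarrow> (\<exists>k. gcode y = k \<and> (\<exists>w. marker (nw w y) \<and>
     (\<exists>a<length (from_nat k :: nat list list). nw ((from_nat k :: nat list list) ! a) (nw w y) = y)))"

lemma B_meas [measurable]: "Measurable.pred X B"
  unfolding B_def[abs_def] by measurable

lemma B_iff:
  assumes "y \<in> space X" shows "B y \<longleftrightarrow> (\<exists>w. marker (nw w y) \<and> y \<in> mset (nw w y))"
  unfolding B_def mset_nw using code_nw[OF assms] by (simp add: code_def)

lemma B_exists: assumes x: "x \<in> space X" shows "\<exists>w. B (nw w x)"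
proof -
  obtain w where w: "marker (nw w x)" using marker_exists[OF x] by blast
  let ?y = "nw w x"
  have y: "?y \<in> space X" using nw_space[OF x] .
  have "good (code ?y) ?y" using w by (simp add: marker_def M0_def)
  then have "code ?y \<noteq> []" by (auto simp: good_def violator_def ucycle_def vs_def)
  then have "nw (code ?y ! 0) ?y \<in> mset ?y" unfolding mset_nw by auto
  moreover obtain u where "nw u (nw (code ?y ! 0) ?y) = ?y" using nw_rev[OF y] by blast
  ultimately have "B (nw (code ?y ! 0) ?y)"
    using B_iff[OF nw_space[OF y]] w by metis
  then show ?thesis by (metis nw_append)
qed

subsection \<open>Layers\<close>

definition lay :: "'a \<Rightarrow> nat" where "lay x = (LEAST m. \<exists>w. length w = m \<and> B (nw w x))"

lemma lay_meas [measurable]: "lay \<in> measurable X (count_space UNIV)"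
  unfolding lay_def[abs_def] by (intro measurable_Least) measurable

lemma lay_word: assumes "x \<in> space X" shows "\<exists>w. length w = lay x \<and> B (nw w x)"
proof -
  have "\<exists>m w. length w = m \<and> B (nw w x)" using B_exists[OF assms] by blast
  from LeastI_ex[OF this] show ?thesis by (simp add: lay_def)
qed

lemma lay_le: "B (nw w x) \<Longrightarrow> lay x \<le> length w"
  unfolding lay_def by (rule Least_le) blast

lemma lay_down:
  assumes x: "x \<in> space X" "\<not> B x" obtains i where "lay x = Suc (lay (nb i x))"
proof -
  obtain w where w: "length w = lay x" "B (nw w x)" using lay_word[OF x(1)] by blast
  then obtain i v where v: "w = i # v" using x(2) by (cases w) auto
  then have le: "lay (nb i x) \<le> length v" using w(2) lay_le by simp
  obtain u where u: "length u = lay (nb i x)" "B (nw u (nb i x))" using lay_word[OF nb_space[OF x(1)]] by blast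
  then have "lay x \<le> Suc (lay (nb i x))" using lay_le[of "i # u" x] by simp
  then have "lay x = Suc (lay (nb i x))" using le w(1) v by simp
  then show thesis using that by blast
qed

primrec outward :: "nat \<Rightarrow> 'a \<Rightarrow> bool" where
  "outward 0 x = True"
| "outward (Suc m) x = (\<exists>i. lay (nb i x) = Suc (lay x) \<and> outward m (nb i x))"

lemma outward_meas [measurable]: "Measurable.pred X (outward m)"
proof (induction m)
  case 0
  have "outward 0 = (\<lambda>_. True)" by (rule ext) simp
  then show ?case by simp
next
  case (Suc m)
  have [measurable]: "Measurable.pred X (\<lambda>x. outward m (nb i x))" "(\<lambda>x. Suc (lay x)) \<in> measurable X (count_space UNIV)" for i
    by (rule measurable_compose[OF nb_meas Suc], rule measurable_compose[OF lay_meas]) simp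
  have "outward (Suc m) = (\<lambda>x. \<exists>i. lay (nb i x) = Suc (lay x) \<and> outward m (nb i x))" by (rule ext) simp
  moreover have "Measurable.pred X (\<lambda>x. \<exists>i. lay (nb i x) = Suc (lay x) \<and> outward m (nb i x))" by measurable
  ultimately show ?case by simp
qed

lemma outward_mono: "outward n x \<Longrightarrow> m \<le> n \<Longrightarrow> outward m x"
proof (induction n arbitrary: m x)
  case (Suc n)
  then show ?case by (cases m) auto
qed simp

definition endless :: "'a \<Rightarrow> bool" where "endless x \<longleftrightarrow> (\<forall>m. outward m x)"

lemma endless_meas [measurable]: "Measurable.pred X endless"
  unfolding endless_def[abs_def] by measurable

text \<open>Koenig's argument: there are finitely many neighbors, so if outward paths from each of
  the next layer were bounded, one bound would hold for all of them and limit the paths from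
  \<open>x\<close>.\<close>

lemma endless_child:
  assumes x: "x \<in> space X" "endless x" obtains i where "lay (nb i x) = Suc (lay x)" "endless (nb i x)"
proof (rule ccontr)
  assume "\<not> thesis"
  then have "\<forall>z\<in>range (\<lambda>i. nb i x). lay z = Suc (lay x) \<longrightarrow> (\<exists>m. \<not> outward m z)"
    using that by (auto simp: endless_def)
  then have "\<forall>z. \<exists>m. z \<in> range (\<lambda>i. nb i x) \<longrightarrow> lay z = Suc (lay x) \<longrightarrow> \<not> outward m z" by blast
  from choice[OF this] obtain f where
    "\<forall>z. z \<in> range (\<lambda>i. nb i x) \<longrightarrow> lay z = Suc (lay x) \<longrightarrow> \<not> outward (f z) z" ..
  then have f: "\<not> outward (f (nb i x)) (nb i x)" if "lay (nb i x) = Suc (lay x)" for i using that by blast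
  let ?m = "Max (f ` range (\<lambda>i. nb i x))"
  have le: "f (nb i x) \<le> ?m" for i using finite_nb[OF x(1)] by (intro Max_ge) auto
  have "outward (Suc ?m) x" using x(2) by (simp add: endless_def del: outward.simps)
  then obtain i where "lay (nb i x) = Suc (lay x)" "outward ?m (nb i x)" by auto
  then show False using f le outward_mono by blast
qed

definition height :: "'a \<Rightarrow> nat" where "height x = (LEAST m. \<not> outward m x)"

lemma height_meas [measurable]: "height \<in> measurable X (count_space UNIV)"
  unfolding height_def[abs_def] by (intro measurable_Least) measurable

text \<open>The last entry separates adjacent vertices, which makes their ranks comparable. There
  are countably many ranks, so a recursion along them remains within Borel functions.\<close>

definition rank :: "'a \<Rightarrow> nat \<times> nat \<times> nat" where
  "rank x = (if endless x then (1, lay x, sep 1 x) else (0, height x, sep 1 x))"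

lemma rank_meas [measurable]: "rank \<in> measurable X (count_space UNIV)"
  unfolding rank_def[abs_def] by measurable

definition lexrel :: "((nat \<times> nat \<times> nat) \<times> (nat \<times> nat \<times> nat)) set" where
  "lexrel = less_than <*lex*> less_than <*lex*> less_than"

lemma wf_lexrel: "wf lexrel" unfolding lexrel_def by (intro wf_lex_prod wf_less_than)

lemma lexrel_total: "p \<noteq> q \<Longrightarrow> (p, q) \<in> lexrel \<or> (q, p) \<in> lexrel"
  by (cases p; cases q) (auto simp: lexrel_def)

lemma adj_rank: "adj A x y \<Longrightarrow> (rank x, rank y) \<in> lexrel \<or> (rank y, rank x) \<in> lexrel"
  using sep_adj[of x y] by (intro lexrel_total) (auto simp: rank_def)

text \<open>Vertices with an infinite outward geodesic are colored outwards from \<open>B\<close>, after the others, which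
  are colored inwards. So every vertex outside of \<open>B\<close> has a neighbor that is colored later.\<close>

lemma later_neighbor:
  assumes x: "x \<in> space X" "\<not> B x"
  obtains z where "adj A x z" "B z \<or> (rank x, rank z) \<in> lexrel"
proof (cases "endless x")
  case True
  obtain i where i: "lay (nb i x) = Suc (lay x)" "endless (nb i x)" using endless_child[OF x(1) True] by blast
  then have "nb i x \<noteq> x" by auto
  then have "adj A x (nb i x)" using nb_adj[OF x(1)] by blast
  moreover have "(rank x, rank (nb i x)) \<in> lexrel" using True i by (simp add: rank_def lexrel_def)
  ultimately show thesis using that by blast
next
  case False
  obtain i where i: "lay x = Suc (lay (nb i x))" using lay_down[OF x] by blast
  let ?z = "nb i x"
  have "?z \<noteq> x" using i by auto
  then have a: "adj A x ?z" using nb_adj[OF x(1)] by blast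
  have "(rank x, rank ?z) \<in> lexrel"
  proof (cases "endless ?z")
    case True
    then show ?thesis using False by (simp add: rank_def lexrel_def)
  next
    case nz: False
    obtain j where j: "nb j ?z = x" using nb_all[of ?z x] a by (auto simp: adj_sym)
    have up: "outward (Suc m) ?z" if "outward m x" for m
      using that i j by (auto intro!: exI[of _ j])
    have "\<not> outward (height ?z) ?z"
      using nz LeastI_ex[of "\<lambda>m. \<not> outward m ?z"] by (auto simp: endless_def height_def)
    moreover from this obtain k where k: "height ?z = Suc k" by (cases "height ?z") auto
    ultimately have "\<not> outward k x" using up by auto
    then have "height x \<le> k" unfolding height_def by (rule Least_le)
    then show ?thesis using False nz k by (simp add: rank_def lexrel_def)
  qed
  then show thesis using that a by blast
qed

subsection \<open>Greedy coloring outside of the good sets\<close>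

definition prior :: "'a \<Rightarrow> 'a \<Rightarrow> bool" where "prior z y \<longleftrightarrow> \<not> B z \<and> (rank z, rank y) \<in> lexrel"

text \<open>One side is enough, because a monochromatic dicycle through \<open>y\<close> uses the
  color of \<open>y\<close> on an in-neighbor and on an out-neighbor.\<close>

definition free_idx :: "('a \<Rightarrow> nat) \<Rightarrow> 'a \<Rightarrow> nat \<Rightarrow> bool" where
  "free_idx f y i \<longleftrightarrow>
     (\<forall>j. (y, nb j y) \<in> A \<longrightarrow> prior (nb j y) y \<longrightarrow> l (f (nb j y)) (nb j y) \<noteq> l i y) \<or>
     (\<forall>j. (nb j y, y) \<in> A \<longrightarrow> prior (nb j y) y \<longrightarrow> l (f (nb j y)) (nb j y) \<noteq> l i y)"

definition idx0 :: "'a \<Rightarrow> nat" where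
  "idx0 = wfrec (inv_image lexrel rank) (\<lambda>f y. LEAST i. free_idx f y i)"

lemma idx0_unfold: "idx0 y = (LEAST i. free_idx idx0 y i)"
proof -
  let ?R = "inv_image lexrel rank"
  have "idx0 y = (LEAST i. free_idx (cut idx0 ?R y) y i)"
    unfolding idx0_def by (subst wfrec[OF wf_inv_image[OF wf_lexrel]]) simp
  moreover have "free_idx (cut idx0 ?R y) y i \<longleftrightarrow> free_idx idx0 y i" for i
  proof -
    have "cut idx0 ?R y z = idx0 z" if "prior z y" for z
      using that by (simp add: prior_def cut_apply in_inv_image)
    then show ?thesis unfolding free_idx_def by (simp cong: imp_cong)
  qed
  ultimately show ?thesis by simp
qed

text \<open>The neighbor that comes later has no color yet. On its side fewer colors are therefore
  in use than the list offers.\<close>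

lemma idx0_free:
  assumes y: "y \<in> space X" "\<not> B y" shows "free_idx idx0 y (idx0 y)"
proof -
  obtain z where z: "adj A y z" "B z \<or> (rank y, rank z) \<in> lexrel" using later_neighbor[OF y] .
  have asym: "(rank z, rank y) \<notin> lexrel" if "(rank y, rank z) \<in> lexrel"
    using that wf_lexrel by (meson wf_asym)
  have nz: "\<not> prior z y" using z(2) asym by (auto simp: prior_def)
  have key: "\<exists>i. \<forall>v\<in>D. prior v y \<longrightarrow> l (idx0 v) v \<noteq> l i y" if D: "finite D" "card D \<le> card (L y)" "z \<in> D" for D
  proof -
    let ?I = "(\<lambda>v. l (idx0 v) v) ` (D - {z})"
    have "card ?I \<le> card (D - {z})" using D(1) by (intro card_image_le) simp
    also have "\<dots> < card (L y)" using D by (metis card_Diff1_less order_less_le_trans)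
    finally have "\<not> L y \<subseteq> ?I" using D(1) card_mono[of ?I "L y"] by auto
    then obtain c where c: "c \<in> L y" "c \<notin> ?I" by blast
    then obtain i where i: "c = l i y" using l_range[OF y(1)] by auto
    have "l (idx0 v) v \<noteq> l i y" if "v \<in> D" "prior v y" for v
    proof -
      have "v \<in> D - {z}" using that nz by auto
      then have "l (idx0 v) v \<in> ?I" by (rule imageI)
      then show ?thesis using c(2) i by metis
    qed
    then show ?thesis by blast
  qed
  have e: "A `` {y} = {v. (y, v) \<in> A}" "A\<inverse> `` {y} = {v. (v, y) \<in> A}" by auto
  have le: "card (A `` {y}) \<le> card (L y)" "card (A\<inverse> `` {y}) \<le> card (L y)"
    using L_deg[OF y(1)] unfolding e maxdeg_def outdeg_def indeg_def by auto
  have "\<exists>i. free_idx idx0 y i"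
  proof (cases "(y, z) \<in> A")
    case True
    then show ?thesis using key[OF finite_out(1)[OF y(1)] le(1)] by (auto simp: free_idx_def)
  next
    case False
    then have "(z, y) \<in> A" using z(1) by (simp add: adj_iff)
    then show ?thesis using key[OF finite_out(2)[OF y(1)] le(2)] by (auto simp: free_idx_def)
  qed
  then show ?thesis unfolding idx0_unfold[of y] by (rule LeastI_ex)
qed

lemma idx0_meas [measurable]: "idx0 \<in> measurable X (count_space UNIV)"
proof -
  have *: "Measurable.pred X (\<lambda>y. rank y = q \<and> idx0 y = i)" for q i
  proof (induction q arbitrary: i rule: wf_induct_rule[OF wf_lexrel])
    case (1 q)
    let ?c = "\<lambda>j i y. \<exists>p k. (p, q) \<in> lexrel \<and> \<not> B (nb j y) \<and> rank (nb j y) = p \<and> idx0 (nb j y) = k \<and> l k (nb j y) = l i y"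
    have c: "Measurable.pred X (?c j i)" for j i
    proof -
      have [measurable]: "Measurable.pred X (\<lambda>y. (p, q) \<in> lexrel \<and> rank (nb j y) = p \<and> idx0 (nb j y) = k)" for p k
      proof (cases "(p, q) \<in> lexrel")
        case True
        from measurable_compose[OF nb_meas[of j] 1[OF True, of k]] show ?thesis using True by simp
      qed simp
      have "Measurable.pred X (\<lambda>y. \<exists>p k. ((p, q) \<in> lexrel \<and> rank (nb j y) = p \<and> idx0 (nb j y) = k) \<and> \<not> B (nb j y) \<and> l k (nb j y) = l i y)"
        by measurable
      then show ?thesis by (rule pred_cong_space) blast
    qed
    note [measurable] = c
    let ?f = "\<lambda>i y. (\<forall>j. (y, nb j y) \<in> A \<longrightarrow> \<not> ?c j i y) \<or> (\<forall>j. (nb j y, y) \<in> A \<longrightarrow> \<not> ?c j i y)"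
    have [measurable]: "Measurable.pred X (?f i)" for i by measurable
    have [measurable]: "(\<lambda>y. LEAST i. ?f i y) \<in> measurable X (count_space UNIV)" by (intro measurable_Least) measurable
    have "Measurable.pred X (\<lambda>y. rank y = q \<and> (LEAST i. ?f i y) = i)" by measurable
    then show ?case
    proof (rule pred_cong_space)
      fix y
      have "?f i y \<longleftrightarrow> free_idx idx0 y i" if "rank y = q" for i
        using that unfolding free_idx_def prior_def by blast
      then show "rank y = q \<and> (LEAST i. ?f i y) = i \<longleftrightarrow> rank y = q \<and> idx0 y = i"
        unfolding idx0_unfold[of y] by auto
    qed
  qed
  have p: "Measurable.pred X (\<lambda>y. idx0 y = i)" for i
  proof (rule pred_cong_space)
    note [measurable] = *
    show "Measurable.pred X (\<lambda>y. \<exists>q. rank y = q \<and> idx0 y = i)" by measurable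
  qed blast
  have "idx0 -` {i} \<inter> space X \<in> sets X" for i
  proof -
    have "idx0 -` {i} \<inter> space X = {y \<in> space X. idx0 y = i}" by auto
    then show ?thesis using p[of i] by (simp add: pred_def)
  qed
  then show ?thesis by (subst measurable_count_space_eq2_countable) auto
qed

definition col0 :: "'a \<Rightarrow> 'b" where "col0 y = l (idx0 y) y"

lemma col0_meas [measurable]: "col0 \<in> measurable X (borel_of Y)"
  unfolding col0_def[abs_def] by (rule measurable_compose_countable[OF l_meas idx0_meas])

end


section \<open>Monochromatic dicycles\<close>

lemma dicycle_arc:
  assumes "dicycle A ys" "a < length ys" shows "(ys ! a, ys ! (Suc a mod length ys)) \<in> A"
  using assms by (auto simp: dicycle_def cycle_arcs_def)

lemma dicycle_rotate:
  assumes "dicycle A ys" shows "dicycle A (rotate m ys)"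
proof -
  let ?n = "length ys"
  have "(rotate m ys ! i, rotate m ys ! (Suc i mod ?n)) \<in> A" if "i < ?n" for i
  proof -
    have n: "0 < ?n" using that by linarith
    have "rotate m ys ! i = ys ! ((m + i) mod ?n)" using that by (rule nth_rotate)
    moreover have "rotate m ys ! (Suc i mod ?n) = ys ! (Suc ((m + i) mod ?n) mod ?n)"
      using n by (simp add: nth_rotate mod_simps)
    ultimately show ?thesis using dicycle_arc[OF assms, of "(m + i) mod ?n"] n by simp
  qed
  then show ?thesis using assms by (auto simp: dicycle_def cycle_arcs_def)
qed

lemma dicycle_walk:
  assumes "dicycle A ys" shows "successively (\<lambda>x y. (x, y) \<in> A) ys" "(last ys, hd ys) \<in> A"
proof -
  have ne: "ys \<noteq> []" using assms by (auto simp: dicycle_def)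
  have "(ys ! i, ys ! Suc i) \<in> A" if "Suc i < length ys" for i
    using dicycle_arc[OF assms, of i] that by simp
  then show "successively (\<lambda>x y. (x, y) \<in> A) ys" by (simp add: successively_conv_nth)
  have "Suc (length ys - 1) = length ys" using ne by simp
  then show "(last ys, hd ys) \<in> A"
    using dicycle_arc[OF assms, of "length ys - 1"] ne by (simp add: last_conv_nth hd_conv_nth)
qed

lemma dicycle_rtrancl:
  assumes "dicycle A ys" "i < length ys" shows "(ys ! (Suc i mod length ys), ys ! i) \<in> A\<^sup>*"
proof -
  let ?n = "length ys" and ?j = "Suc i mod length ys"
  have n: "0 < ?n" using assms(2) by linarith
  have "(ys ! ?j, ys ! ((?j + m) mod ?n)) \<in> A\<^sup>*" for m
  proof (induction m)
    case 0
    then show ?case by simp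
  next
    case (Suc m)
    have "(ys ! ((?j + m) mod ?n), ys ! (Suc ((?j + m) mod ?n) mod ?n)) \<in> A"
      using n by (intro dicycle_arc[OF assms(1)]) simp
    moreover have "Suc ((?j + m) mod ?n) mod ?n = (?j + Suc m) mod ?n"
      by (simp only: mod_Suc_eq add_Suc_right)
    ultimately show ?case using Suc by (auto intro: rtrancl_into_rtrancl)
  qed
  from this[of "?n - 1"] have "(ys ! ?j, ys ! ((?j + (?n - 1)) mod ?n)) \<in> A\<^sup>*" .
  moreover have "(?j + (?n - 1)) mod ?n = (Suc i + (?n - 1)) mod ?n" by (simp add: mod_add_left_eq)
  moreover have "Suc i + (?n - 1) = i + ?n" using n by simp
  ultimately show ?thesis using assms(2) by simp
qed

text \<open>A dicycle that leaves \<open>S\<close> is rotated so that it enters \<open>S\<close> at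
  its start. Its initial stretch in \<open>S\<close> is the segment, entered from the last vertex of
  the list.\<close>

lemma dicycle_segment:
  assumes d: "dicycle A ys" and s: "s \<in> set ys" "s \<in> S"
  obtains p where "p \<noteq> []" "set p \<subseteq> S" "set p \<subseteq> set ys" "successively (\<lambda>x y. (x, y) \<in> A) p"
    "(last p, hd p) \<in> A \<or> (\<exists>y\<in>set ys - S. (y, hd p) \<in> A) \<and> (\<exists>y\<in>set ys - S. (last p, y) \<in> A)"
proof (cases "set ys \<subseteq> S")
  case True
  have "ys \<noteq> []" using s by auto
  then show thesis using that[of ys] dicycle_walk[OF d] True by simp
next
  case False
  then obtain z where "z \<in> set ys" "z \<notin> S" by blast
  then obtain i where i: "i < length ys" "ys ! i \<notin> S" by (auto simp: in_set_conv_nth)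
  let ?z = "rotate i ys"
  let ?t = "takeWhile (\<lambda>x. x \<notin> S) ?z" and ?d = "dropWhile (\<lambda>x. x \<notin> S) ?z"
  have "hd ?z = ys ! i" using i by (subst hd_rotate_conv_nth) auto
  then have "?t \<noteq> []" using i by (cases ?z) auto
  have "?d \<noteq> []" using s by (auto simp: dropWhile_eq_Nil_conv)
  have "?d @ ?t = rotate (length ?t) ?z"
    by (metis rotate_append takeWhile_dropWhile_id)
  then have d': "dicycle A (?d @ ?t)" using dicycle_rotate[OF dicycle_rotate[OF d]] by metis
  define w where "w = ?d @ ?t"
  have w: "w \<noteq> []" "hd w \<in> S" "last w \<notin> S" "dicycle A w" "set w = set ys"
  proof -
    show "w \<noteq> []" "dicycle A w" using \<open>?t \<noteq> []\<close> d' by (auto simp: w_def)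
    show "hd w \<in> S" using hd_dropWhile[OF \<open>?d \<noteq> []\<close>] \<open>?d \<noteq> []\<close> by (simp add: w_def)
    have "last ?t \<in> set ?t" using \<open>?t \<noteq> []\<close> by (rule last_in_set)
    then have "last ?t \<notin> S" by (metis set_takeWhileD)
    then show "last w \<notin> S" using \<open>?t \<noteq> []\<close> by (simp add: w_def)
    have "set w = set ?z" unfolding w_def by (metis set_append sup_commute takeWhile_dropWhile_id)
    then show "set w = set ys" by simp
  qed
  let ?p = "takeWhile (\<lambda>x. x \<in> S) w" and ?q = "dropWhile (\<lambda>x. x \<in> S) w"
  have p: "?p \<noteq> []" "hd ?p = hd w" using w(1,2) by (cases w; simp)+
  have q: "?q \<noteq> []" using w(1,3) last_in_set by (auto simp: dropWhile_eq_Nil_conv)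
  have "successively (\<lambda>x y. (x, y) \<in> A) (?p @ ?q)" using dicycle_walk(1)[OF w(4)] by simp
  then have suc: "successively (\<lambda>x y. (x, y) \<in> A) ?p" "(last ?p, hd ?q) \<in> A"
    using p q unfolding successively_append_iff by auto
  have "hd ?q \<in> set w" using q by (metis hd_in_set set_dropWhileD)
  moreover have "hd ?q \<notin> S" using hd_dropWhile[OF q] .
  ultimately have "\<exists>y\<in>set ys - S. (last ?p, y) \<in> A" using suc(2) w(5) by blast
  moreover have "last w \<in> set ys - S" using w(1,3,5) last_in_set by blast
  then have "\<exists>y\<in>set ys - S. (y, hd ?p) \<in> A" using dicycle_walk(2)[OF w(4)] p(2) by auto
  moreover have "set ?p \<subseteq> S" "set ?p \<subseteq> set ys" using w(5) by (auto dest: set_takeWhileD)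
  ultimately show thesis using that[of ?p] p(1) suc(1) by blast
qed

context borel_setting
begin

lemma dicycle_A0: assumes "dicycle A ys" shows "dicycle A0 ys"
proof -
  have "(ys ! i, ys ! (Suc i mod length ys)) \<in> A0" if "i < length ys" for i
    using dicycle_arc[OF assms that] dicycle_rtrancl[OF assms that] by (simp add: A0_def)
  then show ?thesis using assms by (auto simp: dicycle_def cycle_arcs_def)
qed

lemma rank_maximal:
  assumes "finite S" "S \<noteq> {}" shows "\<exists>y\<in>S. \<forall>z\<in>S. (rank y, rank z) \<notin> lexrel"
  using assms
proof (induction rule: finite_ne_induct)
  case (singleton x)
  then show ?case using wf_lexrel by (auto dest: wf_not_refl)
next
  case (insert x F)
  have tr: "trans lexrel" unfolding lexrel_def by (intro trans_lex_prod trans_less_than)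
  obtain y where y: "y \<in> F" "\<forall>z\<in>F. (rank y, rank z) \<notin> lexrel" using insert by blast
  show ?case
  proof (cases "(rank y, rank x) \<in> lexrel")
    case True
    then have "\<forall>z\<in>insert x F. (rank x, rank z) \<notin> lexrel"
      using y(2) tr wf_lexrel by (auto dest: wf_not_refl transD)
    then show ?thesis by blast
  qed (use y in blast)
qed

text \<open>At the vertex of the dicycle that is colored last, both neighbors on the dicycle are
  already colored, and the colors on one side are avoided.\<close>

lemma col0_dicycle:
  assumes d: "dicycle A ys" and out: "\<And>y. y \<in> set ys \<Longrightarrow> \<not> B y" and mono: "\<And>y. y \<in> set ys \<Longrightarrow> col0 y = c"
  shows False
proof -
  let ?n = "length ys"
  have n: "2 \<le> ?n" using d by (simp add: dicycle_def)
  have "set ys \<noteq> {}" using n by auto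
  then obtain y where y: "y \<in> set ys" "\<forall>z\<in>set ys. (rank y, rank z) \<notin> lexrel"
    using rank_maximal[of "set ys"] by auto
  obtain a where a: "a < ?n" "y = ys ! a" using y(1) by (auto simp: in_set_conv_nth)
  define b where "b = (a + (?n - 1)) mod ?n"
  have b: "b < ?n" using n unfolding b_def by (intro mod_less_divisor) linarith
  have "Suc b mod ?n = Suc (a + (?n - 1)) mod ?n" unfolding b_def by (simp add: mod_Suc_eq)
  also have "Suc (a + (?n - 1)) = a + ?n" using n by simp
  finally have Sb: "Suc b mod ?n = a" using a(1) by simp
  let ?x = "ys ! (Suc a mod ?n)" and ?z = "ys ! b"
  have arcs: "(y, ?x) \<in> A" "(?z, y) \<in> A"
    using dicycle_arc[OF d a(1)] dicycle_arc[OF d b] Sb a(2) by auto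
  have "Suc a mod ?n < ?n" using n by (intro mod_less_divisor) linarith
  then have mem: "?x \<in> set ys" "?z \<in> set ys" using b by auto
  have adjs: "adj A y ?x" "adj A y ?z" using arcs by (auto simp: adj_iff)
  have pr: "prior ?x y" "prior ?z y"
    using adj_rank[OF adjs(1)] adj_rank[OF adjs(2)] y(2) mem out unfolding prior_def by blast+
  obtain j k where jk: "nb j y = ?x" "nb k y = ?z" using nb_all[OF adjs(1)] nb_all[OF adjs(2)] by blast
  have "free_idx idx0 y (idx0 y)" using idx0_free out[OF y(1)] adj_space[OF adjs(1)] by blast
  then have "col0 ?x \<noteq> col0 y \<or> col0 ?z \<noteq> col0 y"
    unfolding free_idx_def col0_def using arcs pr jk by metis
  then show False using mono mem y(1) by simp
qed

subsection \<open>Coloring the good sets\<close>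

text \<open>A bad path written as a list of positions in the code \<open>W\<close>, which makes its existence a Borel
  condition; \<open>E\<close> lists the indices of the colors chosen at these positions.\<close>

definition badq :: "nat list list \<Rightarrow> nat list \<Rightarrow> nat list \<Rightarrow> 'a \<Rightarrow> bool" where
  "badq W E q x \<longleftrightarrow> q \<noteq> [] \<and> (\<forall>a<length q. q ! a < length W)
     \<and> (\<forall>a. Suc a < length q \<longrightarrow> (nw (W ! (q ! a)) x, nw (W ! (q ! Suc a)) x) \<in> A0)
     \<and> (\<forall>a<length q. l (E ! (q ! a)) (nw (W ! (q ! a)) x) = l (E ! (q ! 0)) (nw (W ! (q ! 0)) x))
     \<and> ((nw (W ! (q ! (length q - 1))) x, nw (W ! (q ! 0)) x) \<in> A0 \<or>
        (\<exists>i. (\<forall>a<length W. nb i (nw (W ! (q ! 0)) x) \<noteq> nw (W ! a) x)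
           \<and> (nb i (nw (W ! (q ! 0)) x), nw (W ! (q ! 0)) x) \<in> A0
           \<and> col0 (nb i (nw (W ! (q ! 0)) x)) = l (E ! (q ! 0)) (nw (W ! (q ! 0)) x)) \<and>
        (\<exists>i. (\<forall>a<length W. nb i (nw (W ! (q ! (length q - 1))) x) \<noteq> nw (W ! a) x)
           \<and> (nw (W ! (q ! (length q - 1))) x, nb i (nw (W ! (q ! (length q - 1))) x)) \<in> A0
           \<and> col0 (nb i (nw (W ! (q ! (length q - 1))) x)) = l (E ! (q ! 0)) (nw (W ! (q ! 0)) x)))"

lemma badq_meas [measurable]: "Measurable.pred X (badq W E q)"
  unfolding badq_def[abs_def] by measurable

lemma badq_iff:
  assumes x: "x \<in> space X"
    and on: "\<And>a. a < length W \<Longrightarrow> \<phi> (nw (W ! a) x) = l (E ! a) (nw (W ! a) x)"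
    and off: "\<And>y. y \<notin> set (vs W x) \<Longrightarrow> \<phi> y = col0 y"
  shows "(\<exists>q. badq W E q x) \<longleftrightarrow> (\<exists>p. bad_path A0 (set (vs W x)) (set (vs W x)) \<phi> p)"
proof -
  let ?v = "\<lambda>a. nw (W ! a) x" and ?S = "set (vs W x)"
  have S: "y \<in> ?S \<longleftrightarrow> (\<exists>a<length W. ?v a = y)" for y unfolding vs_def in_set_conv_nth by auto
  have notS: "y \<notin> ?S \<longleftrightarrow> (\<forall>a<length W. y \<noteq> ?v a)" for y unfolding S by metis
  have nbr: "(\<exists>y. y \<notin> ?S \<and> (y, z) \<in> A0 \<and> \<phi> y = c) \<longleftrightarrow>
        (\<exists>i. (\<forall>a<length W. nb i z \<noteq> ?v a) \<and> (nb i z, z) \<in> A0 \<and> col0 (nb i z) = c)"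
      "(\<exists>y. y \<notin> ?S \<and> (z, y) \<in> A0 \<and> \<phi> y = c) \<longleftrightarrow>
        (\<exists>i. (\<forall>a<length W. nb i z \<noteq> ?v a) \<and> (z, nb i z) \<in> A0 \<and> col0 (nb i z) = c)" for z c
  proof -
    have ex: "\<exists>i. nb i z = y" if "(y, z) \<in> A0 \<or> (z, y) \<in> A0" for y
      using nb_all[of z y] that A0_sub by (auto simp: adj_iff)
    show "(\<exists>y. y \<notin> ?S \<and> (y, z) \<in> A0 \<and> \<phi> y = c) \<longleftrightarrow>
        (\<exists>i. (\<forall>a<length W. nb i z \<noteq> ?v a) \<and> (nb i z, z) \<in> A0 \<and> col0 (nb i z) = c)"
      unfolding notS[symmetric] using ex off by metis
    show "(\<exists>y. y \<notin> ?S \<and> (z, y) \<in> A0 \<and> \<phi> y = c) \<longleftrightarrow>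
        (\<exists>i. (\<forall>a<length W. nb i z \<noteq> ?v a) \<and> (z, nb i z) \<in> A0 \<and> col0 (nb i z) = c)"
      unfolding notS[symmetric] using ex off by metis
  qed
  have key: "badq W E q x \<longleftrightarrow> bad_path A0 ?S ?S \<phi> (map ?v q)" if q: "\<forall>a<length q. q ! a < length W" for q
  proof (cases "q = []")
    case False
    have hl: "hd (map ?v q) = ?v (q ! 0)" "last (map ?v q) = ?v (q ! (length q - 1))"
      using False by (simp_all add: hd_conv_nth last_conv_nth hd_map last_map)
    have sub: "set (map ?v q) \<subseteq> ?S"
    proof
      fix y assume "y \<in> set (map ?v q)"
      then obtain i where "i < length q" "y = ?v (q ! i)" by (auto simp: in_set_conv_nth)
      then show "y \<in> ?S" unfolding S using q by blast
    qed
    have len: "0 < length q" "length q - 1 < length q" using False by auto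
    have col: "\<phi> (?v (q ! a)) = l (E ! (q ! a)) (?v (q ! a))" if "a < length q" for a
      using on q that by blast
    have all: "(\<forall>y\<in>set (map ?v q). \<phi> y = c) \<longleftrightarrow> (\<forall>a<length q. l (E ! (q ! a)) (?v (q ! a)) = c)" for c
      using col by (auto simp: all_set_conv_all_nth)
    have ex: "(\<exists>c. (\<forall>a<length q. f a = c) \<and> P c) \<longleftrightarrow> (\<forall>a<length q. f a = f 0) \<and> P (f 0)" for f :: "nat \<Rightarrow> 'b" and P
      using len(1) by metis
    show ?thesis
      unfolding badq_def bad_path_def all hl nbr ex
      using False q sub by (simp add: successively_conv_nth)
  qed (simp add: badq_def bad_path_def)
  show ?thesis
  proof
    assume "\<exists>q. badq W E q x"
    then obtain q where q: "badq W E q x" by blast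
    then have "\<forall>a<length q. q ! a < length W" by (simp add: badq_def)
    then show "\<exists>p. bad_path A0 ?S ?S \<phi> p" using key q by blast
  next
    assume "\<exists>p. bad_path A0 ?S ?S \<phi> p"
    then obtain p where p: "bad_path A0 ?S ?S \<phi> p" by blast
    then have "\<forall>y\<in>set p. \<exists>a. a < length W \<and> ?v a = y" unfolding bad_path_def using S by blast
    then obtain f where f: "\<And>y. y \<in> set p \<Longrightarrow> f y < length W \<and> ?v (f y) = y" by metis
    have "map ?v (map f p) = p" using f by (auto intro: map_idI)
    moreover have "\<forall>a<length (map f p). map f p ! a < length W" using f by simp
    ultimately show "\<exists>q. badq W E q x" using key[of "map f p"] p by metis
  qed
qed

lemma good_vs: assumes "good W x" shows "distinct (vs W x)"
  using assms by (auto simp: good_def vs_def violator_def ucycle_def)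

text \<open>A slack vertex has a color that is missing on one side in \<open>A0\<close>. For a
  violator the extension avoids bad paths of \<open>A\<close>, hence also those of the subset
  \<open>A0\<close>.\<close>

lemma good_coloring_exists:
  assumes x: "x \<in> space X" and g: "good W x"
  shows "\<exists>E. length E = length W \<and> (\<forall>q. \<not> badq W E q x)"
proof -
  let ?S = "set (vs W x)"
  have S_sub: "?S \<subseteq> space X" using nw_space[OF x] by (auto simp: vs_def)
  have irr0: "irrefl A0" using irr A0_sub by (auto simp: irrefl_def)
  have "\<exists>\<phi>. (\<forall>y. y \<notin> ?S \<longrightarrow> \<phi> y = col0 y) \<and> (\<forall>y\<in>?S. \<phi> y \<in> L y) \<and> (\<forall>p. \<not> bad_path A0 ?S ?S \<phi> p)"
  proof (cases "W = [[]] \<and> slack x")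
    case True
    then have S: "?S = {x}" by (simp add: vs_def)
    have pick: "\<exists>c\<in>L x. c \<notin> col0 ` D" if "finite D" "card D < card (L x)" for D
    proof (rule ccontr)
      assume "\<not> ?thesis"
      then have "card (L x) \<le> card (col0 ` D)" using that(1) by (intro card_mono) auto
      then show False using card_image_le[OF that(1), of col0] that(2) by linarith
    qed
    have no: "\<not> bad_path A0 {x} {} col0 p" for p by (auto simp: bad_path_def)
    have "\<exists>c\<in>L x. \<forall>p. \<not> bad_path A0 {x} (insert x {}) (col0(x := c)) p"
    proof (cases "card (A0 `` {x}) < card (L x)")
      case True
      then obtain c where c: "c \<in> L x" "c \<notin> col0 ` (A0 `` {x})" using pick finite_out0(1)[OF x] by blast
      have "\<not> bad_path A0 {x} (insert x {}) (col0(x := c)) p" for p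
        by (rule no_bad_path_insert_out[OF no _ _ _ irr0]) (use c(2) in auto)
      then show ?thesis using c(1) by blast
    next
      case False
      then have "card (A0\<inverse> `` {x}) < card (L x)" using True by (auto simp: slack_def)
      then obtain c where c: "c \<in> L x" "c \<notin> col0 ` (A0\<inverse> `` {x})" using pick finite_out0(2)[OF x] by blast
      have "\<not> bad_path A0 {x} (insert x {}) (col0(x := c)) p" for p
        by (rule no_bad_path_insert_in[OF no _ _ _ irr0]) (use c(2) in auto)
      then show ?thesis using c(1) by blast
    qed
    then obtain c where "c \<in> L x" "\<forall>p. \<not> bad_path A0 {x} {x} (col0(x := c)) p" by blast
    then show ?thesis unfolding S by (intro exI[of _ "col0(x := c)"]) auto
  next
    case False
    then have viol: "violator A (vs W x)" and ns: "\<And>y. y \<in> ?S \<Longrightarrow> \<not> slack y"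
      using g unfolding good_def vs_def by (auto simp: in_set_conv_nth)
    have sp: "y \<in> space X" if "y \<in> ?S" for y using S_sub that by blast
    obtain \<phi> where \<phi>: "\<And>y. y \<notin> ?S \<Longrightarrow> \<phi> y = col0 y" "\<And>y. y \<in> ?S \<Longrightarrow> \<phi> y \<in> L y"
      "\<And>p. \<not> bad_path A ?S ?S \<phi> p"
    proof (rule violator_extension[OF irr viol, of L col0])
      show "finite (A `` {y}) \<and> finite (A\<inverse> `` {y}) \<and> finite (L y)" if "y \<in> ?S" for y
        using finite_out[OF sp[OF that]] L_fin[OF sp[OF that]] by blast
      show "card (A `` {y}) = card (L y) \<and> card (A\<inverse> `` {y}) = card (L y)" if "y \<in> ?S" for y
        using not_slack(3,4)[OF sp[OF that] ns[OF that]] by blast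
    qed (rule that; blast)
    then show ?thesis using bad_path_mono[OF _ A0_sub] by blast
  qed
  then obtain \<phi> where \<phi>: "\<And>y. y \<notin> ?S \<Longrightarrow> \<phi> y = col0 y" "\<And>y. y \<in> ?S \<Longrightarrow> \<phi> y \<in> L y"
    "\<And>p. \<not> bad_path A0 ?S ?S \<phi> p" by blast
  have "\<exists>i. l i y = \<phi> y" if "y \<in> ?S" for y
  proof -
    have "\<phi> y \<in> range (\<lambda>i. l i y)" using \<phi>(2)[OF that] l_range S_sub that by blast
    then show ?thesis by auto
  qed
  then obtain f where f: "\<And>y. y \<in> ?S \<Longrightarrow> l (f y) y = \<phi> y" by metis
  let ?E = "map f (vs W x)"
  have len: "length ?E = length W" by (simp add: vs_def)
  have on: "\<phi> (nw (W ! a) x) = l (?E ! a) (nw (W ! a) x)" if "a < length W" for a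
  proof -
    have "?E ! a = f (nw (W ! a) x)" "nw (W ! a) x \<in> ?S" using that by (auto simp: vs_def)
    then show ?thesis using f by simp
  qed
  have "\<not> (\<exists>q. badq W ?E q x)" using badq_iff[OF x on \<phi>(1)] \<phi>(3) by blast
  then show ?thesis using len by blast
qed

definition eidx :: "'a \<Rightarrow> nat" where
  "eidx x = (LEAST m. length (from_nat m :: nat list) = length (code x) \<and> (\<forall>q. \<not> badq (code x) (from_nat m) q x))"

lemma eidx_meas [measurable]: "eidx \<in> measurable X (count_space UNIV)"
proof -
  have "(\<lambda>x. LEAST m. length (from_nat m :: nat list) = length W \<and> (\<forall>q. \<not> badq W (from_nat m) q x))
      \<in> measurable X (count_space UNIV)" for W
    by (intro measurable_Least) measurable
  then have "(\<lambda>x. LEAST m. length (from_nat m :: nat list) = length (from_nat (gcode x) :: nat list list)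
      \<and> (\<forall>q. \<not> badq (from_nat (gcode x)) (from_nat m) q x)) \<in> measurable X (count_space UNIV)"
    by (rule measurable_compose_countable[OF _ gcode_meas])
  then show ?thesis by (simp add: eidx_def[abs_def] code_def)
qed

lemma eidx_valid:
  assumes x: "x \<in> space X" "marker x"
  shows "length (from_nat (eidx x) :: nat list) = length (code x)" "\<not> badq (code x) (from_nat (eidx x)) q x"
proof -
  let ?P = "\<lambda>m. length (from_nat m :: nat list) = length (code x) \<and> (\<forall>q. \<not> badq (code x) (from_nat m) q x)"
  have "good (code x) x" using x(2) by (simp add: marker_def M0_def)
  then obtain E where "length E = length (code x)" "\<forall>q. \<not> badq (code x) E q x"
    using good_coloring_exists[OF x(1)] by blast
  then have "?P (to_nat E)" by simp
  then have "?P (eidx x)" unfolding eidx_def by (rule LeastI)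
  then show "length (from_nat (eidx x) :: nat list) = length (code x)" "\<not> badq (code x) (from_nat (eidx x)) q x"
    by blast+
qed

text \<open>A relation over words and positions, which makes it Borel. At vertices of marked sets
  its value turns out to be unique, so the use of \<open>LEAST\<close> involves no choice
  there.\<close>

definition owner_idx :: "'a \<Rightarrow> nat \<Rightarrow> bool" where
  "owner_idx y i \<longleftrightarrow> (\<exists>k m w. gcode y = k \<and> marker (nw w y) \<and> eidx (nw w y) = m
     \<and> (\<exists>a<length (from_nat k :: nat list list). nw ((from_nat k :: nat list list) ! a) (nw w y) = y
          \<and> i = (from_nat m :: nat list) ! a))"

definition idx :: "'a \<Rightarrow> nat" where
  "idx y = (if B y then LEAST i. owner_idx y i else idx0 y)"

definition col :: "'a \<Rightarrow> 'b" where "col y = l (idx y) y"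

lemma idx_meas [measurable]: "idx \<in> measurable X (count_space UNIV)"
proof -
  have [measurable]: "(\<lambda>x. eidx (nw w x)) \<in> measurable X (count_space UNIV)" "Measurable.pred X (\<lambda>x. marker (nw w x))" for w
    by (rule measurable_compose[OF nw_meas eidx_meas], rule measurable_compose[OF nw_meas marker_meas])
  have [measurable]: "Measurable.pred X (\<lambda>y. owner_idx y i)" for i
    unfolding owner_idx_def by measurable
  have [measurable]: "(\<lambda>y. LEAST i. owner_idx y i) \<in> measurable X (count_space UNIV)"
    by (intro measurable_Least) measurable
  show ?thesis unfolding idx_def[abs_def] by measurable
qed

lemma col_meas: "col \<in> measurable X (borel_of Y)"
  unfolding col_def[abs_def] by (rule measurable_compose_countable[OF l_meas idx_meas])

lemma col_outside: "\<not> B y \<Longrightarrow> col y = col0 y"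
  by (simp add: col_def col0_def idx_def)

lemma mset_B: assumes "x \<in> space X" "marker x" "y \<in> mset x" shows "B y" "y \<in> space X"
proof -
  obtain a where "y = nw (code x ! a) x" using assms(3) unfolding mset_nw by blast
  then show y: "y \<in> space X" using nw_space[OF assms(1)] by simp
  obtain w where "nw w y = x" using nw_rev[OF assms(1)] \<open>y = _\<close> by blast
  then show "B y" unfolding B_iff[OF y] using assms by metis
qed

text \<open>Markers whose sets share a vertex coincide, and the vertices of a good set are distinct,
  so owner and position are determined.\<close>

lemma col_mset:
  assumes x: "x \<in> space X" "marker x" and a: "a < length (code x)"
  shows "col (nw (code x ! a) x) = l ((from_nat (eidx x) :: nat list) ! a) (nw (code x ! a) x)"
proof -
  let ?y = "nw (code x ! a) x"
  have mem: "?y \<in> mset x" using a unfolding mset_nw by blast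
  note By = mset_B[OF x mem]
  obtain w0 where w0: "nw w0 ?y = x" using nw_rev[OF x(1)] by blast
  have cy: "code ?y = code x" using code_nw[OF x(1)] .
  have cg: "(from_nat (gcode ?y) :: nat list list) = code x" using cy by (simp add: code_def)
  have "owner_idx ?y i \<longleftrightarrow> i = (from_nat (eidx x) :: nat list) ! a" for i
  proof
    assume i: "i = (from_nat (eidx x) :: nat list) ! a"
    show "owner_idx ?y i"
      unfolding owner_idx_def
      by (rule exI[of _ "gcode ?y"], rule exI[of _ "eidx x"], rule exI[of _ w0]) (use w0 x(2) a cg i in auto)
  next
    assume "owner_idx ?y i"
    then obtain w b where wb: "marker (nw w ?y)" "b < length (code x)" "nw (code x ! b) (nw w ?y) = ?y"
      "i = (from_nat (eidx (nw w ?y)) :: nat list) ! b"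
      unfolding owner_idx_def using cg by auto
    have "?y \<in> mset (nw w ?y)" unfolding mset_nw using wb(2,3) code_nw[OF By(2)] cy by auto
    then have "nw (code x ! a @ w) x = x"
      by (intro marker_apart[OF x _ mem, of "code x ! a @ w" ?y]) (use wb(1) in simp_all)
    then have eq: "nw w ?y = x" by simp
    have "distinct (vs (code x) x)" using x(2) by (intro good_vs) (simp add: marker_def M0_def)
    then have "b = a" using wb(2,3) a unfolding eq by (simp add: vs_def distinct_conv_nth) (metis nth_map)
    then show "i = (from_nat (eidx x) :: nat list) ! a" using wb(4) eq by simp
  qed
  then have "(LEAST i. owner_idx ?y i) = (from_nat (eidx x) :: nat list) ! a" by (simp add: Least_equality)
  then show ?thesis using By(1) by (simp add: col_def idx_def)
qed

text \<open>A monochromatic dicycle that meets \<open>B\<close> contains a segment in a marked set.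
  Vertices next to this set lie in no other marked set and thus have the color \<open>col0\<close>,
  for which the set was colored; so the segment would be a bad path.\<close>

lemma col_dicoloring: "dicoloring A col"
  unfolding dicoloring_def
proof (intro allI impI notI)
  fix ys assume d: "dicycle A ys" and "\<exists>b. \<forall>y\<in>set ys. col y = b"
  then obtain c where c: "\<And>y. y \<in> set ys \<Longrightarrow> col y = c" by blast
  show False
  proof (cases "\<exists>y\<in>set ys. B y")
    case False
    then show False using col0_dicycle[OF d, of c] c col_outside by metis
  next
    case True
    then obtain s where s: "s \<in> set ys" "B s" by blast
    have sX: "s \<in> space X"
    proof -
      obtain a where "a < length ys" "s = ys ! a" using s(1) by (auto simp: in_set_conv_nth)
      then show ?thesis using dicycle_arc[OF d, of a] A_sub by auto
    qed
    obtain w where w: "marker (nw w s)" "s \<in> mset (nw w s)" using s(2) B_iff[OF sX] by blast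
    define x where "x = nw w s"
    have x: "x \<in> space X" "marker x" "s \<in> mset x" using w nw_space[OF sX] by (auto simp: x_def)
    let ?S = "mset x"
    define \<phi> where "\<phi> y = (if y \<in> ?S then col y else col0 y)" for y
    have on: "\<phi> (nw (code x ! a) x) = l ((from_nat (eidx x) :: nat list) ! a) (nw (code x ! a) x)"
      if "a < length (code x)" for a
      using col_mset[OF x(1,2) that] that unfolding \<phi>_def mset_nw by auto
    have off: "\<phi> y = col0 y" if "y \<notin> set (vs (code x) x)" for y
      using that by (simp add: \<phi>_def mset_def)
    have none: "\<not> bad_path A0 ?S ?S \<phi> p" for p
      using badq_iff[OF x(1) on off] eidx_valid(2)[OF x(1,2)] unfolding mset_def by blast
    obtain p where p: "p \<noteq> []" "set p \<subseteq> ?S" "set p \<subseteq> set ys" "successively (\<lambda>x y. (x, y) \<in> A0) p"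
      "(last p, hd p) \<in> A0 \<or> (\<exists>y\<in>set ys - ?S. (y, hd p) \<in> A0) \<and> (\<exists>y\<in>set ys - ?S. (last p, y) \<in> A0)"
      by (rule dicycle_segment[OF dicycle_A0[OF d] s(1) x(3)])
    have outer: "\<phi> y = c" if y: "y \<in> set ys - ?S" "t \<in> ?S" "adj A t y" for y t
    proof -
      have yX: "y \<in> space X" using adj_space[OF y(3)] by blast
      have "\<not> B y"
      proof
        assume "B y"
        then obtain w' where w': "marker (nw w' y)" "y \<in> mset (nw w' y)" using B_iff[OF yX] by blast
        obtain a where "t = nw (code x ! a) x" using y(2) unfolding mset_nw by blast
        moreover obtain i where "nb i t = y" using nb_all[OF y(3)] by blast
        ultimately have eq: "nw w' y = nw (code x ! a @ i # w') x" by simp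
        have "nw w' y = x"
          using marker_apart[OF x(1,2), of "code x ! a @ i # w'" t y] w' y(2,3) unfolding eq by blast
        then show False using w'(2) y(1) by simp
      qed
      then have "\<phi> y = col y" using y(1) col_outside by (simp add: \<phi>_def)
      then show ?thesis using y(1) c by simp
    qed
    have hl: "hd p \<in> ?S" "last p \<in> ?S" using p(1,2) by auto
    have "\<exists>y. y \<notin> ?S \<and> (y, hd p) \<in> A0 \<and> \<phi> y = c" if "y \<in> set ys - ?S" "(y, hd p) \<in> A0" for y
      using outer[OF that(1) hl(1)] that A0_sub by (auto simp: adj_iff)
    moreover have "\<exists>y. y \<notin> ?S \<and> (last p, y) \<in> A0 \<and> \<phi> y = c" if "y \<in> set ys - ?S" "(last p, y) \<in> A0" for y
      using outer[OF that(1) hl(2)] that A0_sub by (auto simp: adj_iff)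
    moreover have "\<forall>y\<in>set p. \<phi> y = c" using p(2,3) c by (auto simp: \<phi>_def)
    ultimately have "bad_path A0 ?S ?S \<phi> p" unfolding bad_path_def using p(1,2,4,5) by blast
    then show False using none by blast
  qed
qed

theorem Borel_list_dicoloring_exists: "\<exists>c. Borel_list_dicoloring X A Y L c"
proof -
  have "col x \<in> L x" if "x \<in> space X" for x using l_range[OF that] by (auto simp: col_def)
  then show ?thesis unfolding Borel_list_dicoloring_def using col_meas col_dicoloring by blast
qed

end

theorem theorem1p8:
  fixes X :: "'a measure" and A :: "('a \<times> 'a) set"
  assumes "Borel_digraph X A"
    and "bounded_degree (space X) A"
    and "\<forall>C\<in>conn_components (space X) A. \<not> Gallai_tree A C"
  shows "Borel_degree_list_dicolorable TYPE('b) X A"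
  unfolding Borel_degree_list_dicolorable_def
proof (intro allI impI, elim conjE)
  fix Y :: "'b topology" and L
  assume Y: "Polish_space Y" and L: "L \<in> measurable X (finite_subsets Y)"
    and deg: "\<forall>x\<in>space X. maxdeg A x \<le> card (L x)"
  have X: "standard_Borel X" and irr: "irrefl A" and sub: "A \<subseteq> space X \<times> space X" and A: "A \<in> sets (X \<Otimes>\<^sub>M X)"
    using assms(1) by (auto simp: Borel_digraph_def dgraph_def)
  obtain N where N: "\<And>x. x \<in> space X \<Longrightarrow> finite {y. adj A x y} \<and> card {y. adj A x y} \<le> N"
    using assms(2) unfolding bounded_degree_def by blast
  have "underlying A \<in> sets (X \<Otimes>\<^sub>M X)"
  proof -
    have "(\<lambda>z. (snd z, fst z)) -` A \<inter> space (X \<Otimes>\<^sub>M X) \<in> sets (X \<Otimes>\<^sub>M X)"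
      using A by (intro measurable_sets[of _ _ "X \<Otimes>\<^sub>M X"]) measurable
    moreover have "underlying A = A \<union> ((\<lambda>z. (snd z, fst z)) -` A \<inter> space (X \<Otimes>\<^sub>M X))"
      using sub by (auto simp: underlying_def space_pair_measure)
    ultimately show ?thesis using A by auto
  qed
  note und = this
  obtain nb :: "nat \<Rightarrow> 'a \<Rightarrow> 'a" where nb: "\<And>i. nb i \<in> measurable X X"
    "\<And>x i. x \<in> space X \<Longrightarrow> nb i x = x \<or> adj A x (nb i x)" "\<And>x y. adj A x y \<Longrightarrow> \<exists>i. nb i x = y"
  proof (rule bounded_sections_selectors[OF X und])
    show "finite {y. adj A x y} \<and> card {y. adj A x y} \<le> N" if "x \<in> space X" for x by (rule N[OF that])
  next
    fix n :: "nat \<Rightarrow> 'a \<Rightarrow> 'a" assume n: "\<And>i. n i \<in> measurable X X" "\<And>x i. x \<in> space X \<Longrightarrow> n i x = x \<or> adj A x (n i x)"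
      "\<And>x y. adj A x y \<Longrightarrow> \<exists>i. n i x = y"
    show thesis by (rule that[of n]) (fact n)+
  qed
  obtain \<kappa> :: "'a \<Rightarrow> real" where \<kappa>: "\<kappa> \<in> borel_measurable X" "inj_on \<kappa> (space X)"
    by (rule standard_Borel_embedding[OF X]) (rule that)
  \<comment> \<open>An isolated vertex forms a component without blocks, which is a Gallai tree. So
    all degrees are positive and the lists are nonempty, as their enumeration requires.\<close>
  have nbr: "\<exists>y. adj A x y" if x: "x \<in> space X" for x
  proof (rule ccontr)
    assume none: "\<not> ?thesis"
    have "y = x" if "(x, y) \<in> (underlying A)\<^sup>*" for y
      using that none by (cases rule: converse_rtranclE) auto
    then have "{y \<in> space X. (x, y) \<in> (underlying A)\<^sup>*} = {x}" using x by auto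
    then have "{x} \<in> conn_components (space X) A" unfolding conn_components_def using x by blast
    moreover have "\<not> block {x} (Restr A {x}) S" for S
    proof
      assume "block {x} (Restr A {x}) S"
      then have "S \<subseteq> {x}" "\<exists>a\<in>S. \<exists>b\<in>S. a \<noteq> b" by (simp_all add: block_def biconnected_def)
      then show False by blast
    qed
    then have "Gallai_tree A {x}" by (simp add: Gallai_tree_def)
    ultimately show False using assms(3) by blast
  qed
  have "L x \<noteq> {}" if x: "x \<in> space X" for x
  proof -
    obtain y where y: "adj A x y" using nbr[OF x] by blast
    have fin: "finite {y. (x, y) \<in> A}" "finite {y. (y, x) \<in> A}"
      using N[OF x] by (auto simp: adj_iff elim: rev_finite_subset)
    have "0 < maxdeg A x"
      using y fin unfolding maxdeg_def outdeg_def indeg_def adj_iff by (auto simp: card_gt_0_iff less_max_iff_disj)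
    then show ?thesis using deg x by force
  qed
  then obtain l :: "nat \<Rightarrow> 'a \<Rightarrow> 'b" where l: "\<And>i. l i \<in> measurable X (borel_of Y)"
    "\<And>x. x \<in> space X \<Longrightarrow> range (\<lambda>i. l i x) = L x"
    using finite_subsets_enumeration[OF Y L] by blast
  interpret borel_setting X A nb \<kappa> Y L l
    by unfold_locales
      (use irr sub A N nb \<kappa> Y l deg finite_subsetsD(1)[OF L] assms(3) in auto)
  show "\<exists>c. Borel_list_dicoloring X A Y L c" by (rule Borel_list_dicoloring_exists)
qed

end
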